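(* Let $(G,c)$ be a resistance network with energy space $\mathcal{H}_{\mathcal{E}}$, energy kernel $\{v_x\}_{x\in G}$, Gel'fand triple $\mathcal{S}\subseteq\mathcal{H}_{\mathcal{E}}\subseteq\mathcal{S}'$, pairing $\langle\cdot,\cdot\rangle_{\mathcal{W}}$ and probability measure $\mathbb{P}$ on $\mathcal{S}'$ as defined in the context. The Wiener transform $$\mathcal{W}:\mathcal{H}_{\mathcal{E}}\to L^2(\mathcal{S}',\mathbb{P}),\qquad \mathcal{W}:v\mapsto\tilde v,\qquad \tilde v(\xi):=\langle v,\xi\rangle_{\mathcal{W}},$$ is an isometry. The extended reproducing kernel $\{\tilde v_x\}_{x\in G}$ is a system of Gaussian random variables on $(\mathcal{S}',\mathbb{P})$ which gives the free effective resistance by $$R^F(x,y)=\mathbb{E}\big((\tilde v_x-\tilde v_y)^2\big)\qquad\text{for all }x,y\in G.$$ Moreover, for any $u,v\in\mathcal{H}_{\mathcal{E}}$, $$\langle u,v\rangle_{\mathcal{E}}=\mathbb{E}\big(\overline{\tilde u}\,\tilde v\big)=\int_{\mathcal{S}'}\overline{\tilde u}\,\tilde v\,d\mathbb{P}.$$ Here $\mathbb{E}(f):=\int_{\mathcal{S}'}f(\xi)\,d\mathbb{P}(\xi)$.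
   Context: A resistance network $(G,c)$ is a connected graph with vertex set $G^{0}$ (one writes $x\in G$ for $x\in G^{0}$) together with a symmetric conductance function $c_{xy}=c_{yx}\in[0,\infty)$; adjacency $x\sim y$ means $c_{xy}>0$; $c_{xx}=0$; and $c(x):=\sum_{y\sim x}c_{xy}<\infty$ for each $x$. A vertex $o$ is fixed. Laplacian: $(\Delta v)(x):=\sum_{y\sim x}c_{xy}(v(x)-v(y))$. Energy: $\mathcal{E}(u,v):=\frac12\sum_{x,y\in G}c_{xy}(\overline{u(x)}-\overline{u(y)})(v(x)-v(y))$, $\mathcal{E}(u):=\mathcal{E}(u,u)$, $\operatorname{dom}\mathcal{E}:=\{u:G^{0}\to\mathbb{C}:\mathcal{E}(u)<\infty\}$. The energy space is the Hilbert space $\mathcal{H}_{\mathcal{E}}:=\operatorname{dom}\mathcal{E}/\mathbb{C}\mathbf{1}$ with inner product $\langle u,v\rangle_{\mathcal{E}}:=\mathcal{E}(u,v)$. Energy kernel: $v_x\in\mathcal{H}_{\mathcal{E}}$ is the unique element with $\langle v_x,u\rangle_{\mathcal{E}}=u(x)-u(o)$ for all $u\in\mathcal{H}_{\mathcal{E}}$ (it has an $\mathbb{R}$-valued representative). $\mathrm{Fin}$ is the $\mathcal{E}$-closure of the span of the Dirac masses, and $f_x$ is the orthogonal projection of $v_x$ to $\mathrm{Fin}$. A monopole at $x$ is $w_x\in\mathcal{H}_{\mathcal{E}}$ with $\Delta w_x=\delta_x$ pointwise. If monopoles exist, $w_o$ is the energy-minimizing monopole at $o$, $w_x^v:=v_x+w_o$,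 $w_x^f:=f_x+w_o$. Let $\mathcal{M}:=\operatorname{span}\{v_x\}+\operatorname{span}\{w_x^v,w_x^f\}$ (just $\operatorname{span}\{v_x\}$ if there are no monopoles), and let $\Delta_{\mathcal{M}}$ be the closure in $\mathcal{H}_{\mathcal{E}}$ of $\Delta$ with dense domain $\mathcal{M}$; it is Hermitian and commutes with complex conjugation, so has self-adjoint extensions. Let $\Delta_{\mathcal{S}}$ be a self-adjoint extension of $\Delta_{\mathcal{M}}$. Test functions and distributions: $\mathcal{S}:=\bigcap_{p=1}^\infty\operatorname{dom}(\Delta_{\mathcal{S}}^p)$, with the Fréchet topology given by the seminorms $\|u\|_p:=\|\Delta_{\mathcal{S}}^pu\|_{\mathcal{E}}$, $p\in\mathbb{N}$; $\mathcal{S}'$ is the space of linear functionals on $\mathcal{S}$ continuous for this topology. Here $\mathcal{S}$ and $\mathcal{S}'$ consist of $\mathbb{R}$-valued objects. $\mathcal{S}\subseteq\mathcal{H}_{\mathcal{E}}\subseteq\mathcal{S}'$ is regarded as a Gel'fand triple ($\mathcal{S}$ dense in $\mathcal{H}_{\mathcal{E}}$ and continuously included in it). Pairing: for $u\in\mathcal{S}$ and $\xi\in\mathcal{S}'$, $\langle u,\xi\rangle_{\mathcal{W}}:=\langle\Delta_{\mathcal{S}}^pu,\Delta_{\mathcal{S}}^{-p}\xi\rangle_{\mathcal{E}}$ for any integer $p$ such that $|\xi(u)|\le K\|\Delta_{\mathcal{S}}^pu\|_{\mathcal{E}}$ for all $u\in\mathcal{S}$; equivalently $\langle u,\xi\rangle_{\mathcal{W}}=\lim_{n\to\infty}\xi(E_nu)$,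 where $E_n$ is the spectral projection of $\Delta_{\mathcal{S}}$ for the interval $[\frac1n,n]$ (which maps $\mathcal{H}_{\mathcal{E}}$ into $\mathcal{S}$). It is extended to $u\in\mathcal{H}_{\mathcal{E}}$ by $\langle u,\xi\rangle_{\mathcal{W}}=\lim_{n\to\infty}\langle u,\tilde E_n\xi\rangle_{\mathcal{E}}$, where $\tilde E_n\xi\in\mathcal{H}_{\mathcal{E}}$ is defined by $\langle u,\tilde E_n\xi\rangle_{\mathcal{E}}:=\xi(E_nu)$. For complex-valued $u=u_1+\mathrm{i}u_2$ with $u_1,u_2$ real-valued, $\tilde u=\tilde u_1+\mathrm{i}\tilde u_2$. Measure: $\mathbb{P}$ is the Radon probability measure on $\mathcal{S}'$ corresponding, by Minlos' theorem applied to the Gel'fand triple $\mathcal{S}\subseteq\mathcal{H}_{\mathcal{E}}\subseteq\mathcal{S}'$, to the positive definite function $s\mapsto e^{-\frac12\|s\|_{\mathcal{E}}^2}$, i.e. $\int_{\mathcal{S}'}e^{\mathrm{i}\langle s,\xi\rangle_{\mathcal{W}}}\,d\mathbb{P}(\xi)=e^{-\frac12\|s\|_{\mathcal{E}}^2}$ for all $s\in\mathcal{S}$. Free resistance: for a finite connected network $H$ containing $x,y$, the effective resistance is $R_H(x,y)=v(x)-v(y)$ where $v$ is any solution on $H$ of $\Delta v=\delta_x-\delta_y$ ($\Delta$ being the Laplacian of $H$). For an infinite network, $R^F(x,y):=\lim_{k\to\infty}R_{G_k}(x,y)$, where $\{G_k\}$ is any increasing sequence of finite connected full subnetworks (all edges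 of $G$ between their vertices, with the same conductances) with union $G$ and containing $x,y$.
   Formalization: The self-adjoint extension Δ_S is assumed to commute with complex conjugation; otherwise the spectral projections E_n need not map real-valued elements into the R-valued space S, and the pairing ξ(E_n u) is undefined. *)

theory Defs
  imports "HOL-Probability.Probability"
begin

text \<open>The vertex set is a type \<open>'v\<close>; a class in \<open>'v potential\<close> is a complex function on the
  vertices modulo the constants. The energy space will be a subset of this type.\<close>

quotient_type 'v potential = "'v \<Rightarrow> complex" / "\<lambda>f g. \<exists>k. \<forall>x. f x = g x + k"
proof (rule equivpI)
  show "reflp (\<lambda>f g :: 'v \<Rightarrow> complex. \<exists>k. \<forall>x. f x = g x + k)"
    by (auto intro!: reflpI exI[of _ 0])
  show "symp (\<lambda>f g :: 'v \<Rightarrow> complex. \<exists>k. \<forall>x. f x = g x + k)"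
  proof (rule sympI)
    fix f g :: "'v \<Rightarrow> complex" assume "\<exists>k. \<forall>x. f x = g x + k"
    then obtain k where "\<forall>x. f x = g x + k" by blast
    then show "\<exists>k. \<forall>x. g x = f x + k" by (intro exI[of _ "-k"]) auto
  qed
  show "transp (\<lambda>f g :: 'v \<Rightarrow> complex. \<exists>k. \<forall>x. f x = g x + k)"
  proof (rule transpI)
    fix f g h :: "'v \<Rightarrow> complex"
    assume "\<exists>k. \<forall>x. f x = g x + k" "\<exists>k. \<forall>x. g x = h x + k"
    then obtain k l where "\<forall>x. f x = g x + k" "\<forall>x. g x = h x + l" by blast
    then show "\<exists>k. \<forall>x. f x = h x + k" by (intro exI[of _ "l + k"]) auto
  qed
qed

lift_definition pot :: "('v \<Rightarrow> complex) \<Rightarrow> 'v potential" is "\<lambda>f. f" .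

instantiation potential :: (type) ab_group_add
begin

lift_definition zero_potential :: "'a potential" is "\<lambda>_. 0" .

lift_definition plus_potential :: "'a potential \<Rightarrow> 'a potential \<Rightarrow> 'a potential"
  is "\<lambda>f g x. f x + g x"
proof -
  fix f f' g g' :: "'a \<Rightarrow> complex"
  assume "\<exists>k. \<forall>x. f x = f' x + k" "\<exists>k. \<forall>x. g x = g' x + k"
  then obtain k l where "\<forall>x. f x = f' x + k" "\<forall>x. g x = g' x + l" by blast
  then show "\<exists>k. \<forall>x. f x + g x = f' x + g' x + k" by (intro exI[of _ "k + l"]) auto
qed

lift_definition uminus_potential :: "'a potential \<Rightarrow> 'a potential" is "\<lambda>f x. - f x"
proof -
  fix f f' :: "'a \<Rightarrow> complex"
  assume "\<exists>k. \<forall>x. f x = f' x + k"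
  then obtain k where "\<forall>x. f x = f' x + k" by blast
  then show "\<exists>k. \<forall>x. - f x = - f' x + k" by (intro exI[of _ "- k"]) auto
qed

lift_definition minus_potential :: "'a potential \<Rightarrow> 'a potential \<Rightarrow> 'a potential"
  is "\<lambda>f g x. f x - g x"
proof -
  fix f f' g g' :: "'a \<Rightarrow> complex"
  assume "\<exists>k. \<forall>x. f x = f' x + k" "\<exists>k. \<forall>x. g x = g' x + k"
  then obtain k l where "\<forall>x. f x = f' x + k" "\<forall>x. g x = g' x + l" by blast
  then show "\<exists>k. \<forall>x. f x - g x = f' x - g' x + k" by (intro exI[of _ "k - l"]) auto
qed

instance
  by standard (transfer; auto intro!: exI[of _ 0])+

end

lift_definition cscale :: "complex \<Rightarrow> 'v potential \<Rightarrow> 'v potential" is "\<lambda>a f x. a * f x"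
proof -
  fix a and f f' :: "'v \<Rightarrow> complex"
  assume "\<exists>k. \<forall>x. f x = f' x + k"
  then obtain k where "\<forall>x. f x = f' x + k" by blast
  then show "\<exists>k. \<forall>x. a * f x = a * f' x + k" by (intro exI[of _ "a * k"]) (auto simp: algebra_simps)
qed

global_interpretation pot: vector_space cscale
  by standard (transfer; auto simp: algebra_simps intro!: exI[of _ 0])+

lift_definition pot_cnj :: "'v potential \<Rightarrow> 'v potential" is "\<lambda>f x. cnj (f x)"
proof -
  fix f f' :: "'v \<Rightarrow> complex"
  assume "\<exists>k. \<forall>x. f x = f' x + k"
  then obtain k where "\<forall>x. f x = f' x + k" by blast
  then show "\<exists>k. \<forall>x. cnj (f x) = cnj (f' x) + k" by (intro exI[of _ "cnj k"]) auto
qed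

lift_definition pot_Re :: "'v potential \<Rightarrow> 'v potential" is "\<lambda>f x. complex_of_real (Re (f x))"
proof -
  fix f f' :: "'v \<Rightarrow> complex"
  assume "\<exists>k. \<forall>x. f x = f' x + k"
  then obtain k where "\<forall>x. f x = f' x + k" by blast
  then show "\<exists>k. \<forall>x. complex_of_real (Re (f x)) = complex_of_real (Re (f' x)) + k"
    by (intro exI[of _ "complex_of_real (Re k)"]) auto
qed

lift_definition pot_Im :: "'v potential \<Rightarrow> 'v potential" is "\<lambda>f x. complex_of_real (Im (f x))"
proof -
  fix f f' :: "'v \<Rightarrow> complex"
  assume "\<exists>k. \<forall>x. f x = f' x + k"
  then obtain k where "\<forall>x. f x = f' x + k" by blast
  then show "\<exists>k. \<forall>x. complex_of_real (Im (f x)) = complex_of_real (Im (f' x)) + k"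
    by (intro exI[of _ "complex_of_real (Im k)"]) auto
qed

definition real_potential :: "'v potential \<Rightarrow> bool" where
  "real_potential u \<longleftrightarrow> (\<exists>f :: 'v \<Rightarrow> real. u = pot (\<lambda>x. complex_of_real (f x)))"

lift_definition pdiff :: "'v potential \<Rightarrow> 'v \<Rightarrow> 'v \<Rightarrow> complex" is "\<lambda>f x y. f x - f y"
  by (auto simp: fun_eq_iff)

definition resistance_network :: "('v \<Rightarrow> 'v \<Rightarrow> real) \<Rightarrow> bool" where
  "resistance_network c \<longleftrightarrow>
     (\<forall>x y. 0 \<le> c x y) \<and> (\<forall>x y. c x y = c y x) \<and> (\<forall>x. c x x = 0) \<and>
     (\<forall>x. c x summable_on {y. c x y > 0}) \<and>
     (\<forall>x y. (x, y) \<in> {(a, b). c a b > 0}\<^sup>*)"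

lift_definition energy :: "('v \<Rightarrow> 'v \<Rightarrow> real) \<Rightarrow> 'v potential \<Rightarrow> 'v potential \<Rightarrow> complex" is
  "\<lambda>c u v. 1 / 2 * (\<Sum>\<^sub>\<infinity>(x, y)\<in>UNIV. complex_of_real (c x y) * (cnj (u x) - cnj (u y)) * (v x - v y))"
  by (auto intro!: arg_cong[where f = "\<lambda>h. infsum h UNIV"] simp: fun_eq_iff)

lift_definition finite_energy :: "('v \<Rightarrow> 'v \<Rightarrow> real) \<Rightarrow> 'v potential \<Rightarrow> bool" is
  "\<lambda>c u. (\<lambda>(x, y). c x y * (cmod (u x - u y))\<^sup>2) summable_on UNIV"
  by (auto intro!: arg_cong[where f = "\<lambda>h. h summable_on UNIV"] simp: fun_eq_iff)

definition energy_space :: "('v \<Rightarrow> 'v \<Rightarrow> real) \<Rightarrow> 'v potential set" where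
  "energy_space c = {u. finite_energy c u}"

definition enorm :: "('v \<Rightarrow> 'v \<Rightarrow> real) \<Rightarrow> 'v potential \<Rightarrow> real" where
  "enorm c u = sqrt (Re (energy c u u))"

lift_definition laplacian :: "('v \<Rightarrow> 'v \<Rightarrow> real) \<Rightarrow> 'v potential \<Rightarrow> 'v \<Rightarrow> complex" is
  "\<lambda>c v x. \<Sum>\<^sub>\<infinity>y\<in>{y. c x y > 0}. complex_of_real (c x y) * (v x - v y)"
  by (auto simp: fun_eq_iff intro!: infsum_cong)

definition eclosure :: "('v \<Rightarrow> 'v \<Rightarrow> real) \<Rightarrow> 'v potential set \<Rightarrow> 'v potential set" where
  "eclosure c X = {u \<in> energy_space c. \<exists>s. (\<forall>n. s n \<in> X) \<and> (\<lambda>n. enorm c (s n - u)) \<longlonglongrightarrow> 0}"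

definition dirac :: "'v \<Rightarrow> 'v \<Rightarrow> complex" where
  "dirac x = (\<lambda>y. if y = x then 1 else 0)"

definition Fin :: "('v \<Rightarrow> 'v \<Rightarrow> real) \<Rightarrow> 'v potential set" where
  "Fin c = eclosure c (pot.span (range (\<lambda>x. pot (dirac x))))"

text \<open>In the following, \<open>b\<close> is the fixed base vertex.\<close>

definition energy_kernel :: "('v \<Rightarrow> 'v \<Rightarrow> real) \<Rightarrow> 'v \<Rightarrow> 'v \<Rightarrow> 'v potential" where
  "energy_kernel c b x =
     (THE v. v \<in> energy_space c \<and> (\<forall>u\<in>energy_space c. energy c v u = pdiff u x b))"

definition fin_kernel :: "('v \<Rightarrow> 'v \<Rightarrow> real) \<Rightarrow> 'v \<Rightarrow> 'v \<Rightarrow> 'v potential" where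
  "fin_kernel c b x =
     (THE f. f \<in> Fin c \<and> (\<forall>g\<in>Fin c. energy c g (energy_kernel c b x - f) = 0))"

definition monopole :: "('v \<Rightarrow> 'v \<Rightarrow> real) \<Rightarrow> 'v \<Rightarrow> 'v potential \<Rightarrow> bool" where
  "monopole c x w \<longleftrightarrow> w \<in> energy_space c \<and> laplacian c w = dirac x"

definition min_monopole :: "('v \<Rightarrow> 'v \<Rightarrow> real) \<Rightarrow> 'v \<Rightarrow> 'v potential" where
  "min_monopole c b =
     (THE w. monopole c b w \<and> (\<forall>w'. monopole c b w' \<longrightarrow> enorm c w \<le> enorm c w'))"

text \<open>Span of a union equals the sum of the spans.\<close>

definition lap_domain :: "('v \<Rightarrow> 'v \<Rightarrow> real) \<Rightarrow> 'v \<Rightarrow> 'v potential set" where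
  "lap_domain c b =
     (if \<exists>x w. monopole c x w
      then pot.span (range (energy_kernel c b)
             \<union> range (\<lambda>x. energy_kernel c b x + min_monopole c b)
             \<union> range (\<lambda>x. fin_kernel c b x + min_monopole c b))
      else pot.span (range (energy_kernel c b)))"

text \<open>An operator is given by its domain \<open>D\<close> and a function \<open>A\<close>, whose values off \<open>D\<close> are
  irrelevant.\<close>

definition op_graph :: "'v potential set \<Rightarrow> ('v potential \<Rightarrow> 'v potential)
    \<Rightarrow> ('v potential \<times> 'v potential) set" where
  "op_graph D A = {(u, A u) | u. u \<in> D}"

definition graph_closure :: "('v \<Rightarrow> 'v \<Rightarrow> real) \<Rightarrow> ('v potential \<times> 'v potential) set
    \<Rightarrow> ('v potential \<times> 'v potential) set" where
  "graph_closure c T = {(u, w). u \<in> energy_space c \<and> w \<in> energy_space c \<and>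
     (\<exists>s. (\<forall>n. s n \<in> T) \<and> (\<lambda>n. enorm c (fst (s n) - u)) \<longlonglongrightarrow> 0
                        \<and> (\<lambda>n. enorm c (snd (s n) - w)) \<longlonglongrightarrow> 0)}"

definition closed_laplacian :: "('v \<Rightarrow> 'v \<Rightarrow> real) \<Rightarrow> 'v \<Rightarrow> ('v potential \<times> 'v potential) set" where
  "closed_laplacian c b =
     graph_closure c (op_graph (lap_domain c b) (\<lambda>u. pot (laplacian c u)))"

definition adjoint_graph :: "('v \<Rightarrow> 'v \<Rightarrow> real) \<Rightarrow> 'v potential set
    \<Rightarrow> ('v potential \<Rightarrow> 'v potential) \<Rightarrow> ('v potential \<times> 'v potential) set" where
  "adjoint_graph c D A = {(v, w). v \<in> energy_space c \<and> w \<in> energy_space c \<and>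
     (\<forall>u\<in>D. energy c v (A u) = energy c w u)}"

definition self_adjoint :: "('v \<Rightarrow> 'v \<Rightarrow> real) \<Rightarrow> 'v potential set
    \<Rightarrow> ('v potential \<Rightarrow> 'v potential) \<Rightarrow> bool" where
  "self_adjoint c D A \<longleftrightarrow>
     pot.subspace D \<and> D \<subseteq> energy_space c \<and> eclosure c D = energy_space c \<and>
     (\<forall>u\<in>D. A u \<in> energy_space c) \<and>
     (\<forall>u\<in>D. \<forall>v\<in>D. \<forall>a. A (u + v) = A u + A v \<and> A (cscale a u) = cscale a (A u)) \<and>
     adjoint_graph c D A = op_graph D A"

definition commutes_with_cnj :: "'v potential set \<Rightarrow> ('v potential \<Rightarrow> 'v potential) \<Rightarrow> bool" where
  "commutes_with_cnj D A \<longleftrightarrow> (\<forall>u\<in>D. pot_cnj u \<in> D \<and> A (pot_cnj u) = pot_cnj (A u))"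

text \<open>Linearity of a projection follows from its symmetry on the whole space.\<close>

definition orthogonal_projection :: "('v \<Rightarrow> 'v \<Rightarrow> real) \<Rightarrow> ('v potential \<Rightarrow> 'v potential) \<Rightarrow> bool" where
  "orthogonal_projection c Q \<longleftrightarrow>
     (\<forall>u\<in>energy_space c. Q u \<in> energy_space c \<and> Q (Q u) = Q u) \<and>
     (\<forall>u\<in>energy_space c. \<forall>v\<in>energy_space c. energy c (Q u) v = energy c u (Q v))"

definition spectral_distribution :: "('v \<Rightarrow> 'v \<Rightarrow> real)
    \<Rightarrow> (real set \<Rightarrow> 'v potential \<Rightarrow> 'v potential) \<Rightarrow> 'v potential \<Rightarrow> real measure" where
  "spectral_distribution c E u =
     measure_of UNIV (sets borel) (\<lambda>B. ennreal (Re (energy c u (E B u))))"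

text \<open>\<open>E\<close> is the projection-valued measure with \<open>A = \<integral> t dE(t)\<close>. The spectral theorem
  says that each self-adjoint operator has exactly one such \<open>E\<close>. The quadratic form
  determines \<open>A\<close> by polarization, as its domain is dense.\<close>

definition spectral_measure_of :: "('v \<Rightarrow> 'v \<Rightarrow> real) \<Rightarrow> 'v potential set
    \<Rightarrow> ('v potential \<Rightarrow> 'v potential) \<Rightarrow> (real set \<Rightarrow> 'v potential \<Rightarrow> 'v potential) \<Rightarrow> bool" where
  "spectral_measure_of c D A E \<longleftrightarrow>
     (\<forall>B\<in>sets borel. orthogonal_projection c (E B)) \<and>
     (\<forall>u\<in>energy_space c. E UNIV u = u) \<and>
     (\<forall>B\<in>sets borel. \<forall>C\<in>sets borel. \<forall>u\<in>energy_space c. E (B \<inter> C) u = E B (E C u)) \<and>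
     (\<forall>B. range B \<subseteq> sets borel \<and> disjoint_family B \<longrightarrow>
        (\<forall>u\<in>energy_space c.
           (\<lambda>n. enorm c ((\<Sum>i<n. E (B i) u) - E (\<Union>i. B i) u)) \<longlonglongrightarrow> 0)) \<and>
     D = {u \<in> energy_space c. integrable (spectral_distribution c E u) (\<lambda>t. t\<^sup>2)} \<and>
     (\<forall>u\<in>D. energy c u (A u) = complex_of_real (\<integral>t. t \<partial>spectral_distribution c E u))"

definition dom_power :: "'v potential set \<Rightarrow> ('v potential \<Rightarrow> 'v potential) \<Rightarrow> nat \<Rightarrow> 'v potential set" where
  "dom_power D A p = {u. \<forall>k<p. (A ^^ k) u \<in> D}"

definition test_space :: "'v potential set \<Rightarrow> ('v potential \<Rightarrow> 'v potential) \<Rightarrow> 'v potential set" where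
  "test_space D A = {u. real_potential u} \<inter> (\<Inter>p\<in>{1..}. dom_power D A p)"

text \<open>The index \<open>p = 0\<close> is included, so that the inclusion of the test space into the energy
  space is continuous.\<close>

definition test_topology :: "('v \<Rightarrow> 'v \<Rightarrow> real) \<Rightarrow> 'v potential set
    \<Rightarrow> ('v potential \<Rightarrow> 'v potential) \<Rightarrow> 'v potential topology" where
  "test_topology c D A = topology_generated_by
     {{w \<in> test_space D A. enorm c ((A ^^ p) (w - u)) < e} | u p e. u \<in> test_space D A \<and> e > 0}"

definition distributions :: "('v \<Rightarrow> 'v \<Rightarrow> real) \<Rightarrow> 'v potential set
    \<Rightarrow> ('v potential \<Rightarrow> 'v potential) \<Rightarrow> ('v potential \<Rightarrow> real) set" where
  "distributions c D A = {\<xi> \<in> extensional (test_space D A).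
     (\<forall>u\<in>test_space D A. \<forall>v\<in>test_space D A. \<xi> (u + v) = \<xi> u + \<xi> v) \<and>
     (\<forall>u\<in>test_space D A. \<forall>a::real. \<xi> (cscale (complex_of_real a) u) = a * \<xi> u) \<and>
     continuous_map (test_topology c D A) euclideanreal \<xi>}"

definition weak_star_topology :: "('v \<Rightarrow> 'v \<Rightarrow> real) \<Rightarrow> 'v potential set
    \<Rightarrow> ('v potential \<Rightarrow> 'v potential) \<Rightarrow> ('v potential \<Rightarrow> real) topology" where
  "weak_star_topology c D A =
     subtopology (product_topology (\<lambda>_. euclideanreal) (test_space D A)) (distributions c D A)"

text \<open>The two stages of the pairing have the same formula: by the definition of
  the vector \<open>w\<^sub>n\<close> that represents \<open>\<xi> \<circ> E\<^sub>n\<close>, the limit of the inner products of \<open>u\<close> with \<open>w\<^sub>n\<close>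
  is the limit of \<open>\<xi> (E\<^sub>n u)\<close>, with \<open>E\<^sub>n\<close> the spectral projection for the interval from \<open>1/n\<close> to \<open>n\<close>.
  Here \<open>u\<close> is real-valued. For \<open>u\<close> outside the test space the limit need not exist for
  every \<open>\<xi>\<close>, and \<open>lim\<close> is then an unspecified constant.\<close>

definition truncated_pairing :: "(real set \<Rightarrow> 'v potential \<Rightarrow> 'v potential)
    \<Rightarrow> 'v potential \<Rightarrow> ('v potential \<Rightarrow> real) \<Rightarrow> nat \<Rightarrow> real" where
  "truncated_pairing E u \<xi> n = \<xi> (E {1 / real n..real n} u)"

definition pairing :: "(real set \<Rightarrow> 'v potential \<Rightarrow> 'v potential)
    \<Rightarrow> 'v potential \<Rightarrow> ('v potential \<Rightarrow> real) \<Rightarrow> real" where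
  "pairing E u \<xi> = lim (truncated_pairing E u \<xi>)"

definition wiener :: "(real set \<Rightarrow> 'v potential \<Rightarrow> 'v potential)
    \<Rightarrow> 'v potential \<Rightarrow> ('v potential \<Rightarrow> real) \<Rightarrow> complex" where
  "wiener E u \<xi> =
     complex_of_real (pairing E (pot_Re u) \<xi>) + \<i> * complex_of_real (pairing E (pot_Im u) \<xi>)"

definition radon_prob_on :: "'a topology \<Rightarrow> 'a measure \<Rightarrow> bool" where
  "radon_prob_on T M \<longleftrightarrow>
     prob_space M \<and> space M = topspace T \<and> sets M = sigma_sets (topspace T) {U. openin T U} \<and>
     (\<forall>B\<in>sets M. emeasure M B =
        (SUP K\<in>{K. compactin T K \<and> K \<in> sets M \<and> K \<subseteq> B}. emeasure M K))"

definition minlos_gaussian :: "('v \<Rightarrow> 'v \<Rightarrow> real) \<Rightarrow> 'v potential set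
    \<Rightarrow> ('v potential \<Rightarrow> 'v potential) \<Rightarrow> (real set \<Rightarrow> 'v potential \<Rightarrow> 'v potential)
    \<Rightarrow> ('v potential \<Rightarrow> real) measure \<Rightarrow> bool" where
  "minlos_gaussian c D A E P \<longleftrightarrow>
     radon_prob_on (weak_star_topology c D A) P \<and>
     (\<forall>s\<in>test_space D A.
        (CLINT \<xi>|P. exp (\<i> * complex_of_real (pairing E s \<xi>)))
          = complex_of_real (exp (- (enorm c s)\<^sup>2 / 2)))"

definition square_integrable :: "'a measure \<Rightarrow> ('a \<Rightarrow> complex) \<Rightarrow> bool" where
  "square_integrable M f \<longleftrightarrow>
     f \<in> borel_measurable M \<and> integrable M (\<lambda>x. (cmod (f x))\<^sup>2)"

text \<open>A linear isometry into \<open>L\<^sup>2(M)\<close>, whose elements are functions up to equality almost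
  everywhere.\<close>

definition L2_isometry :: "('v \<Rightarrow> 'v \<Rightarrow> real) \<Rightarrow> 'a measure \<Rightarrow> ('v potential \<Rightarrow> 'a \<Rightarrow> complex) \<Rightarrow> bool" where
  "L2_isometry c M W \<longleftrightarrow>
     (\<forall>u\<in>energy_space c. square_integrable M (W u)) \<and>
     (\<forall>u\<in>energy_space c. \<forall>v\<in>energy_space c. AE \<omega> in M. W (u + v) \<omega> = W u \<omega> + W v \<omega>) \<and>
     (\<forall>u\<in>energy_space c. \<forall>a. AE \<omega> in M. W (cscale a u) \<omega> = a * W u \<omega>) \<and>
     (\<forall>u\<in>energy_space c. sqrt (\<integral>\<omega>. (cmod (W u \<omega>))\<^sup>2 \<partial>M) = enorm c u)"

text \<open>Point masses count as Gaussian: the kernel at the base vertex is \<open>0\<close>.\<close>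

definition gaussian_rv :: "'a measure \<Rightarrow> ('a \<Rightarrow> real) \<Rightarrow> bool" where
  "gaussian_rv M X \<longleftrightarrow> X \<in> borel_measurable M \<and>
     (\<exists>\<mu> \<sigma>. 0 \<le> \<sigma> \<and> distr M borel X =
        (if \<sigma> = 0 then return borel \<mu>
         else density lborel (\<lambda>x. ennreal (normal_density \<mu> \<sigma> x))))"

definition gaussian_system :: "'a measure \<Rightarrow> ('i \<Rightarrow> 'a \<Rightarrow> real) \<Rightarrow> bool" where
  "gaussian_system M X \<longleftrightarrow>
     (\<forall>F a. finite F \<longrightarrow> gaussian_rv M (\<lambda>\<omega>. \<Sum>i\<in>F. a i * X i \<omega>))"

definition connected_in :: "('v \<Rightarrow> 'v \<Rightarrow> real) \<Rightarrow> 'v set \<Rightarrow> bool" where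
  "connected_in c F \<longleftrightarrow>
     (\<forall>x\<in>F. \<forall>y\<in>F. (x, y) \<in> {(a, b). a \<in> F \<and> b \<in> F \<and> c a b > 0}\<^sup>*)"

definition finite_resistance :: "('v \<Rightarrow> 'v \<Rightarrow> real) \<Rightarrow> 'v set \<Rightarrow> 'v \<Rightarrow> 'v \<Rightarrow> real" where
  "finite_resistance c F x y = (THE r. \<exists>v :: 'v \<Rightarrow> real.
     (\<forall>z\<in>F. (\<Sum>w\<in>F. c z w * (v z - v w)) = of_bool (z = x) - of_bool (z = y)) \<and> r = v x - v y)"

definition exhaustion :: "('v \<Rightarrow> 'v \<Rightarrow> real) \<Rightarrow> (nat \<Rightarrow> 'v set) \<Rightarrow> bool" where
  "exhaustion c G \<longleftrightarrow>
     incseq G \<and> (\<Union>k. G k) = UNIV \<and> (\<forall>k. finite (G k) \<and> connected_in c (G k))"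

definition free_resistance :: "('v \<Rightarrow> 'v \<Rightarrow> real) \<Rightarrow> 'v \<Rightarrow> 'v \<Rightarrow> real" where
  "free_resistance c x y = (THE r. \<forall>G. exhaustion c G \<and> (\<forall>k. x \<in> G k \<and> y \<in> G k) \<longrightarrow>
     (\<lambda>k. finite_resistance c (G k) x y) \<longlonglongrightarrow> r)"

end

theory Submission
  imports Defs
begin

text \<open>
  The idea is to realize the pairing of a distribution with an arbitrary element of the energy space as
  an almost sure limit of Gaussian variables \<open>\<xi> (E\<^sub>n u)\<close>, where \<open>E\<^sub>n\<close> is the spectral cut-off to
  the interval from \<open>1/n\<close> to \<open>n\<close>.

  For this, \<open>E\<^sub>n u\<close> has to be a test function when \<open>u\<close> is real. It lies in the domain of every power of
  the operator, because the interval is bounded. It is real, because the spectral projections of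
  compact intervals commute with complex conjugation (\<open>E_interval_cnj\<close>). Indeed, on the ranges of
  the projections for two separated intervals the operator differs from two scalars by less than
  these scalars differ from each other. Comparing the two sides of the symmetry relation forces the
  one range to be orthogonal to the conjugate of the other (\<open>cnj_separated_orthogonal\<close>).

  For a test function \<open>s\<close>, continuity of \<open>\<xi>\<close> gives \<open>\<langle>s, \<xi>\<rangle> = \<xi> (E s)\<close>, with \<open>E\<close> the projection
  for the open positive half-line. The prescribed characteristic function then leaves no room for a
  test function that \<open>E\<close> kills, so \<open>E\<close> is the identity and \<open>\<xi> s\<close> is a centred Gaussian variable of
  variance \<open>\<parallel>s\<parallel>\<^sup>2\<close> (\<open>E_positive_test\<close>, \<open>evaluation_characteristic\<close>).

  The increments of the sequence \<open>\<xi> (E\<^sub>n u)\<close> are evaluations of orthogonal test functions. Their joint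
  characteristic function factors, so they are independent, and Ottaviani's inequality turns convergence
  in mean square into almost sure convergence (\<open>independent_increments_AE_convergent\<close>). The limit
  has the characteristic function of a centred Gaussian variable of variance \<open>\<parallel>u\<parallel>\<^sup>2\<close>. Isometry
  and the covariance formula follow by polarization, and linear combinations of the limits are limits of
  the same kind, which makes the family Gaussian.

  It remains to see that \<open>\<parallel>v\<^sub>x - v\<^sub>y\<parallel>\<^sup>2\<close> is the free resistance. On a finite connected subnetwork the
  potential of a unit current from \<open>x\<close> to \<open>y\<close> represents the functional \<open>f \<mapsto> f x - f y\<close> with respect to
  the energy form. Along an exhaustion these potentials form a Cauchy sequence on every finite part,
  and their limit represents the functional on the whole energy space (\<open>dipole_limit\<close>). This
  construction provides the energy kernel, shows that it is real, and identifies the limit of the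
  finite resistances.
\<close>

section \<open>The energy space as an inner product space\<close>

lemma pot_surj: "\<exists>f. u = pot f"
  by transfer (auto intro!: exI[of _ 0])

lemma pdiff_pot [simp]: "pdiff (pot f) x y = f x - f y"
  by transfer simp

lemma pdiff_add [simp]: "pdiff (u + v) x y = pdiff u x y + pdiff v x y"
  by transfer simp

lemma pdiff_diff [simp]: "pdiff (u - v) x y = pdiff u x y - pdiff v x y"
  by transfer simp

lemma pdiff_0 [simp]: "pdiff 0 x y = 0"
  by transfer simp

lemma pdiff_cscale [simp]: "pdiff (cscale a u) x y = a * pdiff u x y"
  by transfer (simp add: algebra_simps)

lemma pdiff_cnj [simp]: "pdiff (pot_cnj u) x y = cnj (pdiff u x y)"
  by transfer simp

lemma pdiff_Re [simp]: "pdiff (pot_Re u) x y = complex_of_real (Re (pdiff u x y))"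
  by transfer simp

lemma pdiff_Im [simp]: "pdiff (pot_Im u) x y = complex_of_real (Im (pdiff u x y))"
  by transfer simp

lemma pdiff_trans: "pdiff u x z = pdiff u x y + pdiff u y z"
  by transfer simp

lemma pdiff_swap: "pdiff u x y = - pdiff u y x"
  by transfer simp

lemma pot_eqI: "(\<And>x. f x = g x + k) \<Longrightarrow> pot f = pot g"
  by transfer blast

lemma potential_eqI:
  assumes "\<And>x. pdiff u x b = pdiff v x b"
  shows "u = v"
proof -
  obtain f g where fg: "u = pot f" "v = pot g" using pot_surj by metis
  show ?thesis unfolding fg
    using assms by (intro pot_eqI[where k = "f b - g b"]) (simp add: fg algebra_simps)
qed

lemma potential_eqI': "(\<And>x y. pdiff u x y = pdiff v x y) \<Longrightarrow> u = v"
  by (rule potential_eqI) blast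

lemma real_potential_iff_cnj: "real_potential u \<longleftrightarrow> pot_cnj u = u"
proof
  assume "real_potential u"
  then show "pot_cnj u = u"
    unfolding real_potential_def by (auto intro: potential_eqI')
next
  assume *: "pot_cnj u = u"
  obtain f where f: "u = pot f" using pot_surj by blast
  have "cnj (pdiff u x y) = pdiff u x y" for x y
    by (metis "*" pdiff_cnj)
  then have "\<And>x y. cnj (f x - f y) = f x - f y" unfolding f by simp
  then have "u = pot (\<lambda>x. complex_of_real (Re (f x)))"
    unfolding f by (intro potential_eqI') (simp add: complex_eq_iff)
  then show "real_potential u" unfolding real_potential_def by (rule exI[where x = "\<lambda>x. Re (f x)"])
qed

lemma energy_eq: "energy c u v =
    1 / 2 * (\<Sum>\<^sub>\<infinity>(x, y)\<in>UNIV. complex_of_real (c x y) * cnj (pdiff u x y) * pdiff v x y)"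
  by transfer simp

lemma finite_energy_eq:
  "finite_energy c u \<longleftrightarrow> (\<lambda>(x, y). c x y * (cmod (pdiff u x y))\<^sup>2) summable_on UNIV"
  by transfer simp

lemma cscale_minus1 [simp]: "cscale (-1) u = - u"
  by (rule potential_eqI') simp

lemma pot_cnj_add: "pot_cnj (u + v) = pot_cnj u + pot_cnj v"
  by (rule potential_eqI') simp

lemma pot_cnj_diff: "pot_cnj (u - v) = pot_cnj u - pot_cnj v"
  by (rule potential_eqI') simp

lemma pot_cnj_cscale: "pot_cnj (cscale a u) = cscale (cnj a) (pot_cnj u)"
  by (rule potential_eqI') simp

lemma pot_cnj_cnj [simp]: "pot_cnj (pot_cnj u) = u"
  by (rule potential_eqI') simp

lemma pot_Re_Im: "u = pot_Re u + cscale \<i> (pot_Im u)"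
  by (rule potential_eqI') (simp add: complex_eq_iff)

lemma real_potential_Re [simp]: "real_potential (pot_Re u)"
  and real_potential_Im [simp]: "real_potential (pot_Im u)"
  by (auto simp: real_potential_iff_cnj intro!: potential_eqI')

lemma real_potential_0 [simp]: "real_potential 0"
  by (auto simp: real_potential_iff_cnj intro!: potential_eqI')

lemma real_potential_add: "real_potential u \<Longrightarrow> real_potential v \<Longrightarrow> real_potential (u + v)"
  by (auto simp: real_potential_iff_cnj pot_cnj_add)

lemma real_potential_diff: "real_potential u \<Longrightarrow> real_potential v \<Longrightarrow> real_potential (u - v)"
  by (auto simp: real_potential_iff_cnj pot_cnj_diff)

lemma real_potential_cscale: "real_potential u \<Longrightarrow> real_potential (cscale (complex_of_real a) u)"
  by (auto simp: real_potential_iff_cnj pot_cnj_cscale)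

lemma pot_Re_real: "real_potential u \<Longrightarrow> pot_Re u = u"
  and pot_Im_real: "real_potential u \<Longrightarrow> pot_Im u = 0"
  unfolding real_potential_def by (auto intro!: potential_eqI')

locale network =
  fixes c :: "'v \<Rightarrow> 'v \<Rightarrow> real"
  assumes network: "resistance_network c"
begin

abbreviation "H \<equiv> energy_space c"

lemma c_nonneg [simp]: "0 \<le> c x y" and c_sym: "c x y = c y x"
  and connected: "(x, y) \<in> {(a, b). c a b > 0}\<^sup>*"
  using network by (auto simp: resistance_network_def)

lemma H_iff: "u \<in> H \<longleftrightarrow> (\<lambda>(x, y). c x y * (cmod (pdiff u x y))\<^sup>2) summable_on UNIV"
  by (simp add: energy_space_def finite_energy_eq)

text \<open>The closure properties of the energy space are comparisons of the differences along edges.\<close>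

lemma H_comparison:
  assumes u: "u \<in> H" and v: "v \<in> H"
    and le: "\<And>x y. cmod (pdiff w x y) \<le> A * (cmod (pdiff u x y) + cmod (pdiff v x y))"
  shows "w \<in> H"
  unfolding H_iff
proof (rule summable_on_comparison_test)
  show "(\<lambda>p. 2 * A\<^sup>2 * (case p of (x, y) \<Rightarrow> c x y * (cmod (pdiff u x y))\<^sup>2)
      + 2 * A\<^sup>2 * (case p of (x, y) \<Rightarrow> c x y * (cmod (pdiff v x y))\<^sup>2)) summable_on UNIV"
    using u v unfolding H_iff by (intro summable_on_add summable_on_cmult_right)
next
  fix p :: "'v \<times> 'v"
  obtain x y where p: "p = (x, y)" by fastforce
  have "(cmod (pdiff w x y))\<^sup>2 \<le> (A * (cmod (pdiff u x y) + cmod (pdiff v x y)))\<^sup>2"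
    by (rule power_mono[OF le]) simp
  also have "\<dots> \<le> 2 * A\<^sup>2 * (cmod (pdiff u x y))\<^sup>2 + 2 * A\<^sup>2 * (cmod (pdiff v x y))\<^sup>2"
  proof -
    have "0 \<le> A\<^sup>2 * (cmod (pdiff u x y) - cmod (pdiff v x y))\<^sup>2" by simp
    then show ?thesis by (simp add: power2_eq_square algebra_simps)
  qed
  finally have "c x y * (cmod (pdiff w x y))\<^sup>2 \<le> c x y * (2 * A\<^sup>2 * (cmod (pdiff u x y))\<^sup>2 + 2 * A\<^sup>2 * (cmod (pdiff v x y))\<^sup>2)"
    by (intro mult_left_mono) auto
  then show "(case p of (x, y) \<Rightarrow> c x y * (cmod (pdiff w x y))\<^sup>2) \<le>
      2 * A\<^sup>2 * (case p of (x, y) \<Rightarrow> c x y * (cmod (pdiff u x y))\<^sup>2)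
      + 2 * A\<^sup>2 * (case p of (x, y) \<Rightarrow> c x y * (cmod (pdiff v x y))\<^sup>2)"
    by (simp add: p algebra_simps)
  show "0 \<le> (case p of (x, y) \<Rightarrow> c x y * (cmod (pdiff w x y))\<^sup>2)"
    by (simp add: p)
qed

lemma H_0 [simp]: "0 \<in> H"
  by (simp add: H_iff case_prod_unfold)

lemma H_add [simp]: "u \<in> H \<Longrightarrow> v \<in> H \<Longrightarrow> u + v \<in> H"
  by (rule H_comparison[where A = 1 and u = u and v = v]) (auto intro: norm_triangle_ineq)

lemma H_cscale [simp]: "u \<in> H \<Longrightarrow> cscale a u \<in> H"
  by (rule H_comparison[where A = "cmod a" and u = u and v = u])
    (auto simp: norm_mult algebra_simps)

lemma H_uminus [simp]: "u \<in> H \<Longrightarrow> - u \<in> H"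
  using H_cscale[of u "-1"] by simp

lemma H_diff [simp]: "u \<in> H \<Longrightarrow> v \<in> H \<Longrightarrow> u - v \<in> H"
  using H_add[of u "-v"] by simp

lemma H_cnj [simp]: "u \<in> H \<Longrightarrow> pot_cnj u \<in> H"
  by (simp add: H_iff)

lemma H_Re [simp]: "u \<in> H \<Longrightarrow> pot_Re u \<in> H" and H_Im [simp]: "u \<in> H \<Longrightarrow> pot_Im u \<in> H"
  by (rule H_comparison[where A = 1 and u = u and v = u];
      auto intro: order_trans[OF abs_Re_le_cmod] order_trans[OF abs_Im_le_cmod])+

lemma H_sum [simp]: "(\<And>i. i \<in> I \<Longrightarrow> f i \<in> H) \<Longrightarrow> sum f I \<in> H"
  by (induction I rule: infinite_finite_induct) auto

lemma energy_summable:
  assumes u: "u \<in> H" and v: "v \<in> H"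
  shows "(\<lambda>(x, y). complex_of_real (c x y) * cnj (pdiff u x y) * pdiff v x y) summable_on UNIV"
proof (rule abs_summable_summable, rule summable_on_comparison_test)
  show "(\<lambda>p. (case p of (x, y) \<Rightarrow> c x y * (cmod (pdiff u x y))\<^sup>2)
      + (case p of (x, y) \<Rightarrow> c x y * (cmod (pdiff v x y))\<^sup>2)) summable_on UNIV"
    using u v unfolding H_iff by (intro summable_on_add)
next
  fix p :: "'v \<times> 'v"
  obtain x y where p: "p = (x, y)" by fastforce
  have "cmod (pdiff u x y) * cmod (pdiff v x y) \<le> (cmod (pdiff u x y))\<^sup>2 + (cmod (pdiff v x y))\<^sup>2"
  proof -
    have "0 \<le> cmod (pdiff u x y) * cmod (pdiff v x y)" by simp
    with sum_squares_bound[of "cmod (pdiff u x y)" "cmod (pdiff v x y)"] show ?thesis by linarith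
  qed
  from mult_left_mono[OF this, of "c x y"]
  show "norm (case p of (x, y) \<Rightarrow> complex_of_real (c x y) * cnj (pdiff u x y) * pdiff v x y) \<le>
      (case p of (x, y) \<Rightarrow> c x y * (cmod (pdiff u x y))\<^sup>2)
      + (case p of (x, y) \<Rightarrow> c x y * (cmod (pdiff v x y))\<^sup>2)"
    by (simp add: p norm_mult algebra_simps)
qed simp

lemma energy_add_right:
  assumes "u \<in> H" "v \<in> H" "w \<in> H"
  shows "energy c u (v + w) = energy c u v + energy c u w"
  unfolding energy_eq
  using infsum_add[OF energy_summable[OF assms(1,2)] energy_summable[OF assms(1,3)]]
  by (simp add: case_prod_unfold algebra_simps)

lemma energy_cscale_right [simp]: "energy c u (cscale a v) = a * energy c u v"
proof -
  have "(\<Sum>\<^sub>\<infinity>p. a * (complex_of_real (c (fst p) (snd p)) * cnj (pdiff u (fst p) (snd p)) * pdiff v (fst p) (snd p))) =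
    a * (\<Sum>\<^sub>\<infinity>p. (complex_of_real (c (fst p) (snd p)) * cnj (pdiff u (fst p) (snd p)) * pdiff v (fst p) (snd p)))"
    by (rule infsum_cmult_right')
  then show ?thesis
    unfolding energy_eq by (simp add: case_prod_unfold algebra_simps)
qed

lemma energy_cnj: "energy c (pot_cnj u) (pot_cnj v) = cnj (energy c u v)"
  unfolding energy_eq by (simp add: case_prod_unfold flip: infsum_cnj)

lemma energy_commute: "energy c v u = cnj (energy c u v)"
  unfolding energy_eq by (simp add: case_prod_unfold algebra_simps flip: infsum_cnj)

lemma energy_uminus_right [simp]: "energy c u (- v) = - energy c u v"
  using energy_cscale_right[of u "-1" v] by simp

lemma energy_diff_right:
  assumes "u \<in> H" "v \<in> H" "w \<in> H"
  shows "energy c u (v - w) = energy c u v - energy c u w"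
  using energy_add_right[of u v "- w"] assms by simp

lemma energy_add_left:
  assumes "u \<in> H" "v \<in> H" "w \<in> H"
  shows "energy c (u + v) w = energy c u w + energy c v w"
  using energy_add_right[of w u v] assms by (metis complex_cnj_add energy_commute)

lemma energy_diff_left:
  assumes "u \<in> H" "v \<in> H" "w \<in> H"
  shows "energy c (u - v) w = energy c u w - energy c v w"
  using energy_diff_right[of w u v] assms by (metis complex_cnj_diff energy_commute)

lemma energy_cscale_left [simp]: "energy c (cscale a u) v = cnj a * energy c u v"
  by (metis complex_cnj_mult energy_commute energy_cscale_right)

lemma energy_0_right [simp]: "energy c u 0 = 0" and energy_0_left [simp]: "energy c 0 u = 0"
  unfolding energy_eq by (simp_all add: case_prod_unfold)

lemma energy_sum_right:
  assumes "u \<in> H" "\<And>i. i \<in> I \<Longrightarrow> f i \<in> H"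
  shows "energy c u (sum f I) = (\<Sum>i\<in>I. energy c u (f i))"
  using assms(2)
  by (induction I rule: infinite_finite_induct) (auto simp: energy_add_right assms(1))

lemma infsum_complex_of_real:
  "(\<Sum>\<^sub>\<infinity>x\<in>A. complex_of_real (f x)) = complex_of_real (\<Sum>\<^sub>\<infinity>x\<in>A. f x)"
proof (cases "f summable_on A")
  case True
  then show ?thesis by (intro infsumI has_sum_of_real) simp
next
  case False
  then have "\<not> (\<lambda>x. complex_of_real (f x)) summable_on A"
    using summable_on_Re by fastforce
  with False show ?thesis by (simp add: infsum_not_exists)
qed

lemma energy_self: "energy c u u = complex_of_real ((enorm c u)\<^sup>2)"
  and energy_self_eq: "(enorm c u)\<^sup>2 = 1 / 2 * (\<Sum>\<^sub>\<infinity>(x, y)\<in>UNIV. c x y * (cmod (pdiff u x y))\<^sup>2)"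
proof -
  let ?S = "\<Sum>\<^sub>\<infinity>(x, y)\<in>UNIV. c x y * (cmod (pdiff u x y))\<^sup>2"
  have *: "complex_of_real (c x y) * cnj (pdiff u x y) * pdiff u x y
      = complex_of_real (c x y * (cmod (pdiff u x y))\<^sup>2)" for x y
    using complex_norm_square[of "pdiff u x y"] by (simp add: mult_ac)
  have e: "energy c u u = complex_of_real (1 / 2 * ?S)"
    unfolding energy_eq * by (simp add: case_prod_unfold infsum_complex_of_real del: of_real_mult of_real_power)
  have "0 \<le> ?S" by (rule infsum_nonneg) auto
  then have "(enorm c u)\<^sup>2 = 1 / 2 * ?S"
    unfolding enorm_def e by (simp del: of_real_mult)
  then show "energy c u u = complex_of_real ((enorm c u)\<^sup>2)" "(enorm c u)\<^sup>2 = 1 / 2 * ?S"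
    unfolding e by (simp_all only:)
qed

lemma enorm_nonneg [simp]: "0 \<le> enorm c u"
proof -
  have "0 \<le> (\<Sum>\<^sub>\<infinity>(x, y)\<in>UNIV. c x y * (cmod (pdiff u x y))\<^sup>2)" by (rule infsum_nonneg) auto
  then have "0 \<le> Re (energy c u u)" unfolding energy_self energy_self_eq by simp
  then show ?thesis by (simp add: enorm_def)
qed

lemma Re_energy_self [simp]: "Re (energy c u u) = (enorm c u)\<^sup>2"
  by (simp add: energy_self del: of_real_power)

lemma enorm_0 [simp]: "enorm c 0 = 0"
  by (simp add: enorm_def)

lemma enorm_cscale [simp]: "enorm c (cscale a u) = cmod a * enorm c u"
proof -
  have "energy c (cscale a u) (cscale a u) = (a * cnj a) * energy c u u" by simp
  also have "\<dots> = complex_of_real ((cmod a)\<^sup>2 * (enorm c u)\<^sup>2)"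
    by (simp only: energy_self complex_norm_square[symmetric] of_real_mult of_real_power)
  finally have "(enorm c (cscale a u))\<^sup>2 = (cmod a * enorm c u)\<^sup>2"
    by (simp only: energy_self of_real_eq_iff power_mult_distrib)
  then show ?thesis by (simp add: power2_eq_iff_nonneg)
qed

lemma enorm_uminus [simp]: "enorm c (- u) = enorm c u"
  using enorm_cscale[of "-1" u] by simp

lemma enorm_minus_commute: "enorm c (u - v) = enorm c (v - u)"
  by (metis enorm_uminus minus_diff_eq)

lemma enorm_cnj [simp]: "enorm c (pot_cnj u) = enorm c u"
  unfolding enorm_def energy_cnj by simp

lemma enorm_add_square:
  assumes "u \<in> H" "v \<in> H"
  shows "(enorm c (u + v))\<^sup>2 = (enorm c u)\<^sup>2 + 2 * Re (energy c u v) + (enorm c v)\<^sup>2"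
proof -
  have "Re (energy c v u) = Re (energy c u v)" by (subst energy_commute) simp
  then show ?thesis using assms
    unfolding Re_energy_self[symmetric] by (simp add: energy_add_left energy_add_right del: Re_energy_self)
qed

lemma enorm_diff_square:
  assumes "u \<in> H" "v \<in> H"
  shows "(enorm c (u - v))\<^sup>2 = (enorm c u)\<^sup>2 - 2 * Re (energy c u v) + (enorm c v)\<^sup>2"
  using enorm_add_square[of u "-v"] assms by simp

lemma energy_Cauchy_Schwarz:
  assumes "u \<in> H" "v \<in> H"
  shows "cmod (energy c u v) \<le> enorm c u * enorm c v"
proof -
  define e where "e = energy c u v"
  have ineq: "0 \<le> (enorm c u)\<^sup>2 - 2 * r * (cmod e)\<^sup>2 + r\<^sup>2 * (cmod e)\<^sup>2 * (enorm c v)\<^sup>2" for r :: real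
  proof -
    have "0 \<le> (enorm c (u - cscale (complex_of_real r * cnj e) v))\<^sup>2" by simp
    also have "\<dots> = (enorm c u)\<^sup>2 - 2 * Re (complex_of_real r * cnj e * e)
        + (cmod (complex_of_real r * cnj e) * enorm c v)\<^sup>2"
      using assms by (simp add: enorm_diff_square e_def)
    also have "complex_of_real r * cnj e * e = complex_of_real (r * (cmod e)\<^sup>2)"
      using complex_norm_square[of e] by (simp add: mult_ac)
    finally show ?thesis by (simp add: norm_mult power_mult_distrib algebra_simps)
  qed
  have "(cmod e)\<^sup>2 \<le> (enorm c u * enorm c v)\<^sup>2"
  proof (cases "enorm c v = 0")
    case True
    have "cmod e = 0"
    proof (rule ccontr)
      assume "cmod e \<noteq> 0"
      \<comment> \<open>For a null vector \<open>v\<close> the bound is affine in \<open>r\<close>, and this \<open>r\<close> makes it negative.\<close>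
      then have "2 * (((enorm c u)\<^sup>2 + 1) / (2 * (cmod e)\<^sup>2)) * (cmod e)\<^sup>2 = (enorm c u)\<^sup>2 + 1"
        by (simp add: field_simps)
      with ineq[of "((enorm c u)\<^sup>2 + 1) / (2 * (cmod e)\<^sup>2)"] True show False by simp
    qed
    then show ?thesis by simp
  next
    case False
    then have "0 < (enorm c v)\<^sup>2" by simp
    moreover from ineq[of "1 / (enorm c v)\<^sup>2"] False
    have "0 \<le> (enorm c u)\<^sup>2 - (cmod e)\<^sup>2 / (enorm c v)\<^sup>2"
      by (simp add: power2_eq_square field_simps)
    ultimately show ?thesis by (simp add: field_simps power_mult_distrib)
  qed
  then show ?thesis unfolding e_def by (rule power2_le_imp_le) simp
qed

lemma enorm_triangle:
  assumes "u \<in> H" "v \<in> H"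
  shows "enorm c (u + v) \<le> enorm c u + enorm c v"
proof (rule power2_le_imp_le)
  have "Re (energy c u v) \<le> enorm c u * enorm c v"
    using energy_Cauchy_Schwarz[OF assms] complex_Re_le_cmod order_trans by blast
  then show "(enorm c (u + v))\<^sup>2 \<le> (enorm c u + enorm c v)\<^sup>2"
    unfolding enorm_add_square[OF assms] power2_sum by linarith
qed simp

lemma enorm_triangle_diff:
  assumes "u \<in> H" "v \<in> H" "w \<in> H"
  shows "enorm c (u - w) \<le> enorm c (u - v) + enorm c (v - w)"
  using enorm_triangle[of "u - v" "v - w"] assms by simp

lemma enorm_reverse_triangle:
  assumes "u \<in> H" "v \<in> H"
  shows "\<bar>enorm c u - enorm c v\<bar> \<le> enorm c (u - v)"
  using enorm_triangle[of "u - v" v] enorm_triangle[of "v - u" u] assms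
  by (simp add: enorm_minus_commute[of v u])

lemma energy_diff_bound:
  assumes "u \<in> H"
  shows "c x y * (cmod (pdiff u x y))\<^sup>2 \<le> 2 * (enorm c u)\<^sup>2"
proof -
  have "(\<Sum>\<^sub>\<infinity>(x, y)\<in>{(x, y)}. c x y * (cmod (pdiff u x y))\<^sup>2) \<le>
      (\<Sum>\<^sub>\<infinity>(x, y)\<in>UNIV. c x y * (cmod (pdiff u x y))\<^sup>2)"
    using assms by (intro infsum_mono_neutral) (auto simp: H_iff)
  then show ?thesis by (simp add: energy_self_eq)
qed

text \<open>Connectedness makes the energy definite on potentials: zero energy forces a function to be
  constant along every edge.\<close>

lemma enorm_eq_0:
  assumes u: "u \<in> H" and "enorm c u = 0"
  shows "u = 0"
proof (rule potential_eqI')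
  fix x y
  have edge: "pdiff u x y = 0" if "c x y > 0" for x y
    using energy_diff_bound[OF u, of x y] that assms(2)
    by (simp add: mult_le_0_iff)
  have "pdiff u x y = 0" using connected[of x y]
  proof (induction rule: rtrancl_induct)
    case base
    then show ?case by (metis add_cancel_left_right pdiff_trans)
  next
    case (step y z)
    then show ?case using edge[of y z] pdiff_trans[of u x z y] by simp
  qed
  then show "pdiff u x y = pdiff 0 x y" by simp
qed

lemma energy_separates:
  assumes "u \<in> H" "v \<in> H" "\<And>w. w \<in> H \<Longrightarrow> energy c w u = energy c w v"
  shows "u = v"
proof -
  have "energy c (u - v) (u - v) = 0"
    using assms by (simp add: energy_diff_right)
  then have "enorm c (u - v) = 0" by (simp add: enorm_def)
  then show ?thesis using enorm_eq_0[of "u - v"] assms by simp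
qed

lemma energy_real:
  assumes "real_potential u" "real_potential v"
  shows "energy c u v = complex_of_real (Re (energy c u v))"
  using energy_cnj[of u v] assms by (simp add: real_potential_iff_cnj complex_eq_iff)

lemma energy_tendsto_right:
  assumes "w \<in> H" "\<And>n. s n \<in> H" "u \<in> H" "(\<lambda>n. enorm c (s n - u)) \<longlonglongrightarrow> 0"
  shows "(\<lambda>n. energy c w (s n)) \<longlonglongrightarrow> energy c w u"
proof (rule LIM_zero_cancel, rule Lim_null_comparison)
  show "\<forall>\<^sub>F n in sequentially. norm (energy c w (s n) - energy c w u) \<le> enorm c w * enorm c (s n - u)"
    using energy_Cauchy_Schwarz[of w "s n - u" for n] assms
    by (simp add: energy_diff_right)
  show "(\<lambda>n. enorm c w * enorm c (s n - u)) \<longlonglongrightarrow> 0"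
    using tendsto_mult_right_zero[OF assms(4)] by simp
qed

lemma enorm_tendsto:
  assumes "\<And>n. s n \<in> H" "u \<in> H" "(\<lambda>n. enorm c (s n - u)) \<longlonglongrightarrow> 0"
  shows "(\<lambda>n. enorm c (s n)) \<longlonglongrightarrow> enorm c u"
proof (rule LIM_zero_cancel, rule Lim_null_comparison)
  show "\<forall>\<^sub>F n in sequentially. norm (enorm c (s n) - enorm c u) \<le> enorm c (s n - u)"
    using enorm_reverse_triangle assms by simp
qed (rule assms(3))

end

section \<open>Finite subnetworks and free resistance\<close>

context network
begin

definition local_energy :: "'v set \<Rightarrow> ('v \<Rightarrow> real) \<Rightarrow> ('v \<Rightarrow> real) \<Rightarrow> real" where
  "local_energy F f g = 1 / 2 * (\<Sum>x\<in>F. \<Sum>y\<in>F. c x y * (f x - f y) * (g x - g y))"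

lemma local_energy_commute: "local_energy F f g = local_energy F g f"
  unfolding local_energy_def by (simp add: mult_ac)

lemma local_energy_add_right:
  "local_energy F f (\<lambda>x. g x + h x) = local_energy F f g + local_energy F f h"
  unfolding local_energy_def by (simp add: algebra_simps sum.distrib sum_subtractf)

lemma local_energy_cmult_right: "local_energy F f (\<lambda>x. a * g x) = a * local_energy F f g"
  unfolding local_energy_def sum_distrib_left by (simp add: algebra_simps)

lemma local_energy_add_left:
  "local_energy F (\<lambda>x. g x + h x) f = local_energy F g f + local_energy F h f"
  by (simp only: local_energy_commute[of F _ f] local_energy_add_right)

lemma local_energy_cmult_left: "local_energy F (\<lambda>x. a * g x) f = a * local_energy F g f"
  by (simp only: local_energy_commute[of F _ f] local_energy_cmult_right)

lemma local_energy_diff_right: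
  "local_energy F f (\<lambda>x. g x - h x) = local_energy F f g - local_energy F f h"
  using local_energy_add_right[of F f g "\<lambda>x. -1 * h x"] local_energy_cmult_right[of F f "-1" h] by simp

lemma local_energy_diff_left:
  "local_energy F (\<lambda>x. g x - h x) f = local_energy F g f - local_energy F h f"
  by (simp only: local_energy_commute[of F _ f] local_energy_diff_right)

lemma local_energy_nonneg [simp]: "0 \<le> local_energy F f f"
  unfolding local_energy_def by (auto intro!: sum_nonneg simp: mult.assoc)

lemma local_energy_mono:
  assumes "F \<subseteq> G" "finite G"
  shows "local_energy F f f \<le> local_energy G f f"
proof -
  have "(\<Sum>x\<in>F. \<Sum>y\<in>F. c x y * (f x - f y) * (f x - f y)) \<le>
      (\<Sum>x\<in>F. \<Sum>y\<in>G. c x y * (f x - f y) * (f x - f y))"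
    using assms by (intro sum_mono sum_mono2) (auto simp: mult.assoc)
  also have "\<dots> \<le> (\<Sum>x\<in>G. \<Sum>y\<in>G. c x y * (f x - f y) * (f x - f y))"
    using assms by (intro sum_mono2 sum_nonneg) (auto simp: mult.assoc)
  finally show ?thesis by (simp add: local_energy_def)
qed

lemma local_energy_Cauchy_Schwarz:
  "(local_energy F f g)\<^sup>2 \<le> local_energy F f f * local_energy F g g"
proof -
  let ?a = "local_energy F f f" and ?b = "local_energy F f g" and ?d = "local_energy F g g"
  have q: "0 \<le> ?a + 2 * r * ?b + r\<^sup>2 * ?d" for r
  proof -
    have "0 \<le> local_energy F (\<lambda>x. f x + r * g x) (\<lambda>x. f x + r * g x)" by simp
    also have "\<dots> = ?a + 2 * r * ?b + r\<^sup>2 * ?d"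
      by (simp add: local_energy_add_left local_energy_add_right local_energy_cmult_left
          local_energy_cmult_right local_energy_commute[of F g f] power2_eq_square algebra_simps)
    finally show ?thesis .
  qed
  show ?thesis
  proof (cases "?d = 0")
    case True
    have "?b = 0"
    proof (rule ccontr)
      assume "?b \<noteq> 0"
      \<comment> \<open>This \<open>r\<close> brings the affine function \<open>?a + 2 * r * ?b\<close> down to \<open>-1\<close>.\<close>
      with q[of "- (?a + 1) / (2 * ?b)"] True show False by (simp add: field_simps)
    qed
    then show ?thesis using True by simp
  next
    case False
    then have d: "0 < ?d" using local_energy_nonneg[of F g] by linarith
    have "0 \<le> ?a - ?b\<^sup>2 / ?d"
      using q[of "- ?b / ?d"] d by (simp add: power2_eq_square field_simps)
    then show ?thesis using d by (simp add: field_simps)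
  qed
qed

text \<open>Summation by parts.\<close>

lemma local_energy_green:
  assumes "finite F"
  shows "local_energy F f g = (\<Sum>z\<in>F. g z * (\<Sum>w\<in>F. c z w * (f z - f w)))"
proof -
  have "(\<Sum>x\<in>F. \<Sum>y\<in>F. c x y * (f x - f y) * g y) = (\<Sum>y\<in>F. \<Sum>x\<in>F. c x y * (f x - f y) * g y)"
    by (rule sum.swap)
  also have "\<dots> = - (\<Sum>z\<in>F. \<Sum>w\<in>F. c z w * (f z - f w) * g z)"
    unfolding sum_negf[symmetric] by (intro sum.cong refl) (simp add: c_sym[of _ "_ :: 'v"] algebra_simps)
  finally have "local_energy F f g = (\<Sum>z\<in>F. \<Sum>w\<in>F. c z w * (f z - f w) * g z)"
    unfolding local_energy_def by (simp add: right_diff_distrib sum_subtractf)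
  then show ?thesis by (simp add: sum_distrib_left mult_ac)
qed

lemma edge_bound:
  assumes "finite F" "x \<in> F" "y \<in> F"
  shows "c x y * (f x - f y)\<^sup>2 \<le> 2 * local_energy F f f"
proof -
  have "c x y * (f x - f y) * (f x - f y) \<le> (\<Sum>y\<in>F. c x y * (f x - f y) * (f x - f y))"
    using assms by (intro member_le_sum) (auto simp: mult.assoc)
  also have "\<dots> \<le> (\<Sum>x\<in>F. \<Sum>y\<in>F. c x y * (f x - f y) * (f x - f y))"
    using assms by (intro member_le_sum[of x F "\<lambda>x. \<Sum>y\<in>F. c x y * (f x - f y) * (f x - f y)"] sum_nonneg)
      (auto simp: mult.assoc)
  finally show ?thesis by (simp add: local_energy_def power2_eq_square mult.assoc)
qed

text \<open>The constant comes from a path in \<open>F\<close>: every further edge doubles it and adds a multiple of the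
  resistance of that edge.\<close>

lemma oscillation_bound:
  assumes F: "finite F" "connected_in c F" and x: "x \<in> F" and y: "y \<in> F"
  shows "\<exists>C\<ge>0. \<forall>f. (f x - f y)\<^sup>2 \<le> C * local_energy F f f"
proof -
  have "(x, y) \<in> {(a, b). a \<in> F \<and> b \<in> F \<and> c a b > 0}\<^sup>*"
    using F x y by (auto simp: connected_in_def)
  then show ?thesis
  proof (induction rule: rtrancl_induct)
    case base
    then show ?case by (intro exI[of _ 0]) auto
  next
    case (step y z)
    then obtain C where C: "0 \<le> C" "\<And>f. (f x - f y)\<^sup>2 \<le> C * local_energy F f f" by blast
    have yz: "y \<in> F" "z \<in> F" "c y z > 0" using step by auto
    show ?case
    proof (intro exI[of _ "2 * C + 4 / c y z"] conjI allI)
      fix f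
      have "(f y - f z)\<^sup>2 \<le> 2 * local_energy F f f / c y z"
        using edge_bound[OF F(1) yz(1,2), of f] yz(3) by (simp add: field_simps)
      moreover have "(f x - f z)\<^sup>2 \<le> 2 * (f x - f y)\<^sup>2 + 2 * (f y - f z)\<^sup>2"
      proof -
        have "0 \<le> ((f x - f y) - (f y - f z))\<^sup>2" by simp
        then show ?thesis by (simp add: power2_eq_square algebra_simps)
      qed
      ultimately have "(f x - f z)\<^sup>2 \<le> 2 * (C * local_energy F f f) + 2 * (2 * local_energy F f f / c y z)"
        using C(2)[of f] by linarith
      then show "(f x - f z)\<^sup>2 \<le> (2 * C + 4 / c y z) * local_energy F f f"
        by (simp add: algebra_simps)
    qed (use C yz in auto)
  qed
qed

text \<open>Riesz representation for the energy form, by adding one vertex at a time to the support: the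
  component \<open>e\<close> of a new Dirac mass that is orthogonal to the previous ones is adjoined, unless it is a
  null vector.\<close>

lemma local_riesz:
  assumes F: "finite F" and W: "finite W"
    and add: "\<And>f g. l (\<lambda>x. f x + g x) = l f + l g" and cmult: "\<And>a f. l (\<lambda>x. a * f x) = a * l f"
    and null: "\<And>f. local_energy F f f = 0 \<Longrightarrow> l f = 0"
  shows "\<exists>h. (\<forall>x. x \<notin> W \<longrightarrow> h x = 0) \<and> (\<forall>f. (\<forall>x. x \<notin> W \<longrightarrow> f x = 0) \<longrightarrow> local_energy F h f = l f)"
  using W add cmult null
proof (induction W arbitrary: l rule: finite_induct)
  case empty
  have "l (\<lambda>x. 0) = 0" using empty(2)[of 0 "\<lambda>x. 0"] by simp
  then have "local_energy F (\<lambda>x. 0) f = l f" if "\<forall>x. f x = 0" for f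
  proof -
    have "f = (\<lambda>x. 0)" using that by auto
    then show ?thesis using \<open>l (\<lambda>x. 0) = 0\<close> by (simp add: local_energy_def)
  qed
  then show ?case by (intro exI[of _ "\<lambda>x. 0"]) auto
next
  case (insert z W)
  obtain h where h: "\<And>x. x \<notin> W \<Longrightarrow> h x = 0"
      "\<And>f. (\<And>x. x \<notin> W \<Longrightarrow> f x = 0) \<Longrightarrow> local_energy F h f = l f"
    using insert.IH[of l, OF insert.prems] by metis
  define d :: "'v \<Rightarrow> real" where "d x = of_bool (x = z)" for x
  have "\<exists>p. (\<forall>x. x \<notin> W \<longrightarrow> p x = 0) \<and>
      (\<forall>f. (\<forall>x. x \<notin> W \<longrightarrow> f x = 0) \<longrightarrow> local_energy F p f = local_energy F d f)"
  proof (rule insert.IH[of "local_energy F d"])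
    fix f assume "local_energy F f f = 0"
    then show "local_energy F d f = 0" using local_energy_Cauchy_Schwarz[of F d f] by simp
  qed (rule local_energy_add_right local_energy_cmult_right)+
  then obtain p where p: "\<And>x. x \<notin> W \<Longrightarrow> p x = 0"
      "\<And>f. (\<And>x. x \<notin> W \<Longrightarrow> f x = 0) \<Longrightarrow> local_energy F p f = local_energy F d f"
    by metis
  define e where "e x = d x - p x" for x
  have orth: "local_energy F e f = 0" if "\<And>x. x \<notin> W \<Longrightarrow> f x = 0" for f
    unfolding e_def using p(2)[of f] that by (simp add: local_energy_diff_left)
  define \<alpha> where "\<alpha> = (if local_energy F e e = 0 then 0 else l e / local_energy F e e)"
  have \<alpha>: "\<alpha> * local_energy F e e = l e" using insert.prems(3)[of e] by (simp add: \<alpha>_def)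
  define h' where "h' x = h x + \<alpha> * e x" for x
  show ?case
  proof (intro exI[of _ h'] conjI allI impI)
    fix x assume "x \<notin> insert z W"
    then show "h' x = 0" using h(1) p(1) by (simp add: h'_def e_def d_def)
  next
    fix f :: "'v \<Rightarrow> real" assume f: "\<forall>x. x \<notin> insert z W \<longrightarrow> f x = 0"
    define g where "g x = f x - f z * e x" for x
    have g: "g x = 0" if "x \<notin> W" for x
      using f that p(1) insert.hyps by (auto simp: g_def e_def d_def)
    have fg: "f = (\<lambda>x. g x + f z * e x)" by (simp add: g_def)
    have "l f = l g + f z * l e" by (subst fg) (simp only: insert.prems)
    moreover have "local_energy F h' f = l g + f z * l e"
    proof -
      have "local_energy F h' f = local_energy F h g + f z * local_energy F h e
          + \<alpha> * (local_energy F e g + f z * local_energy F e e)"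
        unfolding h'_def
        by (subst (1) fg) (simp only: local_energy_add_left local_energy_add_right
            local_energy_cmult_left local_energy_cmult_right, simp add: algebra_simps)
      moreover have "local_energy F h e = 0" using orth[of h] h(1) by (subst local_energy_commute) auto
      ultimately show ?thesis using h(2)[of g] g orth[of g] \<alpha> by (simp add: algebra_simps)
    qed
    ultimately show "local_energy F h' f = l f" by simp
  qed
qed

text \<open>The weak form of \<open>\<Delta> h = \<delta>\<^sub>x - \<delta>\<^sub>y\<close> on the subnetwork \<open>F\<close>. Unlike the pointwise equation it
  can be tested against the potentials of larger networks.\<close>

definition dipole :: "'v set \<Rightarrow> 'v \<Rightarrow> 'v \<Rightarrow> ('v \<Rightarrow> real) \<Rightarrow> bool" where
  "dipole F x y h \<longleftrightarrow> (\<forall>f. local_energy F h f = f x - f y)"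

lemma dipole_iff:
  assumes F: "finite F" "x \<in> F" "y \<in> F"
  shows "dipole F x y h \<longleftrightarrow>
    (\<forall>z\<in>F. (\<Sum>w\<in>F. c z w * (h z - h w)) = of_bool (z = x) - of_bool (z = y))"
proof
  assume h: "dipole F x y h"
  show "\<forall>z\<in>F. (\<Sum>w\<in>F. c z w * (h z - h w)) = of_bool (z = x) - of_bool (z = y)"
  proof
    fix z assume z: "z \<in> F"
    have "local_energy F h (\<lambda>v. of_bool (v = z)) = (\<Sum>w\<in>F. c z w * (h z - h w))"
      using z F by (simp add: local_energy_green of_bool_def if_distrib if_distribR cong: if_cong)
    then show "(\<Sum>w\<in>F. c z w * (h z - h w)) = of_bool (z = x) - of_bool (z = y)"
      using h by (auto simp: dipole_def)
  qed
next
  assume h: "\<forall>z\<in>F. (\<Sum>w\<in>F. c z w * (h z - h w)) = of_bool (z = x) - of_bool (z = y)"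
  show "dipole F x y h"
    unfolding dipole_def
  proof
    fix f
    have "local_energy F h f = (\<Sum>z\<in>F. f z * (of_bool (z = x) - of_bool (z = y)))"
      unfolding local_energy_green[OF F(1)] using h by (intro sum.cong) auto
    moreover have "(\<Sum>z\<in>F. f z * of_bool (z = a)) = f a" if "a \<in> F" for a
      using that F by (simp add: of_bool_def if_distrib cong: if_cong)
    ultimately show "local_energy F h f = f x - f y"
      using F by (simp only: right_diff_distrib sum_subtractf)
  qed
qed

text \<open>By connectedness, a function of zero energy does not see the poles, so the voltage between
  them is a functional to which the Riesz representation applies.\<close>

lemma dipole_exists:
  assumes F: "finite F" "connected_in c F" "x \<in> F" "y \<in> F"
  shows "\<exists>h. dipole F x y h"
proof -
  obtain C where C: "\<And>f. (f x - f y)\<^sup>2 \<le> C * local_energy F f f"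
    using oscillation_bound[OF F] by blast
  have "\<exists>h. (\<forall>z. z \<notin> F \<longrightarrow> h z = 0) \<and>
      (\<forall>f. (\<forall>z. z \<notin> F \<longrightarrow> f z = 0) \<longrightarrow> local_energy F h f = f x - f y)"
  proof (rule local_riesz[OF F(1) F(1), of "\<lambda>f. f x - f y"])
    fix f assume "local_energy F f f = 0"
    then show "f x - f y = 0" using C[of f] by simp
  qed (auto simp: algebra_simps)
  then obtain h where h: "\<And>f. (\<forall>z. z \<notin> F \<longrightarrow> f z = 0) \<Longrightarrow> local_energy F h f = f x - f y"
    by blast
  have "local_energy F h f = f x - f y" for f
  proof -
    let ?f = "\<lambda>z. if z \<in> F then f z else 0"
    have "local_energy F h ?f = local_energy F h f" by (simp add: local_energy_def)
    then show ?thesis using h[of ?f] F by simp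
  qed
  then show ?thesis by (auto simp: dipole_def)
qed

text \<open>By symmetry of the energy form, two dipole potentials have the same voltage between the poles.\<close>

lemma finite_resistance_dipole:
  assumes F: "finite F" "connected_in c F" "x \<in> F" "y \<in> F" and h: "dipole F x y h"
  shows "finite_resistance c F x y = h x - h y"
  unfolding finite_resistance_def dipole_iff[OF F(1,3,4), symmetric]
proof (rule the_equality)
  show "\<exists>v. dipole F x y v \<and> h x - h y = v x - v y" using h by blast
next
  fix r assume "\<exists>v. dipole F x y v \<and> r = v x - v y"
  then obtain v where v: "dipole F x y v" "r = v x - v y" by blast
  have "v x - v y = local_energy F h v" using h by (simp add: dipole_def)
  also have "\<dots> = h x - h y" using v(1) by (subst local_energy_commute) (simp add: dipole_def)
  finally show "r = h x - h y" using v by simp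
qed

subsection \<open>Passage to the limit along an exhaustion\<close>

lemma exhaustion_contains:
  assumes G: "exhaustion c G" and T: "finite T"
  shows "\<exists>k. \<forall>j\<ge>k. T \<subseteq> G j"
proof -
  have "\<exists>k. z \<in> G k" for z using G by (auto simp: exhaustion_def)
  then obtain n where n: "\<And>z. z \<in> G (n z)" by metis
  show ?thesis
  proof (intro exI allI impI subsetI)
    fix j z assume j: "Max (insert 0 (n ` T)) \<le> j" and z: "z \<in> T"
    have "n z \<le> j" using j T z by simp
    then have "G (n z) \<subseteq> G j" using G by (auto simp: exhaustion_def incseq_def)
    then show "z \<in> G j" using n by blast
  qed
qed

lemma exhaustion_filterlim:
  assumes G: "exhaustion c G"
  shows "filterlim (\<lambda>k. G k \<times> G k) (finite_subsets_at_top UNIV) sequentially"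
  unfolding filterlim_finite_subsets_at_top
proof (intro allI impI)
  fix T :: "('v \<times> 'v) set" assume T: "finite T \<and> T \<subseteq> UNIV"
  then obtain k where k: "\<And>j. k \<le> j \<Longrightarrow> fst ` T \<union> snd ` T \<subseteq> G j"
    using exhaustion_contains[OF G, of "fst ` T \<union> snd ` T"] by auto
  show "\<forall>\<^sub>F j in sequentially. finite (G j \<times> G j) \<and> T \<subseteq> G j \<times> G j \<and> G j \<times> G j \<subseteq> UNIV"
    unfolding eventually_sequentially
  proof (intro exI allI impI)
    fix j assume "k \<le> j"
    then have "T \<subseteq> G j \<times> G j" using k[of j] by force
    then show "finite (G j \<times> G j) \<and> T \<subseteq> G j \<times> G j \<and> G j \<times> G j \<subseteq> UNIV"
      using G by (auto simp: exhaustion_def)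
  qed
qed

definition real_pot :: "('v \<Rightarrow> real) \<Rightarrow> 'v potential" where
  "real_pot f = pot (\<lambda>x. complex_of_real (f x))"

lemma pdiff_real_pot [simp]: "pdiff (real_pot f) x y = complex_of_real (f x - f y)"
  by (simp add: real_pot_def)

lemma real_potential_real_pot [simp]: "real_potential (real_pot f)"
  by (auto simp: real_potential_def real_pot_def)

lemma local_energy_tendsto:
  assumes G: "exhaustion c G" and f: "real_pot f \<in> H" and g: "real_pot g \<in> H"
  shows "(\<lambda>k. complex_of_real (local_energy (G k) f g)) \<longlonglongrightarrow> energy c (real_pot f) (real_pot g)"
proof -
  let ?s = "\<lambda>(x, y). complex_of_real (c x y) * cnj (pdiff (real_pot f) x y) * pdiff (real_pot g) x y"
  have "(?s has_sum (\<Sum>\<^sub>\<infinity>p\<in>UNIV. ?s p)) UNIV"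
    using energy_summable[OF f g] by (rule has_sum_infsum)
  then have "(\<lambda>k. sum ?s (G k \<times> G k)) \<longlonglongrightarrow> (\<Sum>\<^sub>\<infinity>p\<in>UNIV. ?s p)"
    unfolding has_sum_def using exhaustion_filterlim[OF G] by (rule filterlim_compose)
  then have "(\<lambda>k. 1 / 2 * sum ?s (G k \<times> G k)) \<longlonglongrightarrow> 1 / 2 * (\<Sum>\<^sub>\<infinity>p\<in>UNIV. ?s p)"
    by (rule tendsto_mult_left)
  moreover have "1 / 2 * sum ?s (G k \<times> G k) = complex_of_real (local_energy (G k) f g)" for k
    using G by (simp add: local_energy_def exhaustion_def sum.cartesian_product case_prod_unfold)
  ultimately show ?thesis unfolding energy_eq by simp
qed

lemma local_energy_le_enorm:
  assumes F: "finite F" and f: "real_pot f \<in> H"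
  shows "local_energy F f f \<le> (enorm c (real_pot f))\<^sup>2"
proof -
  have "(\<Sum>(x, y)\<in>F \<times> F. c x y * (cmod (pdiff (real_pot f) x y))\<^sup>2) \<le>
      (\<Sum>\<^sub>\<infinity>(x, y)\<in>UNIV. c x y * (cmod (pdiff (real_pot f) x y))\<^sup>2)"
    using f F by (intro finite_sum_le_infsum) (auto simp: H_iff)
  moreover have "(\<Sum>(x, y)\<in>F \<times> F. c x y * (cmod (pdiff (real_pot f) x y))\<^sup>2) = 2 * local_energy F f f"
    by (simp add: local_energy_def sum.cartesian_product power2_eq_square mult.assoc del: of_real_diff)
  ultimately show ?thesis by (simp add: energy_self_eq)
qed

text \<open>Each finite network yields the dipole potential \<open>h k\<close>. Testing these against each other shows
  that the resistances \<open>R k\<close> decrease and that \<open>h k - h j\<close> has energy at most \<open>R k - R j\<close> on \<open>G k\<close>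
  for \<open>j \<ge> k\<close>. Hence the \<open>h k\<close> converge pointwise, and the limit represents evaluation differences on
  the whole energy space.\<close>

lemma dipole_limit:
  assumes G: "exhaustion c G" and xy: "\<And>k. x \<in> G k" "\<And>k. y \<in> G k"
  shows "\<exists>h. real_pot h \<in> H \<and> (\<forall>u\<in>H. energy c (real_pot h) u = pdiff u x y) \<and>
    (\<lambda>k. finite_resistance c (G k) x y) \<longlonglongrightarrow> h x - h y"
proof -
  have fin: "finite (G k)" and con: "connected_in c (G k)" for k
    using G by (auto simp: exhaustion_def)
  have inc: "G k \<subseteq> G j" if "k \<le> j" for k j
    using G that by (auto simp: exhaustion_def incseq_def)
  have "\<exists>h. dipole (G k) x y h \<and> h y = 0" for k
  proof -
    obtain h where h: "dipole (G k) x y h" using dipole_exists[OF fin con xy] by blast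
    have "local_energy (G k) (\<lambda>z. h z - h y) f = local_energy (G k) h f" for f
      by (simp add: local_energy_def)
    then have "dipole (G k) x y (\<lambda>z. h z - h y)" using h by (simp add: dipole_def)
    then show ?thesis by (intro exI[of _ "\<lambda>z. h z - h y"]) simp
  qed
  then obtain h where h: "\<And>k. dipole (G k) x y (h k)" and hy: "\<And>k. h k y = 0" by metis
  have hE: "local_energy (G k) (h k) f = f x - f y" for k f using h[of k] by (simp add: dipole_def)
  define R where "R k = h k x" for k
  have Rk: "finite_resistance c (G k) x y = R k" for k
    using finite_resistance_dipole[OF fin con xy h] by (simp add: R_def hy)
  have RE: "local_energy (G k) (h k) (h k) = R k" for k by (simp add: hE hy R_def)
  have R0: "0 \<le> R k" for k using local_energy_nonneg[of "G k" "h k"] by (simp add: RE)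
  have diff: "local_energy (G k) (\<lambda>z. h k z - h j z) (\<lambda>z. h k z - h j z) \<le> R k - R j" if "k \<le> j" for k j
  proof -
    have "local_energy (G k) (\<lambda>z. h k z - h j z) (\<lambda>z. h k z - h j z) =
        R k - 2 * local_energy (G k) (h k) (h j) + local_energy (G k) (h j) (h j)"
      by (simp add: local_energy_diff_left local_energy_diff_right RE local_energy_commute[of "G k" "h j" "h k"])
    also have "local_energy (G k) (h k) (h j) = R j" by (simp add: hE hy R_def)
    also have "local_energy (G k) (h j) (h j) \<le> R j"
      using local_energy_mono[OF inc[OF that] fin, of "h j"] by (simp add: RE)
    finally show ?thesis by simp
  qed
  have Rdec: "R j \<le> R k" if "k \<le> j" for k j
    using diff[OF that] local_energy_nonneg[of "G k" "\<lambda>z. h k z - h j z"] by linarith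
  then have "decseq R" by (simp add: decseq_def)
  then obtain r where r: "R \<longlonglongrightarrow> r" "\<And>k. r \<le> R k"
    using decseq_convergent[of R 0] R0 by auto
  have "convergent (\<lambda>k. h k z)" for z
  proof -
    obtain k0 where k0: "\<And>j. k0 \<le> j \<Longrightarrow> {z} \<subseteq> G j" using exhaustion_contains[OF G, of "{z}"] by auto
    obtain C where C: "0 \<le> C" "\<And>f. (f z - f y)\<^sup>2 \<le> C * local_energy (G k0) f f"
      using oscillation_bound[OF fin con _ xy(2), of z k0] k0[of k0] by auto
    have "Cauchy (\<lambda>k. h k z)"
    proof (rule metric_CauchyI)
      fix e :: real assume e: "0 < e"
      have "Cauchy R" using r(1) LIMSEQ_imp_Cauchy by blast
      then obtain N where N: "\<And>m n. N \<le> m \<Longrightarrow> N \<le> n \<Longrightarrow> dist (R m) (R n) < e\<^sup>2 / (C + 1)"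
        using e C(1) metric_CauchyD[of R "e\<^sup>2 / (C + 1)"] by (metis add_nonneg_pos divide_pos_pos zero_less_one zero_less_power)
      have main: "\<bar>h m z - h n z\<bar> < e" if mn: "max N k0 \<le> m" "m \<le> n" for m n
      proof -
        let ?f = "\<lambda>z. h m z - h n z"
        have "(h m z - h n z)\<^sup>2 \<le> C * local_energy (G k0) ?f ?f" using C(2)[of ?f] by (simp add: hy)
        also have "\<dots> \<le> C * local_energy (G m) ?f ?f"
          using mn C inc[of k0 m] fin by (intro mult_left_mono local_energy_mono) auto
        also have "\<dots> \<le> C * (R m - R n)" using mn C diff by (intro mult_left_mono) auto
        also have "\<dots> \<le> C * (e\<^sup>2 / (C + 1))"
          using N[of m n] mn C Rdec[of m n] by (intro mult_left_mono) (auto simp: dist_real_def)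
        also have "\<dots> < e\<^sup>2" using e C by (simp add: field_simps)
        finally show ?thesis using power2_less_imp_less[of "\<bar>h m z - h n z\<bar>" e] e by simp
      qed
      show "\<exists>M. \<forall>m\<ge>M. \<forall>n\<ge>M. dist (h m z) (h n z) < e"
      proof (intro exI allI impI)
        fix m n assume "max N k0 \<le> m" "max N k0 \<le> n"
        then show "dist (h m z) (h n z) < e"
          using main[of m n] main[of n m] by (cases "m \<le> n") (auto simp: dist_real_def)
      qed
    qed
    then show ?thesis by (rule Cauchy_convergent)
  qed
  then obtain g where g: "\<And>z. (\<lambda>k. h k z) \<longlonglongrightarrow> g z" unfolding convergent_def by metis
  have lim: "(\<lambda>j. local_energy (G k) (\<lambda>z. a z - h j z) (\<lambda>z. a z - h j z)) \<longlonglongrightarrow>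
      local_energy (G k) (\<lambda>z. a z - g z) (\<lambda>z. a z - g z)" for k and a :: "'v \<Rightarrow> real"
    unfolding local_energy_def by (intro tendsto_intros g)
  have close: "local_energy (G k) (\<lambda>z. h k z - g z) (\<lambda>z. h k z - g z) \<le> R k - r" for k
  proof (rule LIMSEQ_le[OF lim tendsto_diff[OF tendsto_const r(1)]])
    show "\<exists>N. \<forall>j\<ge>N. local_energy (G k) (\<lambda>z. h k z - h j z) (\<lambda>z. h k z - h j z) \<le> R k - R j"
      using diff by blast
  qed
  have bound: "local_energy (G k) g g \<le> R 0" for k
  proof (rule LIMSEQ_le_const2)
    have l: "(\<lambda>j. local_energy (G k) (h j) (h j)) \<longlonglongrightarrow> local_energy (G k) g g"
      unfolding local_energy_def by (intro tendsto_intros g)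
    then show "(\<lambda>j. local_energy (G k) (h j) (h j)) \<longlonglongrightarrow> local_energy (G k) g g" .
    show "\<exists>N. \<forall>j\<ge>N. local_energy (G k) (h j) (h j) \<le> R 0"
    proof (intro exI allI impI)
      fix j assume "k \<le> j"
      then have "local_energy (G k) (h j) (h j) \<le> R j"
        using local_energy_mono[OF inc fin, of k j "h j"] by (simp add: RE)
      then show "local_energy (G k) (h j) (h j) \<le> R 0" using Rdec[of 0 j] by simp
    qed
  qed
  have gH: "real_pot g \<in> H"
    unfolding H_iff
  proof (rule nonneg_bdd_above_summable_on)
    show "bdd_above (sum (\<lambda>(x, y). c x y * (cmod (pdiff (real_pot g) x y))\<^sup>2) ` {F. F \<subseteq> UNIV \<and> finite F})"
    proof (rule bdd_aboveI2)
      fix T :: "('v \<times> 'v) set" assume "T \<in> {F. F \<subseteq> UNIV \<and> finite F}"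
      then have T: "finite T" by simp
      then obtain k where k: "fst ` T \<union> snd ` T \<subseteq> G k"
        using exhaustion_contains[OF G, of "fst ` T \<union> snd ` T"] by auto
      then have "T \<subseteq> G k \<times> G k" by force
      then have "(\<Sum>(x, y)\<in>T. c x y * (cmod (pdiff (real_pot g) x y))\<^sup>2) \<le>
          (\<Sum>(x, y)\<in>G k \<times> G k. c x y * (cmod (pdiff (real_pot g) x y))\<^sup>2)"
        using fin by (intro sum_mono2) auto
      also have "\<dots> = 2 * local_energy (G k) g g"
        by (simp add: local_energy_def sum.cartesian_product power2_eq_square mult.assoc del: of_real_diff)
      also have "\<dots> \<le> 2 * R 0" using bound by simp
      finally show "(\<Sum>(x, y)\<in>T. c x y * (cmod (pdiff (real_pot g) x y))\<^sup>2) \<le> 2 * R 0" .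
    qed
  qed auto
  have real_rep: "energy c (real_pot g) (real_pot f) = complex_of_real (f x - f y)"
    if f: "real_pot f \<in> H" for f
  proof (rule LIMSEQ_unique[OF local_energy_tendsto[OF G gH f]])
    have "(\<lambda>k. local_energy (G k) g f - (f x - f y)) \<longlonglongrightarrow> 0"
    proof (rule Lim_null_comparison)
      show "\<forall>\<^sub>F k in sequentially. norm (local_energy (G k) g f - (f x - f y)) \<le>
          sqrt ((R k - r) * (enorm c (real_pot f))\<^sup>2)"
      proof (intro always_eventually allI)
        fix k
        let ?d = "\<lambda>z. h k z - g z"
        have "local_energy (G k) g f - (f x - f y) = - local_energy (G k) ?d f"
          by (simp add: local_energy_diff_left hE)
        moreover have "(local_energy (G k) ?d f)\<^sup>2 \<le> (R k - r) * (enorm c (real_pot f))\<^sup>2"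
          using local_energy_Cauchy_Schwarz[of "G k" ?d f] close[of k] local_energy_le_enorm[OF fin f, of k] r(2)[of k]
          by (meson diff_ge_0_iff_ge local_energy_nonneg mult_mono order_trans)
        ultimately show "norm (local_energy (G k) g f - (f x - f y)) \<le> sqrt ((R k - r) * (enorm c (real_pot f))\<^sup>2)"
          by (simp add: real_le_rsqrt)
      qed
      have "(\<lambda>k. sqrt ((R k - r) * (enorm c (real_pot f))\<^sup>2)) \<longlonglongrightarrow> sqrt ((r - r) * (enorm c (real_pot f))\<^sup>2)"
        by (intro tendsto_intros r)
      then show "(\<lambda>k. sqrt ((R k - r) * (enorm c (real_pot f))\<^sup>2)) \<longlonglongrightarrow> 0" by simp
    qed
    then have "(\<lambda>k. local_energy (G k) g f) \<longlonglongrightarrow> f x - f y" by (rule LIM_zero_cancel)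
    then show "(\<lambda>k. complex_of_real (local_energy (G k) g f)) \<longlonglongrightarrow> complex_of_real (f x - f y)"
      by (rule tendsto_of_real)
  qed
  have "energy c (real_pot g) u = pdiff u x y" if u: "u \<in> H" for u
  proof -
    obtain f where f: "u = pot f" using pot_surj by blast
    have Re: "pot_Re u = real_pot (\<lambda>z. Re (f z))" and Im: "pot_Im u = real_pot (\<lambda>z. Im (f z))"
      by (rule potential_eqI'; simp add: f)+
    have "energy c (real_pot g) u = energy c (real_pot g) (pot_Re u) + \<i> * energy c (real_pot g) (pot_Im u)"
      by (subst pot_Re_Im[of u]) (use u gH in \<open>simp add: energy_add_right\<close>)
    also have "\<dots> = complex_of_real (Re (f x) - Re (f y)) + \<i> * complex_of_real (Im (f x) - Im (f y))"
      using u real_rep[of "\<lambda>z. Re (f z)"] real_rep[of "\<lambda>z. Im (f z)"] by (simp add: Re[symmetric] Im[symmetric])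
    also have "\<dots> = pdiff u x y" by (simp add: f complex_eq_iff)
    finally show ?thesis .
  qed
  moreover have "(\<lambda>k. finite_resistance c (G k) x y) \<longlonglongrightarrow> g x - g y"
    unfolding Rk R_def using tendsto_diff[OF g[of x] g[of y]] by (simp add: hy)
  ultimately show ?thesis using gH by blast
qed

lemma connected_in_union:
  assumes "connected_in c F" "connected_in c G" "b \<in> F" "b \<in> G"
  shows "connected_in c (F \<union> G)"
proof -
  let ?r = "\<lambda>F. {(a, b). a \<in> F \<and> b \<in> F \<and> c a b > 0}"
  have mono: "(?r F)\<^sup>* \<subseteq> (?r (F \<union> G))\<^sup>*" "(?r G)\<^sup>* \<subseteq> (?r (F \<union> G))\<^sup>*"
    by (intro rtrancl_mono; auto)+
  have "(z, b) \<in> (?r (F \<union> G))\<^sup>* \<and> (b, z) \<in> (?r (F \<union> G))\<^sup>*" if "z \<in> F \<union> G" for z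
    using that assms mono unfolding connected_in_def by blast
  then show ?thesis unfolding connected_in_def by (meson rtrancl_trans)
qed

lemma finite_connected_containing:
  "\<exists>F. finite F \<and> connected_in c F \<and> b \<in> F \<and> z \<in> F"
  using connected[of b z]
proof (induction rule: rtrancl_induct)
  case base
  show ?case by (intro exI[of _ "{b}"]) (auto simp: connected_in_def)
next
  case (step y z)
  then obtain F where F: "finite F" "connected_in c F" "b \<in> F" "y \<in> F" by blast
  have "connected_in c {y, z}"
  proof -
    have "(y, z) \<in> {(a, b). a \<in> {y, z} \<and> b \<in> {y, z} \<and> c a b > 0}"
      "(z, y) \<in> {(a, b). a \<in> {y, z} \<and> b \<in> {y, z} \<and> c a b > 0}"
      using step(2) c_sym[of y z] by auto
    then show ?thesis unfolding connected_in_def by (auto intro: r_into_rtrancl)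
  qed
  then have "connected_in c (F \<union> {y, z})" using F by (intro connected_in_union[where b = y]) auto
  then show ?case using F by (intro exI[of _ "F \<union> {y, z}"]) auto
qed

text \<open>Summability of the conductances at a vertex leaves only countably many neighbours, so a
  connected network is countable.\<close>

lemma countable_vertices: "countable (UNIV :: 'v set)"
proof -
  have nb: "countable {y. c x y > 0}" for x
  proof -
    have "c x summable_on {y. c x y > 0}" using network by (auto simp: resistance_network_def)
    then have "(\<lambda>y. norm (c x y)) summable_on {y. c x y > 0}"
      by simp
    from abs_summable_countable[OF this] show ?thesis
      by (rule countable_subset[rotated]) auto
  qed
  define L where "L = rec_nat {undefined :: 'v} (\<lambda>_ S. \<Union>x\<in>S. {y. c x y > 0})"
  have "countable (L n)" for n by (induction n) (auto simp: L_def nb)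
  moreover have "z \<in> (\<Union>n. L n)" for z
    using connected[of undefined z]
  proof (induction rule: rtrancl_induct)
    case base
    have "undefined \<in> L 0" by (simp add: L_def)
    then show ?case by blast
  next
    case (step y z)
    then obtain n where "y \<in> L n" by blast
    then have "z \<in> L (Suc n)" using step(2) by (auto simp: L_def)
    then show ?case by blast
  qed
  ultimately show ?thesis by (metis UNIV_eq_I countable_UN countableI_type)
qed

lemma exhaustion_exists: "\<exists>G. exhaustion c G \<and> (\<forall>k. x \<in> G k \<and> y \<in> G k)"
proof -
  obtain P where P: "\<And>z. finite (P z)" "\<And>z. connected_in c (P z)" "\<And>z. x \<in> P z" "\<And>z. z \<in> P z"
    using finite_connected_containing[of x] by metis
  define G where "G k = rec_nat (P y) (\<lambda>i F. F \<union> P (from_nat_into UNIV i)) k" for k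
  have G0: "G 0 = P y" and GS: "G (Suc k) = G k \<union> P (from_nat_into UNIV k)" for k
    by (auto simp: G_def)
  have fc: "finite (G k) \<and> connected_in c (G k) \<and> x \<in> G k \<and> y \<in> G k" for k
    by (induction k) (auto simp: G0 GS P intro!: connected_in_union[where b = x])
  moreover have "incseq G" by (rule incseq_SucI) (auto simp: GS)
  moreover have "z \<in> (\<Union>k. G k)" for z
  proof -
    obtain i where i: "from_nat_into UNIV i = z"
      using from_nat_into_surj[OF countable_vertices, of z] by auto
    have "z \<in> G (Suc i)" using P(4)[of z] by (simp add: GS i)
    then show ?thesis by blast
  qed
  ultimately show ?thesis unfolding exhaustion_def by blast
qed

lemma free_resistance_eq:
  assumes "\<And>G. exhaustion c G \<Longrightarrow> (\<And>k. x \<in> G k \<and> y \<in> G k) \<Longrightarrow> (\<lambda>k. finite_resistance c (G k) x y) \<longlonglongrightarrow> r"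
  shows "free_resistance c x y = r"
  unfolding free_resistance_def
proof (rule the_equality)
  show "\<forall>G. exhaustion c G \<and> (\<forall>k. x \<in> G k \<and> y \<in> G k) \<longrightarrow> (\<lambda>k. finite_resistance c (G k) x y) \<longlonglongrightarrow> r"
    using assms by blast
next
  fix r' assume r': "\<forall>G. exhaustion c G \<and> (\<forall>k. x \<in> G k \<and> y \<in> G k) \<longrightarrow> (\<lambda>k. finite_resistance c (G k) x y) \<longlonglongrightarrow> r'"
  obtain G where "exhaustion c G \<and> (\<forall>k. x \<in> G k \<and> y \<in> G k)" using exhaustion_exists by blast
  with r' assms show "r' = r" by (meson LIMSEQ_unique)
qed

lemma energy_separates_left:
  assumes "u \<in> H" "v \<in> H" "\<And>w. w \<in> H \<Longrightarrow> energy c u w = energy c v w"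
  shows "u = v"
  using assms by (intro energy_separates) (auto, metis energy_commute)

lemma energy_kernel:
  shows energy_kernel_H [simp]: "energy_kernel c b x \<in> H"
    and energy_kernel_reproduces: "u \<in> H \<Longrightarrow> energy c (energy_kernel c b x) u = pdiff u x b"
    and energy_kernel_real: "real_potential (energy_kernel c b x)"
proof -
  obtain G where G: "exhaustion c G" "\<And>k. x \<in> G k \<and> b \<in> G k" using exhaustion_exists by blast
  obtain h where h: "real_pot h \<in> H" "\<And>u. u \<in> H \<Longrightarrow> energy c (real_pot h) u = pdiff u x b"
    using dipole_limit[OF G(1), of x b] G(2) by auto
  have "energy_kernel c b x = real_pot h"
    unfolding energy_kernel_def using h by (intro the_equality) (auto intro: energy_separates_left)
  with h show "energy_kernel c b x \<in> H" "u \<in> H \<Longrightarrow> energy c (energy_kernel c b x) u = pdiff u x b"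
    "real_potential (energy_kernel c b x)" by auto
qed

text \<open>The free resistance is the squared distance of two kernel vectors, because their difference is
  the potential reached in the limit over finite subnetworks.\<close>

lemma free_resistance_energy_kernel:
  "free_resistance c x y = (enorm c (energy_kernel c b x - energy_kernel c b y))\<^sup>2"
proof (rule free_resistance_eq)
  fix G assume G: "exhaustion c G" "\<And>k. x \<in> G k \<and> y \<in> G k"
  obtain h where h: "real_pot h \<in> H" "\<And>u. u \<in> H \<Longrightarrow> energy c (real_pot h) u = pdiff u x y"
      "(\<lambda>k. finite_resistance c (G k) x y) \<longlonglongrightarrow> h x - h y"
    using dipole_limit[OF G(1), of x y] G(2) by auto
  have "energy_kernel c b x - energy_kernel c b y = real_pot h"
  proof (rule energy_separates_left)
    fix w assume w: "w \<in> H"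
    show "energy c (energy_kernel c b x - energy_kernel c b y) w = energy c (real_pot h) w"
      using w h(2)[OF w] pdiff_trans[of w x b y] pdiff_swap[of w b y]
      by (simp add: energy_diff_left energy_kernel_reproduces)
  qed (use h in auto)
  moreover have "(enorm c (real_pot h))\<^sup>2 = h x - h y"
    using h(2)[OF h(1)] by (simp add: energy_self flip: of_real_diff of_real_power)
  ultimately show "(\<lambda>k. finite_resistance c (G k) x y) \<longlonglongrightarrow> (enorm c (energy_kernel c b x - energy_kernel c b y))\<^sup>2"
    using h(3) by simp
qed

end

section \<open>Characteristic functions, independence and almost sure convergence\<close>

text \<open>Positive and negative part of \<open>Z\<close>, used as densities, give two laws of \<open>X\<close> with
  the same characteristic function. Levy's uniqueness theorem identifies these laws.\<close>

lemma (in prob_space) fourier_orthogonal_real: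
  fixes X Z :: "'a \<Rightarrow> real"
  assumes X [measurable]: "X \<in> borel_measurable M" and Z: "integrable M Z"
    and zero: "\<And>s. (CLINT \<omega>|M. iexp (s * X \<omega>) * complex_of_real (Z \<omega>)) = 0"
    and B [measurable]: "B \<in> sets borel"
  shows "(\<integral>\<omega>. indicator B (X \<omega>) * Z \<omega> \<partial>M) = 0"
proof -
  define p where "p \<omega> = max 0 (Z \<omega>)" for \<omega>
  define n where "n \<omega> = max 0 (- Z \<omega>)" for \<omega>
  have Zpn: "Z \<omega> = p \<omega> - n \<omega>" for \<omega> by (auto simp: p_def n_def)
  have [measurable]: "Z \<in> borel_measurable M" using Z by simp
  have int: "integrable M p" "integrable M n" using Z unfolding p_def n_def by auto
  have nonneg: "0 \<le> p \<omega>" "0 \<le> n \<omega>" for \<omega> by (auto simp: p_def n_def)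
  define m where "m = integral\<^sup>L M p"
  have "(\<integral>\<omega>. Z \<omega> \<partial>M) = 0" using zero[of 0] by simp
  then have mn: "integral\<^sup>L M n = m" using int by (simp add: m_def Zpn)
  show ?thesis
  proof (cases "m = 0")
    case True
    then have "AE \<omega> in M. p \<omega> = 0" "AE \<omega> in M. n \<omega> = 0"
      using integral_nonneg_eq_0_iff_AE[of M p] integral_nonneg_eq_0_iff_AE[of M n] int nonneg mn
      by (auto simp: m_def)
    then have "AE \<omega> in M. indicator B (X \<omega>) * Z \<omega> = 0" by eventually_elim (simp add: Zpn)
    then show ?thesis by (rule integral_eq_zero_AE)
  next
    case False
    then have m: "0 < m" using nonneg unfolding m_def by (simp add: order_less_le integral_nonneg)
    define law where "law f = distr (density M (\<lambda>\<omega>. ennreal (f \<omega> / m))) borel X" for f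
    have law_integral: "integral\<^sup>L (law f) g = (\<integral>\<omega>. (f \<omega> / m) *\<^sub>R g (X \<omega>) \<partial>M)"
      if [measurable]: "f \<in> borel_measurable M" "g \<in> borel_measurable borel" and "\<And>\<omega>. 0 \<le> f \<omega>"
      for f and g :: "real \<Rightarrow> 'b :: {banach, second_countable_topology}"
      unfolding law_def using that m
      by (subst integral_distr) (auto intro!: integral_density)
    have law_prob: "real_distribution (law f)"
      if f: "integrable M f" "\<And>\<omega>. 0 \<le> f \<omega>" "integral\<^sup>L M f = m" for f
    proof -
      have [measurable]: "f \<in> borel_measurable M" using f by simp
      have "emeasure (density M (\<lambda>\<omega>. ennreal (f \<omega> / m))) (space M) = (\<integral>\<^sup>+\<omega>. ennreal (f \<omega> / m) \<partial>M)"
        by (simp add: emeasure_density cong: nn_integral_cong)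
      also have "\<dots> = ennreal (\<integral>\<omega>. f \<omega> / m \<partial>M)"
        using f m by (intro nn_integral_eq_integral) auto
      also have "\<dots> = 1" using f m by simp
      finally have "prob_space (density M (\<lambda>\<omega>. ennreal (f \<omega> / m)))"
        by (intro prob_spaceI) simp
      then show ?thesis unfolding law_def
        by (rule prob_space.real_distribution_distr) simp
    qed
    have "char (law p) s = char (law n) s" for s
    proof -
      have i: "integrable M (\<lambda>\<omega>. (f \<omega> / m) *\<^sub>R iexp (s * X \<omega>))" if "integrable M f" for f
      proof (rule Bochner_Integration.integrable_bound[of M "\<lambda>\<omega>. f \<omega> / m"])
        show "integrable M (\<lambda>\<omega>. f \<omega> / m)" using that by simp
        have [measurable]: "f \<in> borel_measurable M" using that by simp
        show "(\<lambda>\<omega>. (f \<omega> / m) *\<^sub>R iexp (s * X \<omega>)) \<in> borel_measurable M" by measurable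
      qed simp
      have "char (law p) s - char (law n) s =
          (CLINT \<omega>|M. (p \<omega> / m) *\<^sub>R iexp (s * X \<omega>)) - (CLINT \<omega>|M. (n \<omega> / m) *\<^sub>R iexp (s * X \<omega>))"
        using int nonneg by (simp add: char_def law_integral)
      also have "\<dots> = (CLINT \<omega>|M. (p \<omega> / m) *\<^sub>R iexp (s * X \<omega>) - (n \<omega> / m) *\<^sub>R iexp (s * X \<omega>))"
        using i[OF int(1)] i[OF int(2)] by simp
      also have "\<dots> = (CLINT \<omega>|M. complex_of_real (1 / m) * (iexp (s * X \<omega>) * complex_of_real (Z \<omega>)))"
        by (intro Bochner_Integration.integral_cong) (auto simp: Zpn scaleR_conv_of_real ring_distribs diff_divide_distrib mult.commute)
      also have "\<dots> = 0" using zero[of s] by (simp del: of_real_divide)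
      finally show ?thesis by simp
    qed
    then have "law p = law n"
      using int nonneg mn m_def by (intro Levy_uniqueness law_prob) auto
    then have eq': "integral\<^sup>L (law p) (indicator B :: real \<Rightarrow> real) = integral\<^sup>L (law n) (indicator B)"
      by (rule arg_cong)
    have meas: "p \<in> borel_measurable M" "n \<in> borel_measurable M"
      "(indicator B :: real \<Rightarrow> real) \<in> borel_measurable borel" using int by auto
    have "(\<integral>\<omega>. (p \<omega> / m) *\<^sub>R (indicator B (X \<omega>) :: real) \<partial>M) =
        (\<integral>\<omega>. (n \<omega> / m) *\<^sub>R (indicator B (X \<omega>) :: real) \<partial>M)"
      using eq' unfolding law_integral[OF meas(1,3) nonneg(1)] law_integral[OF meas(2,3) nonneg(2)] .
    then have eq: "(\<integral>\<omega>. p \<omega> * indicator B (X \<omega>) \<partial>M) = (\<integral>\<omega>. n \<omega> * indicator B (X \<omega>) \<partial>M)"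
      using m by simp
    have j: "integrable M (\<lambda>\<omega>. f \<omega> * indicator B (X \<omega>))" if "integrable M f" for f :: "'a \<Rightarrow> real"
    proof (rule Bochner_Integration.integrable_bound[OF that])
      have [measurable]: "f \<in> borel_measurable M" using that by simp
      show "(\<lambda>\<omega>. f \<omega> * indicator B (X \<omega>)) \<in> borel_measurable M" by measurable
    qed (simp add: indicator_def)
    have "(\<integral>\<omega>. indicator B (X \<omega>) * Z \<omega> \<partial>M) =
        (\<integral>\<omega>. p \<omega> * indicator B (X \<omega>) - n \<omega> * indicator B (X \<omega>) \<partial>M)"
      by (intro Bochner_Integration.integral_cong) (auto simp: Zpn algebra_simps)
    then show ?thesis using j[OF int(1)] j[OF int(2)] eq by simp
  qed
qed

lemma (in prob_space) integrable_iexp_mult: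
  assumes [measurable]: "X \<in> borel_measurable M" and Z: "integrable M Z"
  shows "integrable M (\<lambda>\<omega>. iexp (X \<omega>) * Z \<omega>)"
proof (rule Bochner_Integration.integrable_bound[OF Z])
  have [measurable]: "Z \<in> borel_measurable M" using Z by simp
  show "(\<lambda>\<omega>. iexp (X \<omega>) * Z \<omega>) \<in> borel_measurable M" by measurable
qed (simp add: norm_mult)

lemma (in finite_measure) complex_indicator_integral:
  assumes "A \<in> sets M"
  shows "integrable M (\<lambda>\<omega>. indicator A \<omega> :: complex)"
    and "(CLINT \<omega>|M. indicator A \<omega>) = complex_of_real (measure M A)"
proof -
  have eq: "(\<lambda>\<omega>. indicator A \<omega> :: complex) = (\<lambda>\<omega>. complex_of_real (indicator A \<omega>))"
    by (auto simp: indicator_def)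
  show "integrable M (\<lambda>\<omega>. indicator A \<omega> :: complex)"
    unfolding eq using assms by (simp add: emeasure_eq_measure)
  show "(CLINT \<omega>|M. indicator A \<omega>) = complex_of_real (measure M A)"
    unfolding eq integral_complex_of_real using assms by simp
qed

text \<open>The condition on \<open>Z\<close> passes to its complex conjugate by exchanging \<open>s\<close> and \<open>- s\<close>, hence to
  the real and the imaginary part.\<close>

lemma (in prob_space) fourier_orthogonal:
  fixes X :: "'a \<Rightarrow> real" and Z :: "'a \<Rightarrow> complex"
  assumes X [measurable]: "X \<in> borel_measurable M" and Z: "integrable M Z"
    and zero: "\<And>s. (CLINT \<omega>|M. iexp (s * X \<omega>) * Z \<omega>) = 0"
    and B [measurable]: "B \<in> sets borel"
  shows "(CLINT \<omega>|M. indicator B (X \<omega>) * Z \<omega>) = 0"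
proof -
  have [measurable]: "Z \<in> borel_measurable M" using Z by simp
  have zero': "(CLINT \<omega>|M. iexp (s * X \<omega>) * cnj (Z \<omega>)) = 0" for s
  proof -
    have "(CLINT \<omega>|M. iexp (s * X \<omega>) * cnj (Z \<omega>)) = (CLINT \<omega>|M. cnj (iexp (- s * X \<omega>) * Z \<omega>))"
      by (intro Bochner_Integration.integral_cong) (auto simp: exp_cnj)
    also have "\<dots> = cnj (CLINT \<omega>|M. iexp (- s * X \<omega>) * Z \<omega>)" by (rule Bochner_Integration.integral_cnj)
    finally show ?thesis using zero[of "- s"] by simp
  qed
  have i: "integrable M (\<lambda>\<omega>. iexp (s * X \<omega>) * Z \<omega>)" "integrable M (\<lambda>\<omega>. iexp (s * X \<omega>) * cnj (Z \<omega>))" for s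
    using Z by (intro integrable_iexp_mult; simp)+
  have re: "(CLINT \<omega>|M. iexp (s * X \<omega>) * complex_of_real (Re (Z \<omega>))) = 0" for s
  proof -
    have "(CLINT \<omega>|M. iexp (s * X \<omega>) * complex_of_real (Re (Z \<omega>))) =
        (CLINT \<omega>|M. 1 / 2 * (iexp (s * X \<omega>) * Z \<omega> + iexp (s * X \<omega>) * cnj (Z \<omega>)))"
      by (intro Bochner_Integration.integral_cong)
        (auto simp flip: distrib_left simp: complex_add_cnj)
    then show ?thesis using zero[of s] zero'[of s] i[of s] by simp
  qed
  have im_part: "w * complex_of_real (Im z) = 1 / (2 * \<i>) * (w * z - w * cnj z)" for w z
    unfolding right_diff_distrib[symmetric] complex_diff_cnj by (simp add: field_simps)
  have im: "(CLINT \<omega>|M. iexp (s * X \<omega>) * complex_of_real (Im (Z \<omega>))) = 0" for s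
  proof -
    have "(CLINT \<omega>|M. iexp (s * X \<omega>) * complex_of_real (Im (Z \<omega>))) =
        (CLINT \<omega>|M. 1 / (2 * \<i>) * (iexp (s * X \<omega>) * Z \<omega> - iexp (s * X \<omega>) * cnj (Z \<omega>)))"
      by (intro Bochner_Integration.integral_cong refl im_part)
    then show ?thesis using zero[of s] zero'[of s] i[of s] by simp
  qed
  have j: "integrable M (\<lambda>\<omega>. indicator B (X \<omega>) * Z \<omega>)"
    by (rule Bochner_Integration.integrable_bound[OF Z]) (auto simp: indicator_def)
  have "Re (CLINT \<omega>|M. indicator B (X \<omega>) * Z \<omega>) = (\<integral>\<omega>. indicator B (X \<omega>) * Re (Z \<omega>) \<partial>M)"
    unfolding integral_Re[OF j, symmetric]
    by (intro Bochner_Integration.integral_cong) (auto simp: indicator_def)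
  moreover have "Im (CLINT \<omega>|M. indicator B (X \<omega>) * Z \<omega>) = (\<integral>\<omega>. indicator B (X \<omega>) * Im (Z \<omega>) \<partial>M)"
    unfolding integral_Im[OF j, symmetric]
    by (intro Bochner_Integration.integral_cong) (auto simp: indicator_def)
  moreover have "(\<integral>\<omega>. indicator B (X \<omega>) * Re (Z \<omega>) \<partial>M) = 0"
    using Z re by (intro fourier_orthogonal_real) auto
  moreover have "(\<integral>\<omega>. indicator B (X \<omega>) * Im (Z \<omega>) \<partial>M) = 0"
    using Z im by (intro fourier_orthogonal_real) auto
  ultimately show ?thesis by (simp add: complex_eq_iff)
qed

text \<open>The variables \<open>X 0, \<dots>, X (k - 1)\<close> are exchanged for indicators one at a time.\<close>

lemma (in prob_space) fourier_orthogonal_rectangle: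
  fixes X :: "nat \<Rightarrow> 'a \<Rightarrow> real" and Z :: "'a \<Rightarrow> complex"
  assumes X [measurable]: "\<And>j. X j \<in> borel_measurable M" and Z: "integrable M Z"
    and zero: "\<And>t. (CLINT \<omega>|M. iexp (\<Sum>j<k. t j * X j \<omega>) * Z \<omega>) = 0"
    and B [measurable]: "\<And>j. B j \<in> sets borel"
  shows "(CLINT \<omega>|M. (\<Prod>j<k. indicator (B j) (X j \<omega>)) * Z \<omega>) = 0"
  using Z zero
proof (induction k arbitrary: Z)
  case 0
  then show ?case by simp
next
  case (Suc k)
  have [measurable]: "Z \<in> borel_measurable M" using Suc.prems by simp
  let ?R = "\<lambda>\<omega>. (\<Prod>j<k. indicator (B j) (X j \<omega>)) :: complex"
  have R: "integrable M (\<lambda>\<omega>. ?R \<omega> * Z \<omega>)"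
  proof (rule Bochner_Integration.integrable_bound[OF Suc.prems(1)])
    have "norm (?R \<omega>) \<le> 1" for \<omega>
      unfolding prod_norm[symmetric] by (intro prod_le_1) (auto simp: indicator_def)
    then have "norm (?R \<omega> * Z \<omega>) \<le> norm (Z \<omega>)" for \<omega>
      by (simp only: norm_mult) (metis mult.commute mult_left_le norm_ge_zero)
    then show "AE \<omega> in M. norm (?R \<omega> * Z \<omega>) \<le> norm (Z \<omega>)" by simp
  qed simp
  have "(CLINT \<omega>|M. indicator (B k) (X k \<omega>) * (?R \<omega> * Z \<omega>)) = 0"
  proof (rule fourier_orthogonal[OF X R _ B])
    fix s
    have "(CLINT \<omega>|M. ?R \<omega> * (iexp (s * X k \<omega>) * Z \<omega>)) = 0"
    proof (rule Suc.IH)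
      show "integrable M (\<lambda>\<omega>. iexp (s * X k \<omega>) * Z \<omega>)"
        using Suc.prems by (intro integrable_iexp_mult) auto
      fix t
      have "(CLINT \<omega>|M. iexp (\<Sum>j<Suc k. (t(k := s)) j * X j \<omega>) * Z \<omega>) = 0"
        by (rule Suc.prems(2))
      moreover have "iexp (\<Sum>j<Suc k. (t(k := s)) j * X j \<omega>) = iexp (\<Sum>j<k. t j * X j \<omega>) * iexp (s * X k \<omega>)" for \<omega>
        by (simp add: distrib_left exp_add)
      ultimately show "(CLINT \<omega>|M. iexp (\<Sum>j<k. t j * X j \<omega>) * (iexp (s * X k \<omega>) * Z \<omega>)) = 0"
        by (simp add: mult.assoc)
    qed
    then show "(CLINT \<omega>|M. iexp (s * X k \<omega>) * (?R \<omega> * Z \<omega>)) = 0"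
      by (simp add: mult.left_commute)
  qed
  then show ?case by (simp add: mult_ac)
qed

text \<open>The factorization says that the exponentials of \<open>Y\<close>, once centred, are orthogonal to those of
  \<open>X 0, \<dots>, X (k - 1)\<close>, and orthogonality to exponentials passes to indicators. Rectangle events are
  what first passage times call for.\<close>

lemma (in prob_space) independent_of_rectangle:
  fixes X :: "nat \<Rightarrow> 'a \<Rightarrow> real" and Y :: "'a \<Rightarrow> real"
  assumes X [measurable]: "\<And>j. X j \<in> borel_measurable M" and Y [measurable]: "Y \<in> borel_measurable M"
    and factor: "\<And>s t. (CLINT \<omega>|M. iexp (s * Y \<omega>) * iexp (\<Sum>j<k. t j * X j \<omega>)) =
      (CLINT \<omega>|M. iexp (s * Y \<omega>)) * (CLINT \<omega>|M. iexp (\<Sum>j<k. t j * X j \<omega>))"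
    and B [measurable]: "\<And>j. B j \<in> sets borel" and C [measurable]: "C \<in> sets borel"
  shows "prob {\<omega> \<in> space M. Y \<omega> \<in> C \<and> (\<forall>j<k. X j \<omega> \<in> B j)} =
    prob {\<omega> \<in> space M. Y \<omega> \<in> C} * prob {\<omega> \<in> space M. \<forall>j<k. X j \<omega> \<in> B j}"
proof -
  define R where "R \<omega> = (\<Prod>j<k. indicator (B j) (X j \<omega>) :: complex)" for \<omega>
  define A where "A = {\<omega> \<in> space M. \<forall>j<k. X j \<omega> \<in> B j}"
  define G where "G = {\<omega> \<in> space M. Y \<omega> \<in> C}"
  have [measurable]: "A \<in> sets M" "G \<in> sets M" by (auto simp: A_def G_def)
  have RA: "R \<omega> = indicator A \<omega>" if "\<omega> \<in> space M" for \<omega>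
    using that by (auto simp: R_def A_def indicator_def prod_zero_iff)
  have iY: "integrable M (\<lambda>\<omega>. iexp (s * Y \<omega>))" for s
    using integrable_iexp_mult[of "\<lambda>\<omega>. s * Y \<omega>" "\<lambda>_. 1"] by simp
  have iA: "integrable M (\<lambda>\<omega>. indicator A \<omega> :: complex)"
    by (rule complex_indicator_integral) simp
  \<comment> \<open>First the exponentials in the \<open>X j\<close> give way to the indicator of \<open>A\<close>, then the one in \<open>Y\<close>.\<close>
  have 1: "(CLINT \<omega>|M. R \<omega> * (iexp (s * Y \<omega>) - (CLINT \<omega>|M. iexp (s * Y \<omega>)))) = 0" for s
    unfolding R_def
  proof (rule fourier_orthogonal_rectangle[OF X _ _ B])
    fix t
    let ?m = "CLINT \<omega>|M. iexp (s * Y \<omega>)"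
    have "integrable M (\<lambda>\<omega>. iexp (\<Sum>j<k. t j * X j \<omega>) * iexp (s * Y \<omega>))"
      using iY by (intro integrable_iexp_mult) auto
    moreover have "integrable M (\<lambda>\<omega>. iexp (\<Sum>j<k. t j * X j \<omega>))"
      using integrable_iexp_mult[of "\<lambda>\<omega>. \<Sum>j<k. t j * X j \<omega>" "\<lambda>_. 1"] by simp
    ultimately show "(CLINT \<omega>|M. iexp (\<Sum>j<k. t j * X j \<omega>) * (iexp (s * Y \<omega>) - ?m)) = 0"
      using factor[of s t] by (simp add: right_diff_distrib mult.commute)
  qed (use iY in simp)
  have 2: "(CLINT \<omega>|M. iexp (s * Y \<omega>) * (indicator A \<omega> - complex_of_real (prob A))) = 0" for s
  proof -
    let ?m = "CLINT \<omega>|M. iexp (s * Y \<omega>)"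
    have iYA: "integrable M (\<lambda>\<omega>. iexp (s * Y \<omega>) * indicator A \<omega>)"
      using iA by (intro integrable_iexp_mult) auto
    have "(CLINT \<omega>|M. iexp (s * Y \<omega>) * indicator A \<omega> - ?m * indicator A \<omega>) = 0"
      using 1[of s] by (subst (asm) Bochner_Integration.integral_cong[OF refl])
        (auto simp: RA algebra_simps)
    moreover have "(CLINT \<omega>|M. indicator A \<omega>) = complex_of_real (prob A)"
      by (rule complex_indicator_integral) simp
    ultimately have "(CLINT \<omega>|M. iexp (s * Y \<omega>) * indicator A \<omega>) = ?m * complex_of_real (prob A)"
      using iYA iA by simp
    then show ?thesis using iYA iY by (simp add: right_diff_distrib)
  qed
  have 3: "(CLINT \<omega>|M. indicator C (Y \<omega>) * (indicator A \<omega> - complex_of_real (prob A))) = 0"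
    using iA by (intro fourier_orthogonal[OF Y _ 2 C]) simp
  have "(CLINT \<omega>|M. indicator C (Y \<omega>) * (indicator A \<omega> - complex_of_real (prob A))) =
      (CLINT \<omega>|M. indicator (G \<inter> A) \<omega> - indicator G \<omega> * complex_of_real (prob A))"
    by (intro Bochner_Integration.integral_cong) (auto simp: G_def indicator_def)
  also have "\<dots> = complex_of_real (prob (G \<inter> A)) - complex_of_real (prob G) * complex_of_real (prob A)"
    by (simp add: complex_indicator_integral)
  finally have "prob (G \<inter> A) = prob G * prob A"
    using 3 by (simp flip: of_real_mult)
  moreover have "G \<inter> A = {\<omega> \<in> space M. Y \<omega> \<in> C \<and> (\<forall>j<k. X j \<omega> \<in> B j)}"
    by (auto simp: G_def A_def)
  ultimately show ?thesis by (simp add: G_def A_def)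
qed

text \<open>Ottaviani's inequality. If some \<open>\<bar>X k\<bar>\<close> exceeds \<open>2 * a\<close> while the increment after the first
  such \<open>k\<close> stays below \<open>a\<close>, then \<open>\<bar>X n\<bar>\<close> exceeds \<open>a\<close>.\<close>

lemma (in prob_space) ottaviani:
  fixes X :: "nat \<Rightarrow> 'a \<Rightarrow> real"
  assumes X [measurable]: "\<And>j. X j \<in> borel_measurable M"
    and factor: "\<And>k s t. k \<le> n \<Longrightarrow>
      (CLINT \<omega>|M. iexp (s * (X n \<omega> - X k \<omega>)) * iexp (\<Sum>j<Suc k. t j * X j \<omega>)) =
      (CLINT \<omega>|M. iexp (s * (X n \<omega> - X k \<omega>))) * (CLINT \<omega>|M. iexp (\<Sum>j<Suc k. t j * X j \<omega>))"
    and small: "\<And>k. k \<le> n \<Longrightarrow> prob {\<omega> \<in> space M. a < \<bar>X n \<omega> - X k \<omega>\<bar>} \<le> \<epsilon>"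
  shows "(1 - \<epsilon>) * prob {\<omega> \<in> space M. \<exists>k\<le>n. 2 * a < \<bar>X k \<omega>\<bar>} \<le> prob {\<omega> \<in> space M. a < \<bar>X n \<omega>\<bar>}"
proof -
  define A where "A k = {\<omega> \<in> space M. 2 * a < \<bar>X k \<omega>\<bar> \<and> (\<forall>j<k. \<bar>X j \<omega>\<bar> \<le> 2 * a)}" for k :: nat
  define G where "G k = {\<omega> \<in> space M. \<bar>X n \<omega> - X k \<omega>\<bar> \<le> a}" for k
  have [measurable]: "A k \<in> sets M" "G k \<in> sets M" for k by (auto simp: A_def G_def)
  have disj: "disjoint_family_on A {..n}"
  proof (unfold disjoint_family_on_def, intro ballI impI)
    fix k l :: nat assume "k \<noteq> l"
    then consider "k < l" | "l < k" by linarith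
    then show "A k \<inter> A l = {}" by cases (fastforce simp: A_def)+
  qed
  have U: "(\<Union>k\<le>n. A k) = {\<omega> \<in> space M. \<exists>k\<le>n. 2 * a < \<bar>X k \<omega>\<bar>}"
  proof (intro set_eqI iffI)
    fix \<omega> assume "\<omega> \<in> {\<omega> \<in> space M. \<exists>k\<le>n. 2 * a < \<bar>X k \<omega>\<bar>}"
    then obtain k where k: "\<omega> \<in> space M" "k \<le> n" "2 * a < \<bar>X k \<omega>\<bar>" by auto
    define l where "l = (LEAST k. 2 * a < \<bar>X k \<omega>\<bar>)"
    have "2 * a < \<bar>X l \<omega>\<bar>" "l \<le> k" using k unfolding l_def by (auto intro: LeastI Least_le)
    moreover have "\<bar>X j \<omega>\<bar> \<le> 2 * a" if "j < l" for j
      using not_less_Least[of j "\<lambda>k. 2 * a < \<bar>X k \<omega>\<bar>"] that unfolding l_def by auto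
    ultimately have "\<omega> \<in> A l" "l \<le> n" using k by (auto simp: A_def)
    then show "\<omega> \<in> (\<Union>k\<le>n. A k)" by auto
  qed (auto simp: A_def)
  have indep: "prob (G k \<inter> A k) = prob (G k) * prob (A k)" if "k \<le> n" for k
  proof -
    let ?B = "\<lambda>j. if j < k then {- (2 * a)..2 * a} else - {- (2 * a)..2 * a}"
    have A': "A k = {\<omega> \<in> space M. \<forall>j<Suc k. X j \<omega> \<in> ?B j}"
      by (auto simp: A_def less_Suc_eq abs_le_iff)
    have G': "G k = {\<omega> \<in> space M. X n \<omega> - X k \<omega> \<in> {- a..a}}" by (auto simp: G_def)
    have "prob {\<omega> \<in> space M. X n \<omega> - X k \<omega> \<in> {- a..a} \<and> (\<forall>j<Suc k. X j \<omega> \<in> ?B j)} =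
      prob {\<omega> \<in> space M. X n \<omega> - X k \<omega> \<in> {- a..a}} * prob {\<omega> \<in> space M. \<forall>j<Suc k. X j \<omega> \<in> ?B j}"
      by (rule independent_of_rectangle[OF _ _ factor[OF that]]) (auto intro: borel_comp)
    moreover have "G k \<inter> A k = {\<omega> \<in> space M. X n \<omega> - X k \<omega> \<in> {- a..a} \<and> (\<forall>j<Suc k. X j \<omega> \<in> ?B j)}"
      unfolding A' G' by blast
    ultimately show ?thesis unfolding A' G' by simp
  qed
  have G_large: "1 - \<epsilon> \<le> prob (G k)" if "k \<le> n" for k
  proof -
    have "G k = space M - {\<omega> \<in> space M. a < \<bar>X n \<omega> - X k \<omega>\<bar>}" by (auto simp: G_def)
    then have "prob (G k) = 1 - prob {\<omega> \<in> space M. a < \<bar>X n \<omega> - X k \<omega>\<bar>}"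
      using prob_compl[of "{\<omega> \<in> space M. a < \<bar>X n \<omega> - X k \<omega>\<bar>}"] by simp
    then show ?thesis using small[OF that] by simp
  qed
  have "(1 - \<epsilon>) * prob (\<Union>k\<le>n. A k) = (\<Sum>k\<le>n. (1 - \<epsilon>) * prob (A k))"
    using disj by (subst finite_measure_finite_Union) (auto simp: sum_distrib_left)
  also have "\<dots> \<le> (\<Sum>k\<le>n. prob (G k \<inter> A k))"
    using G_large by (intro sum_mono) (auto simp: indep intro: mult_right_mono)
  also have "\<dots> = prob (\<Union>k\<le>n. G k \<inter> A k)"
    using disj by (subst finite_measure_finite_Union) (auto simp: disjoint_family_on_def)
  also have "\<dots> \<le> prob {\<omega> \<in> space M. a < \<bar>X n \<omega>\<bar>}"
    by (intro finite_measure_mono) (auto simp: G_def A_def)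
  finally show ?thesis by (simp add: U)
qed

text \<open>Ottaviani's inequality for the sequence restarted at \<open>N\<close> bounds the probability that it ever
  moves away from \<open>X N\<close> by more than \<open>2 * a\<close>, by twice the bound for a move by more than \<open>a\<close> between
  two fixed times. For this reason the factorization is required after every restart. The result is
  Levy's equivalence of convergence in probability and almost surely for sums of independent variables.\<close>

lemma (in prob_space) independent_increments_AE_convergent:
  fixes X :: "nat \<Rightarrow> 'a \<Rightarrow> real"
  assumes X [measurable]: "\<And>j. X j \<in> borel_measurable M"
    and factor: "\<And>N n k s t. k \<le> n \<Longrightarrow>
      (CLINT \<omega>|M. iexp (s * (X (N + n) \<omega> - X (N + k) \<omega>)) * iexp (\<Sum>j<Suc k. t j * (X (N + j) \<omega> - X N \<omega>))) =
      (CLINT \<omega>|M. iexp (s * (X (N + n) \<omega> - X (N + k) \<omega>))) *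
      (CLINT \<omega>|M. iexp (\<Sum>j<Suc k. t j * (X (N + j) \<omega> - X N \<omega>)))"
    and Cauchy: "\<And>a \<epsilon>. 0 < a \<Longrightarrow> 0 < \<epsilon> \<Longrightarrow>
      \<exists>N. \<forall>m\<ge>N. \<forall>n\<ge>m. prob {\<omega> \<in> space M. a < \<bar>X n \<omega> - X m \<omega>\<bar>} \<le> \<epsilon>"
  shows "AE \<omega> in M. convergent (\<lambda>n. X n \<omega>)"
proof -
  define bad where "bad a N = {\<omega> \<in> space M. \<exists>k. 2 * a < \<bar>X (N + k) \<omega> - X N \<omega>\<bar>}" for a N
  have [measurable]: "bad a N \<in> sets M" for a N by (auto simp: bad_def)
  have bad_small: "\<exists>N. prob (bad a N) \<le> 2 * \<epsilon>" if a: "0 < a" and \<epsilon>: "0 < \<epsilon>" "\<epsilon> \<le> 1 / 2" for a \<epsilon>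
  proof -
    obtain N where N: "\<And>m n. N \<le> m \<Longrightarrow> m \<le> n \<Longrightarrow> prob {\<omega> \<in> space M. a < \<bar>X n \<omega> - X m \<omega>\<bar>} \<le> \<epsilon>"
      using Cauchy[OF a \<epsilon>(1)] by blast
    define C where "C n = {\<omega> \<in> space M. \<exists>k\<le>n. 2 * a < \<bar>X (N + k) \<omega> - X N \<omega>\<bar>}" for n
    have "prob (C n) \<le> 2 * \<epsilon>" for n
    proof -
      have "(1 - \<epsilon>) * prob (C n) \<le> prob {\<omega> \<in> space M. a < \<bar>X (N + n) \<omega> - X N \<omega>\<bar>}"
        unfolding C_def
        using N factor by (intro ottaviani[where X = "\<lambda>k \<omega>. X (N + k) \<omega> - X N \<omega>"]) auto
      also have "\<dots> \<le> \<epsilon>" by (rule N) auto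
      finally have "(1 - \<epsilon>) * prob (C n) \<le> \<epsilon>" .
      moreover have "1 / 2 * prob (C n) \<le> (1 - \<epsilon>) * prob (C n)"
        using \<epsilon> by (intro mult_right_mono) auto
      ultimately show ?thesis by simp
    qed
    moreover have "(\<lambda>n. prob (C n)) \<longlonglongrightarrow> prob (\<Union>n. C n)"
      by (intro finite_Lim_measure_incseq) (auto simp: C_def incseq_def intro: order_trans)
    ultimately have "prob (\<Union>n. C n) \<le> 2 * \<epsilon>" by (intro LIMSEQ_le_const2) auto
    moreover have "(\<Union>n. C n) = bad a N" by (auto simp: C_def bad_def)
    ultimately show ?thesis by auto
  qed
  have AE_bad: "AE \<omega> in M. \<exists>N. \<omega> \<notin> bad a N" if a: "0 < a" for a
  proof -
    have "prob (\<Inter>N. bad a N) \<le> 0"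
    proof (rule field_le_epsilon)
      fix e :: real assume "0 < e"
      then have "0 < min (e / 2) (1 / 2)" "min (e / 2) (1 / 2) \<le> 1 / 2" by auto
      from bad_small[OF a this] obtain N where N: "prob (bad a N) \<le> 2 * min (e / 2) (1 / 2)"
        by blast
      have "prob (\<Inter>N. bad a N) \<le> prob (bad a N)" by (intro finite_measure_mono) auto
      then show "prob (\<Inter>N. bad a N) \<le> 0 + e" using N by simp
    qed
    then have "prob (\<Inter>N. bad a N) = 0" using measure_le_0_iff by blast
    then have "(\<Inter>N. bad a N) \<in> null_sets M" by (simp add: null_sets_def emeasure_eq_measure)
    from AE_not_in[OF this] show ?thesis by simp
  qed
  have "AE \<omega> in M. \<forall>i. \<exists>N. \<omega> \<notin> bad (1 / real (Suc i)) N"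
    using AE_bad by (subst AE_all_countable) auto
  with AE_space show ?thesis
  proof eventually_elim
    fix \<omega> assume \<omega>: "\<omega> \<in> space M" and good: "\<forall>i. \<exists>N. \<omega> \<notin> bad (1 / real (Suc i)) N"
    have "Cauchy (\<lambda>n. X n \<omega>)"
    proof (rule metric_CauchyI)
      fix e :: real assume e: "0 < e"
      obtain i where i: "1 / real (Suc i) < e / 4" using nat_approx_posE[of "e / 4"] e by auto
      obtain N where "\<omega> \<notin> bad (1 / real (Suc i)) N" using good by blast
      then have N: "\<bar>X (N + k) \<omega> - X N \<omega>\<bar> \<le> 2 * (1 / real (Suc i))" for k
        using \<omega> unfolding bad_def by (simp add: not_less)
      have N': "\<bar>X m \<omega> - X N \<omega>\<bar> < e / 2" if "N \<le> m" for m
        using N[of "m - N"] that i by simp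
      show "\<exists>M. \<forall>m\<ge>M. \<forall>n\<ge>M. dist (X m \<omega>) (X n \<omega>) < e"
      proof (intro exI allI impI)
        fix m n assume "N \<le> m" "N \<le> n"
        then show "dist (X m \<omega>) (X n \<omega>) < e"
          using N'[of m] N'[of n] unfolding dist_real_def abs_less_iff by linarith
      qed
    qed
    then show "convergent (\<lambda>n. X n \<omega>)" by (simp add: Cauchy_convergent_iff)
  qed
qed

text \<open>By Levy's uniqueness theorem, after rescaling to unit variance. For \<open>\<sigma> = 0\<close> the variable vanishes
  almost surely.\<close>

lemma (in prob_space) gaussian_of_characteristic_function:
  fixes X :: "'a \<Rightarrow> real"
  assumes X [measurable]: "X \<in> borel_measurable M" and \<sigma>: "0 \<le> \<sigma>"
    and ch: "\<And>t. (CLINT \<omega>|M. iexp (t * X \<omega>)) = complex_of_real (exp (- (t * \<sigma>)\<^sup>2 / 2))"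
  shows "distr M borel X =
      (if \<sigma> = 0 then return borel 0 else density lborel (\<lambda>x. ennreal (normal_density 0 \<sigma> x)))"
    and "integrable M (\<lambda>\<omega>. (X \<omega>)\<^sup>2)" and "expectation (\<lambda>\<omega>. (X \<omega>)\<^sup>2) = \<sigma>\<^sup>2"
proof -
  have charX: "char (distr M borel X) t = complex_of_real (exp (- (t * \<sigma>)\<^sup>2 / 2))" for t
    using ch[of t] by (simp add: char_def integral_distr)
  have "distr M borel X =
      (if \<sigma> = 0 then return borel 0 else density lborel (\<lambda>x. ennreal (normal_density 0 \<sigma> x))) \<and>
    integrable M (\<lambda>\<omega>. (X \<omega>)\<^sup>2) \<and> expectation (\<lambda>\<omega>. (X \<omega>)\<^sup>2) = \<sigma>\<^sup>2"
  proof (cases "\<sigma> = 0")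
    case True
    have r: "real_distribution (return borel (0::real))"
      unfolding real_distribution_def real_distribution_axioms_def
      by (auto intro!: prob_space_return)
    have "char (distr M borel X) = char (return borel 0)"
      unfolding fun_eq_iff charX using True by (simp add: char_def integral_return)
    then have d: "distr M borel X = return borel 0"
      using r by (intro Levy_uniqueness) auto
    have "AE x in distr M borel X. x = 0"
      unfolding d by (subst AE_return) auto
    then have "AE \<omega> in M. X \<omega> = 0" by (subst (asm) AE_distr_iff) auto
    then have z: "AE \<omega> in M. (X \<omega>)\<^sup>2 = 0" by eventually_elim simp
    have "integrable M (\<lambda>\<omega>. (X \<omega>)\<^sup>2) \<longleftrightarrow> integrable M (\<lambda>_. 0 :: real)"
      using z by (intro integrable_cong_AE) auto
    moreover have "expectation (\<lambda>\<omega>. (X \<omega>)\<^sup>2) = 0" using z by (rule integral_eq_zero_AE)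
    ultimately show ?thesis using True d by simp
  next
    case False
    then have s: "0 < \<sigma>" using \<sigma> by simp
    define Y where "Y \<omega> = X \<omega> / \<sigma>" for \<omega>
    have [measurable]: "Y \<in> borel_measurable M" unfolding Y_def by measurable
    have "char (distr M borel Y) t = char std_normal_distribution t" for t
    proof -
      have "char (distr M borel Y) t = (CLINT \<omega>|M. iexp (t / \<sigma> * X \<omega>))"
        by (simp add: char_def integral_distr Y_def)
      also have "\<dots> = complex_of_real (exp (- (t\<^sup>2) / 2))" using ch[of "t / \<sigma>"] s by simp
      finally show ?thesis by (simp add: char_std_normal_distribution)
    qed
    then have dY: "distr M borel Y = std_normal_distribution"
      using real_dist_normal_dist by (intro Levy_uniqueness) auto
    then have "distributed M lborel Y std_normal_density"
      unfolding distributed_def by (auto simp: cong: distr_cong)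
    then have "distributed M lborel (\<lambda>\<omega>. (X \<omega> - 0) / \<sigma>) std_normal_density"
      by (simp add: Y_def[abs_def])
    then have dX: "distributed M lborel X (normal_density 0 \<sigma>)"
      using normal_standard_normal_convert[OF s, of X 0] by blast
    have "integrable M (\<lambda>\<omega>. (X \<omega>)\<^sup>2)"
      using distributed_integrable[OF dX, of "\<lambda>x. x\<^sup>2"] integrable_normal_moment[OF s, of 0 2] by simp
    moreover have "expectation (\<lambda>\<omega>. (X \<omega>)\<^sup>2) = \<sigma>\<^sup>2"
      using normal_distributed_variance[OF s dX] normal_distributed_expectation[OF s dX] by simp
    moreover have "distr M borel X = density lborel (\<lambda>x. ennreal (normal_density 0 \<sigma> x))"
      using dX unfolding distributed_def by (auto simp: cong: distr_cong)
    ultimately show ?thesis using False by simp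
  qed
  then show "distr M borel X =
      (if \<sigma> = 0 then return borel 0 else density lborel (\<lambda>x. ennreal (normal_density 0 \<sigma> x)))"
    "integrable M (\<lambda>\<omega>. (X \<omega>)\<^sup>2)" "expectation (\<lambda>\<omega>. (X \<omega>)\<^sup>2) = \<sigma>\<^sup>2" by blast+
qed

section \<open>Spectral calculus of a self-adjoint operator commuting with conjugation\<close>

lemma (in network) enorm_limit_unique:
  assumes "\<And>n. s n \<in> H" "u \<in> H" "v \<in> H"
    "(\<lambda>n. enorm c (s n - u)) \<longlonglongrightarrow> 0" "(\<lambda>n. enorm c (s n - v)) \<longlonglongrightarrow> 0"
  shows "u = v"
proof -
  have "energy c w u = energy c w v" if "w \<in> H" for w
    using energy_tendsto_right[OF that assms(1,2,4)] energy_tendsto_right[OF that assms(1,3,5)]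
    by (rule LIMSEQ_unique)
  then show ?thesis using energy_separates assms by blast
qed

locale spectral_operator = network c
  for c :: "'v \<Rightarrow> 'v \<Rightarrow> real" +
  fixes D :: "'v potential set" and A :: "'v potential \<Rightarrow> 'v potential"
    and E :: "real set \<Rightarrow> 'v potential \<Rightarrow> 'v potential"
  assumes self_adjoint: "self_adjoint c D A"
    and spectral: "spectral_measure_of c D A E"
    and real_operator: "commutes_with_cnj D A"
begin

abbreviation "\<mu> \<equiv> spectral_distribution c E"

lemma D_H: "u \<in> D \<Longrightarrow> u \<in> H"
  and A_H [simp]: "u \<in> D \<Longrightarrow> A u \<in> H"
  and D_add: "u \<in> D \<Longrightarrow> v \<in> D \<Longrightarrow> u + v \<in> D"
  and D_cscale: "u \<in> D \<Longrightarrow> cscale a u \<in> D"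
  and A_add: "u \<in> D \<Longrightarrow> v \<in> D \<Longrightarrow> A (u + v) = A u + A v"
  and A_cscale: "u \<in> D \<Longrightarrow> A (cscale a u) = cscale a (A u)"
  and D_dense: "eclosure c D = H"
  and D_0: "0 \<in> D"
  using self_adjoint unfolding self_adjoint_def pot.subspace_def by blast+

lemma D_uminus: "u \<in> D \<Longrightarrow> - u \<in> D"
  using D_cscale[of u "-1"] by simp

lemma A_diff: "u \<in> D \<Longrightarrow> v \<in> D \<Longrightarrow> A (u - v) = A u - A v"
  using A_add[of u "-v"] A_cscale[of v "-1"] D_uminus by simp

lemma A_symmetric:
  assumes "u \<in> D" "v \<in> D"
  shows "energy c u (A v) = energy c (A u) v"
proof -
  have "(u, A u) \<in> adjoint_graph c D A"
    using assms self_adjoint unfolding self_adjoint_def op_graph_def by auto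
  then show ?thesis using assms unfolding adjoint_graph_def by auto
qed

lemma D_cnj: "u \<in> D \<Longrightarrow> pot_cnj u \<in> D" and A_cnj: "u \<in> D \<Longrightarrow> A (pot_cnj u) = pot_cnj (A u)"
  using real_operator unfolding commutes_with_cnj_def by auto

lemma orthogonal_to_D:
  assumes "u \<in> H" "\<And>z. z \<in> D \<Longrightarrow> energy c z u = 0"
  shows "u = 0"
proof -
  have "u \<in> eclosure c D" using assms D_dense by simp
  then obtain s where s: "\<And>n. s n \<in> D" "(\<lambda>n. enorm c (s n - u)) \<longlonglongrightarrow> 0"
    unfolding eclosure_def by blast
  have "(\<lambda>n. energy c u (s n)) \<longlonglongrightarrow> energy c u u"
    using s D_H assms by (intro energy_tendsto_right) auto
  moreover have "energy c u (s n) = 0" for n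
    by (subst energy_commute) (simp add: assms(2)[OF s(1)])
  ultimately have "energy c u u = 0" by (simp add: LIMSEQ_const_iff)
  then show ?thesis using enorm_eq_0[of u] assms(1) by (simp add: enorm_def)
qed

lemma E_projection: "B \<in> sets borel \<Longrightarrow> orthogonal_projection c (E B)"
  and E_UNIV: "u \<in> H \<Longrightarrow> E UNIV u = u"
  and E_inter: "B \<in> sets borel \<Longrightarrow> C \<in> sets borel \<Longrightarrow> u \<in> H \<Longrightarrow> E B (E C u) = E (B \<inter> C) u"
  and E_sigma_additive: "range F \<subseteq> sets borel \<Longrightarrow> disjoint_family F \<Longrightarrow> u \<in> H \<Longrightarrow>
     (\<lambda>n. enorm c ((\<Sum>i<n. E (F i) u) - E (\<Union>i. F i) u)) \<longlonglongrightarrow> 0"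
  and D_eq: "D = {u \<in> H. integrable (\<mu> u) (\<lambda>t. t\<^sup>2)}"
  and A_form: "u \<in> D \<Longrightarrow> energy c u (A u) = complex_of_real (\<integral>t. t \<partial>\<mu> u)"
  using spectral unfolding spectral_measure_of_def by (elim conjE, simp)+

lemma E_H [simp]: "B \<in> sets borel \<Longrightarrow> u \<in> H \<Longrightarrow> E B u \<in> H"
  and E_idem [simp]: "B \<in> sets borel \<Longrightarrow> u \<in> H \<Longrightarrow> E B (E B u) = E B u"
  and E_sym: "B \<in> sets borel \<Longrightarrow> u \<in> H \<Longrightarrow> v \<in> H \<Longrightarrow> energy c (E B u) v = energy c u (E B v)"
  using E_projection unfolding orthogonal_projection_def by blast+

lemma D_iff: "u \<in> D \<longleftrightarrow> u \<in> H \<and> integrable (\<mu> u) (\<lambda>t. t\<^sup>2)"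
  by (subst D_eq) simp

lemma E_add:
  assumes "B \<in> sets borel" "u \<in> H" "v \<in> H"
  shows "E B (u + v) = E B u + E B v"
  using assms
  by (intro energy_separates) (auto simp: energy_add_right E_sym[symmetric])

lemma E_cscale:
  assumes "B \<in> sets borel" "u \<in> H"
  shows "E B (cscale a u) = cscale a (E B u)"
  using assms
  by (intro energy_separates) (auto simp: E_sym[symmetric])

lemma E_zero [simp]: "B \<in> sets borel \<Longrightarrow> E B 0 = 0"
  using E_cscale[of B 0 0] by simp

lemma E_uminus: "B \<in> sets borel \<Longrightarrow> u \<in> H \<Longrightarrow> E B (- u) = - E B u"
  using E_cscale[of B u "-1"] by simp

lemma E_diff: "B \<in> sets borel \<Longrightarrow> u \<in> H \<Longrightarrow> v \<in> H \<Longrightarrow> E B (u - v) = E B u - E B v"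
  using E_add[of B u "-v"] E_uminus[of B v] by simp

lemma enorm_E: "B \<in> sets borel \<Longrightarrow> u \<in> H \<Longrightarrow> energy c u (E B u) = complex_of_real ((enorm c (E B u))\<^sup>2)"
  by (metis E_H E_idem E_sym energy_self)

text \<open>Additivity for the constantly empty family says that \<open>n\<close> times the vector converges.\<close>

lemma E_empty [simp]:
  assumes "u \<in> H"
  shows "E {} u = 0"
proof -
  have "(\<lambda>n. enorm c ((\<Sum>i<n. E {} u) - E {} u)) \<longlonglongrightarrow> 0"
    using E_sigma_additive[of "\<lambda>_. {}" u] assms by (simp add: disjoint_family_on_def)
  then have "(\<lambda>n. enorm c ((\<Sum>i<n + 2. E {} u) - E {} u)) \<longlonglongrightarrow> 0"
    by (rule LIMSEQ_ignore_initial_segment)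
  moreover have "(\<Sum>i<n + 2. E {} u) - E {} u = cscale (of_nat (n + 1)) (E {} u)" for n
  proof (rule potential_eqI')
    have "pdiff (\<Sum>i<m. E {} u) x y = of_nat m * pdiff (E {} u) x y" for m :: nat and x y
      by (induction m) (auto simp: algebra_simps)
    then show "pdiff ((\<Sum>i<n + 2. E {} u) - E {} u) x y = pdiff (cscale (of_nat (n + 1)) (E {} u)) x y" for x y
      by (simp add: algebra_simps)
  qed
  ultimately have *: "(\<lambda>n. real (n + 1) * enorm c (E {} u)) \<longlonglongrightarrow> 0"
    by (simp add: norm_of_nat[where 'a = complex, of "Suc n" for n, simplified])
  have "enorm c (E {} u) \<le> 0"
    by (rule LIMSEQ_le_const[OF *]) (auto simp: algebra_simps)
  then show ?thesis using enorm_eq_0[of "E {} u"] assms by (simp add: order_antisym_conv)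
qed

lemma E_union:
  assumes B: "B \<in> sets borel" "C \<in> sets borel" "B \<inter> C = {}" and u: "u \<in> H"
  shows "E (B \<union> C) u = E B u + E C u"
proof -
  let ?F = "binaryset B C"
  have r: "range ?F \<subseteq> sets borel" "disjoint_family ?F" "(\<Union>i. ?F i) = B \<union> C"
    using B by (auto simp: binaryset_def disjoint_family_on_def UN_binaryset_eq)
  have "(\<lambda>n. enorm c ((\<Sum>i<n. E (?F i) u) - E (B \<union> C) u)) \<longlonglongrightarrow> 0"
    using E_sigma_additive[OF r(1,2) u] r(3) by simp
  then have "(\<lambda>n. enorm c ((\<Sum>i<n + 2. E (?F i) u) - E (B \<union> C) u)) \<longlonglongrightarrow> 0"
    by (rule LIMSEQ_ignore_initial_segment)
  moreover have "(\<Sum>i<n + 2. E (?F i) u) = E B u + E C u" for n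
    using u by (induction n) (auto simp: binaryset_def numeral_2_eq_2 lessThan_Suc algebra_simps)
  ultimately have "enorm c (E B u + E C u - E (B \<union> C) u) = 0"
    by (simp add: LIMSEQ_const_iff)
  then have "E B u + E C u - E (B \<union> C) u = 0"
    using B u by (intro enorm_eq_0) auto
  then show ?thesis by simp
qed

lemma E_Compl: "B \<in> sets borel \<Longrightarrow> u \<in> H \<Longrightarrow> E B u + E (- B) u = u"
  using E_union[of B "- B" u] by (simp add: E_UNIV borel_comp)

lemma sets_\<mu> [simp, measurable_cong]: "sets (\<mu> u) = sets borel"
  unfolding spectral_distribution_def
  by (simp add: sigma_algebra.sigma_sets_eq[OF sets.sigma_algebra_axioms[of borel, simplified]])

lemma space_\<mu> [simp]: "space (\<mu> u) = UNIV"
  unfolding spectral_distribution_def by (simp add: space_measure_of_conv)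

lemma emeasure_\<mu>:
  assumes u: "u \<in> H" and B: "B \<in> sets borel"
  shows "emeasure (\<mu> u) B = ennreal ((enorm c (E B u))\<^sup>2)"
proof -
  have "emeasure (\<mu> u) B = ennreal (Re (energy c u (E B u)))"
    unfolding spectral_distribution_def
  proof (rule emeasure_measure_of_sigma[OF _ _ _ B])
    show "sigma_algebra UNIV (sets (borel :: real measure))"
      using sets.sigma_algebra_axioms[of borel] by simp
    show "positive (sets borel) (\<lambda>B. ennreal (Re (energy c u (E B u))))"
      using u by (simp add: positive_def)
    show "countably_additive (sets borel) (\<lambda>B. ennreal (Re (energy c u (E B u))))"
      unfolding countably_additive_def
    proof (intro allI impI)
      fix F :: "nat \<Rightarrow> real set"
      assume F: "range F \<subseteq> sets borel" "disjoint_family F" "(\<Union>i. F i) \<in> sets borel"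
      then have Fb: "F i \<in> sets borel" for i by auto
      have "(\<lambda>n. energy c u (\<Sum>i<n. E (F i) u)) \<longlonglongrightarrow> energy c u (E (\<Union>i. F i) u)"
        using F Fb u by (intro energy_tendsto_right E_sigma_additive) auto
      then have "(\<lambda>n. Re (\<Sum>i<n. energy c u (E (F i) u))) \<longlonglongrightarrow> Re (energy c u (E (\<Union>i. F i) u))"
        using Fb u by (intro tendsto_Re) (simp add: energy_sum_right)
      then have "(\<lambda>i. Re (energy c u (E (F i) u))) sums Re (energy c u (E (\<Union>i. F i) u))"
        by (simp add: sums_def)
      moreover have "0 \<le> Re (energy c u (E (F i) u))" for i
        using Fb u by (simp add: enorm_E del: of_real_power)
      ultimately show "(\<Sum>i. ennreal (Re (energy c u (E (F i) u)))) = ennreal (Re (energy c u (E (\<Union>i. F i) u)))"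
        by (intro suminf_ennreal_eq)
    qed
  qed
  then show ?thesis using assms by (simp add: enorm_E del: of_real_power)
qed

lemma measure_\<mu>: "u \<in> H \<Longrightarrow> B \<in> sets borel \<Longrightarrow> measure (\<mu> u) B = (enorm c (E B u))\<^sup>2"
  by (simp add: measure_def emeasure_\<mu>)

lemma finite_measure_\<mu>: "u \<in> H \<Longrightarrow> finite_measure (\<mu> u)"
  by (rule finite_measureI) (simp add: emeasure_\<mu>)

lemma \<mu>_E:
  assumes "u \<in> H" "B \<in> sets borel"
  shows "\<mu> (E B u) = density (\<mu> u) (indicator B)"
proof (rule measure_eqI)
  fix C assume "C \<in> sets (\<mu> (E B u))"
  then have C: "C \<in> sets borel" by simp
  show "emeasure (\<mu> (E B u)) C = emeasure (density (\<mu> u) (indicator B)) C"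
    using assms C by (simp add: emeasure_restricted emeasure_\<mu> E_inter Int_commute)
qed simp

lemma integrable_\<mu>_E:
  assumes "u \<in> H" "B \<in> sets borel" "f \<in> borel_measurable borel"
  shows "integrable (\<mu> (E B u)) f \<longleftrightarrow> integrable (\<mu> u) (\<lambda>t. indicator B t * (f t :: real))"
    and "integral\<^sup>L (\<mu> (E B u)) f = (\<integral>t. indicator B t * f t \<partial>\<mu> u)"
proof -
  have f [measurable]: "f \<in> borel_measurable (\<mu> u)"
    using assms(3) by (simp cong: measurable_cong_sets)
  have i: "(indicator B :: real \<Rightarrow> real) \<in> borel_measurable (\<mu> u)"
    using assms(2) by (simp cong: measurable_cong_sets)
  have eq: "\<mu> (E B u) = density (\<mu> u) (\<lambda>t. ennreal (indicator B t))"
    using \<mu>_E[OF assms(1,2)] by (simp add: ennreal_indicator)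
  show "integrable (\<mu> (E B u)) f \<longleftrightarrow> integrable (\<mu> u) (\<lambda>t. indicator B t * f t)"
    unfolding eq using integrable_density[OF f i] by simp
  show "integral\<^sup>L (\<mu> (E B u)) f = (\<integral>t. indicator B t * f t \<partial>\<mu> u)"
    unfolding eq using integral_density[OF f i] by simp
qed

lemma E_D:
  assumes u: "u \<in> D" and B: "B \<in> sets borel"
  shows "E B u \<in> D"
proof -
  have "integrable (\<mu> u) (\<lambda>t. indicator B t *\<^sub>R t\<^sup>2)"
    using u B by (intro integrable_mult_indicator) (auto simp: D_iff)
  then show ?thesis using u B D_H[OF u]
    by (simp add: D_iff[of "E B u"] integrable_\<mu>_E)
qed

lemma E_bounded_D:
  assumes u: "u \<in> H" and B: "B \<in> sets borel" "bounded B"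
  shows "E B u \<in> D"
proof -
  interpret finite_measure "\<mu> u" using finite_measure_\<mu>[OF u] .
  obtain R where R: "\<And>t. t \<in> B \<Longrightarrow> \<bar>t\<bar> \<le> R" using B(2) by (auto simp: bounded_iff)
  have "norm (indicator B t * t\<^sup>2) \<le> R\<^sup>2" for t
    using R[of t] power_mono[of "\<bar>t\<bar>" R 2] by (cases "t \<in> B") auto
  moreover have "(\<lambda>t. indicator B t * t\<^sup>2) \<in> borel_measurable (\<mu> u)"
    using B by (simp cong: measurable_cong_sets)
  ultimately have "integrable (\<mu> u) (\<lambda>t. indicator B t * t\<^sup>2)"
    by (intro integrable_const_bound[where B = "R\<^sup>2"]) auto
  then show ?thesis using u B by (simp add: D_iff[of "E B u"] integrable_\<mu>_E)
qed

lemma integrable_id_\<mu>: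
  assumes u: "u \<in> D"
  shows "integrable (\<mu> u) (\<lambda>t. t)"
proof -
  interpret finite_measure "\<mu> u" using finite_measure_\<mu> D_H[OF u] .
  have "integrable (\<mu> u) (\<lambda>t. 1 + t\<^sup>2)" using u by (auto simp: D_iff)
  then show ?thesis
  proof (rule Bochner_Integration.integrable_bound)
    have "\<bar>t\<bar> \<le> \<bar>1 + t\<^sup>2\<bar>" for t :: real
      using sum_squares_bound[of 1 "\<bar>t\<bar>"] by simp
    then show "AE t in \<mu> u. norm t \<le> norm (1 + t\<^sup>2)" by simp
  qed (simp cong: measurable_cong_sets)
qed

text \<open>The form is the integral of \<open>t\<close> against the spectral distribution, and the projections restrict
  this measure to \<open>B\<close> and to its complement.\<close>

lemma form_split:
  assumes u: "u \<in> D" and B: "B \<in> sets borel"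
  shows "energy c u (A u) = energy c (E B u) (A (E B u)) + energy c (E (- B) u) (A (E (- B) u))"
proof -
  have uH: "u \<in> H" and B': "- B \<in> sets borel" using D_H[OF u] B by (auto intro: borel_comp)
  note int = integrable_id_\<mu>[OF u]
  have "(\<integral>t. t \<partial>\<mu> u) = (\<integral>t. indicator B t * t + indicator (- B) t * t \<partial>\<mu> u)"
    by (intro Bochner_Integration.integral_cong) (auto simp: indicator_def)
  also have "\<dots> = (\<integral>t. indicator B t * t \<partial>\<mu> u) + (\<integral>t. indicator (- B) t * t \<partial>\<mu> u)"
    using integrable_mult_indicator[of B "\<mu> u" "\<lambda>t. t"] integrable_mult_indicator[of "- B" "\<mu> u" "\<lambda>t. t"] B B' int
    by (intro Bochner_Integration.integral_add) auto
  finally show ?thesis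
    using u uH B B' E_D[OF u] by (simp add: A_form integrable_\<mu>_E)
qed

text \<open>Since the form has no cross terms, polarization makes the off-diagonal part of \<open>A\<close> vanish.\<close>

lemma E_A_orthogonal:
  assumes u: "u \<in> D" "E B u = u" and w: "w \<in> D" "E (- B) w = w" and B: "B \<in> sets borel"
  shows "energy c w (A u) = 0"
proof -
  have B': "- B \<in> sets borel" using B by (auto intro: borel_comp)
  have zero: "E (- B) u = 0" "E B w = 0"
    using E_inter[of "- B" B u] E_inter[of B "- B" w] u w B B' D_H by auto
  have re: "Re (energy c w (A (cscale a u))) = 0" for a
  proof -
    let ?u = "cscale a u"
    have uD: "?u \<in> D" and uw: "?u + w \<in> D" using u w by (auto intro: D_cscale D_add)
    have "energy c (?u + w) (A (?u + w)) = energy c ?u (A ?u) + energy c w (A w)"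
      using form_split[OF uw B] u w B B' D_H zero uD
      by (simp add: E_add E_cscale)
    moreover have "energy c (?u + w) (A (?u + w)) =
        energy c ?u (A ?u) + energy c ?u (A w) + energy c w (A ?u) + energy c w (A w)"
      using uD w D_H A_H
      by (simp add: A_add energy_add_left energy_add_right H_add del: energy_cscale_left)
    ultimately have "energy c ?u (A w) + energy c w (A ?u) = 0" by (simp del: energy_cscale_left)
    moreover have "energy c ?u (A w) = cnj (energy c w (A ?u))"
      using A_symmetric[OF uD w(1)] energy_commute by metis
    ultimately have "cnj (energy c w (A ?u)) + energy c w (A ?u) = 0" by simp
    then show ?thesis by (simp add: complex_eq_iff)
  qed
  show ?thesis
    using re[of 1] re[of \<i>] u by (simp add: A_cscale complex_eq_iff)
qed

lemma E_A_invariant: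
  assumes u: "u \<in> D" "E B u = u" and B: "B \<in> sets borel"
  shows "E B (A u) = A u"
proof -
  have B': "- B \<in> sets borel" using B by (auto intro: borel_comp)
  have "E (- B) (A u) = 0"
  proof (rule orthogonal_to_D)
    fix z assume z: "z \<in> D"
    have "energy c (E (- B) z) (A u) = 0"
      using z u B B' D_H E_D by (intro E_A_orthogonal[where B = B]) auto
    then show "energy c z (E (- B) (A u)) = 0" using z u B' D_H by (simp add: E_sym)
  qed (use u B' in simp)
  then show ?thesis using E_Compl[of B "A u"] B u by simp
qed

lemma E_A_commute:
  assumes u: "u \<in> D" and B: "B \<in> sets borel"
  shows "E B (A u) = A (E B u)"
proof -
  have B': "- B \<in> sets borel" using B by (auto intro: borel_comp)
  have uH: "u \<in> H" using D_H u .
  have "A u = A (E B u) + A (E (- B) u)"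
    using E_Compl[OF B uH] A_add[of "E B u" "E (- B) u"] E_D[OF u] B B' by simp
  moreover have "E B (A (E B u)) = A (E B u)"
    using E_D[OF u B] B uH by (intro E_A_invariant) auto
  moreover have "E B (A (E (- B) u)) = 0"
  proof -
    have "E (- B) (A (E (- B) u)) = A (E (- B) u)"
      using E_D[OF u B'] B' uH by (intro E_A_invariant) auto
    then show ?thesis
      using E_inter[of B "- B" "A (E (- B) u)"] B B' E_D[OF u B'] by simp
  qed
  ultimately show ?thesis using B B' E_D[OF u] by (simp add: E_add)
qed

text \<open>On the range of the projection for a compact interval with centre \<open>s\<close> and radius \<open>r\<close>, the
  quadratic form of \<open>A - s\<close> is at most \<open>r\<close>. For a symmetric operator this bounds the norm.\<close>

lemma interval_form_bound:
  assumes u: "u \<in> H" "E {s - r..s + r} u = u"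
  shows "u \<in> D" and "\<bar>Re (energy c u (A u)) - s * (enorm c u)\<^sup>2\<bar> \<le> r * (enorm c u)\<^sup>2"
proof -
  let ?J = "{s - r..s + r}"
  show uD: "u \<in> D" using E_bounded_D[of u ?J] u by simp
  interpret finite_measure "\<mu> u" using finite_measure_\<mu> u(1) .
  have "E (- ?J) u = 0" using E_Compl[of ?J u] u by simp
  then have "emeasure (\<mu> u) (- ?J) = 0"
    using u emeasure_\<mu>[of u "- ?J"] by (simp add: borel_comp)
  then have "- ?J \<in> null_sets (\<mu> u)" by (simp add: null_sets_def borel_comp)
  from AE_not_in[OF this] have ae: "AE t in \<mu> u. t \<in> ?J" by simp
  have m: "measure (\<mu> u) UNIV = (enorm c u)\<^sup>2" using u by (simp add: measure_\<mu> E_UNIV)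
  have int: "integrable (\<mu> u) (\<lambda>t. t - s)" using integrable_id_\<mu>[OF uD] by simp
  have "Re (energy c u (A u)) - s * (enorm c u)\<^sup>2 = (\<integral>t. t - s \<partial>\<mu> u)"
    using integrable_id_\<mu>[OF uD] uD m by (simp add: A_form)
  moreover have "\<bar>\<integral>t. t - s \<partial>\<mu> u\<bar> \<le> (\<integral>t. \<bar>t - s\<bar> \<partial>\<mu> u)"
    by (rule integral_abs_bound)
  moreover have "(\<integral>t. \<bar>t - s\<bar> \<partial>\<mu> u) \<le> (\<integral>t. r \<partial>\<mu> u)"
    using ae int by (intro integral_mono_AE) auto
  moreover have "(\<integral>t. r \<partial>\<mu> u) = r * (enorm c u)\<^sup>2" using m by simp
  ultimately show "\<bar>Re (energy c u (A u)) - s * (enorm c u)\<^sup>2\<bar> \<le> r * (enorm c u)\<^sup>2"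
    by linarith
qed

lemma interval_norm_bound:
  assumes u: "u \<in> H" "E {s - r..s + r} u = u" and r: "0 \<le> r"
  defines "w \<equiv> A u - cscale (complex_of_real s) u"
  shows "w \<in> H" "E {s - r..s + r} w = w" "enorm c w \<le> r * enorm c u"
proof -
  let ?J = "{s - r..s + r}"
  have uD: "u \<in> D" using interval_form_bound[OF u] by simp
  show wH: "w \<in> H" using uD u by (simp add: w_def)
  have EA: "E ?J (A u) = A u" using uD u by (intro E_A_invariant) auto
  then show Ew: "E ?J w = w" using uD u by (simp add: w_def E_diff E_cscale)
  show "enorm c w \<le> r * enorm c u"
  proof (cases "enorm c w = 0 \<or> enorm c u = 0")
    case True
    have "enorm c w = 0" if "enorm c u = 0"
    proof -
      have "u = 0" using enorm_eq_0[OF u(1) that] .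
      moreover have "A 0 = 0" using A_cscale[of 0 0] D_0 by simp
      ultimately show ?thesis by (simp add: w_def)
    qed
    then show ?thesis using True r by auto
  next
    case False
    \<comment> \<open>Rescaling \<open>T u = w\<close> to the length of \<open>u\<close> makes the polarized bound sharp enough: it reads
      \<open>\<parallel>u\<parallel> \<parallel>T u\<parallel> \<le> r \<parallel>u\<parallel>\<^sup>2\<close>.\<close>
    define T where "T x = A x - cscale (complex_of_real s) x" for x
    define k where "k = complex_of_real (enorm c u / enorm c w)"
    define z where "z = cscale k w"
    have zH: "z \<in> H" and Ez: "E ?J z = z" using wH Ew by (auto simp: z_def E_cscale)
    have zD: "z \<in> D" using interval_form_bound[OF zH Ez] by simp
    have nz: "enorm c z = enorm c u" using False by (simp add: z_def k_def norm_divide norm_mult)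
    have q: "\<bar>Re (energy c x (T x))\<bar> \<le> r * (enorm c x)\<^sup>2" if "x \<in> H" "E ?J x = x" for x
    proof -
      have "Re (energy c x (T x)) = Re (energy c x (A x)) - s * (enorm c x)\<^sup>2"
        using interval_form_bound[OF that] that by (simp add: T_def energy_diff_right)
      then show ?thesis using interval_form_bound[OF that] by simp
    qed
    have Tadd: "T (u + z) = T u + T z" "T (u - z) = T u - T z"
      using uD zD u zH by (auto simp: T_def A_add A_diff pot.scale_right_distrib pot.scale_right_diff_distrib)
    have TH: "T u \<in> H" "T z \<in> H" using uD zD u zH by (auto simp: T_def)
    have sym: "Re (energy c u (T z)) = Re (energy c z (T u))"
    proof -
      have "energy c u (T z) = energy c (T u) z"
        using uD zD u zH by (simp add: T_def energy_diff_right energy_diff_left A_symmetric)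
      then show ?thesis by (metis energy_commute cnj.simps(1))
    qed
    have "4 * Re (energy c z (T u)) = Re (energy c (u + z) (T (u + z))) - Re (energy c (u - z) (T (u - z)))"
      unfolding Tadd using u zH TH sym
      by (simp add: energy_add_left energy_add_right energy_diff_left energy_diff_right)
    also have "\<dots> \<le> r * (enorm c (u + z))\<^sup>2 + r * (enorm c (u - z))\<^sup>2"
      using q[of "u + z"] q[of "u - z"] u zH Ez by (simp add: E_add E_diff)
    also have "\<dots> = r * (4 * (enorm c u)\<^sup>2)"
      using u zH by (simp add: enorm_add_square enorm_diff_square nz algebra_simps)
    finally have "Re (energy c z (T u)) \<le> r * (enorm c u)\<^sup>2" by simp
    moreover have "energy c z (T u) = complex_of_real (enorm c u * enorm c w)"
      using False unfolding z_def T_def w_def[symmetric]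
      by (simp add: energy_self k_def power2_eq_square)
    ultimately have "enorm c u * enorm c w \<le> enorm c u * (r * enorm c u)"
      by (simp add: power2_eq_square algebra_simps del: of_real_mult)
    then show ?thesis using False by (simp add: order_less_le)
  qed
qed

text \<open>Conjugation carries the range for one compact interval to a subspace on which \<open>A\<close> has the same
  bounds. Two vectors on which \<open>A\<close> is within \<open>r\<^sub>1\<close> of \<open>s\<^sub>1\<close> and within \<open>r\<^sub>2\<close> of \<open>s\<^sub>2\<close> satisfy
  \<open>\<bar>s\<^sub>1 - s\<^sub>2\<bar> \<bar>\<langle>x, y\<rangle>\<bar> \<le> (r\<^sub>1 + r\<^sub>2) \<theta> \<parallel>x\<parallel> \<parallel>y\<parallel>\<close> whenever \<open>\<theta>\<close> bounds the cosine of the angle of the two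
  invariant subspaces. Iterating this estimate shows that separated intervals give orthogonal
  subspaces.\<close>

lemma cnj_separated_orthogonal:
  assumes r: "0 \<le> r1" "0 \<le> r2" and sep: "r1 + r2 < \<bar>s1 - s2\<bar>"
    and x: "x \<in> H" "E {s1 - r1..s1 + r1} x = x"
    and y: "y \<in> H" "E {s2 - r2..s2 + r2} y = y"
  shows "energy c (pot_cnj x) y = 0"
proof -
  define \<rho> where "\<rho> = (r1 + r2) / \<bar>s1 - s2\<bar>"
  have d: "0 < \<bar>s1 - s2\<bar>" using r sep by linarith
  have \<rho>: "0 \<le> \<rho>" "\<rho> < 1" using r sep d by (auto simp: \<rho>_def)
  have step: "cmod (energy c (pot_cnj x) y) \<le> \<rho> ^ n * (enorm c x * enorm c y)"
    if "x \<in> H" "E {s1 - r1..s1 + r1} x = x" "y \<in> H" "E {s2 - r2..s2 + r2} y = y" for n x y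
    using that
  proof (induction n arbitrary: x y)
    case 0
    then show ?case using energy_Cauchy_Schwarz[of "pot_cnj x" y] by simp
  next
    case (Suc n)
    define x' where "x' = A x - cscale (complex_of_real s1) x"
    define y' where "y' = A y - cscale (complex_of_real s2) y"
    note bx = interval_norm_bound[OF Suc.prems(1,2) r(1), folded x'_def]
    note bv = interval_norm_bound[OF Suc.prems(3,4) r(2), folded y'_def]
    have xD: "x \<in> D" and yD: "y \<in> D"
      using interval_form_bound Suc.prems by blast+
    have "energy c (pot_cnj x') y - energy c (pot_cnj x) y' =
        complex_of_real (s2 - s1) * energy c (pot_cnj x) y"
      using xD yD Suc.prems A_symmetric[OF D_cnj[OF xD] yD]
      by (simp add: x'_def y'_def pot_cnj_diff pot_cnj_cscale energy_diff_left energy_diff_right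
          A_cnj algebra_simps)
    then have "\<bar>s1 - s2\<bar> * cmod (energy c (pot_cnj x) y) =
        cmod (energy c (pot_cnj x') y - energy c (pot_cnj x) y')"
      by (simp add: norm_mult abs_minus_commute del: of_real_diff)
    also have "\<dots> \<le> cmod (energy c (pot_cnj x') y) + cmod (energy c (pot_cnj x) y')"
      by (rule norm_triangle_ineq4)
    also have "\<dots> \<le> \<rho> ^ n * (enorm c x' * enorm c y) + \<rho> ^ n * (enorm c x * enorm c y')"
      using Suc.IH[of x' y] Suc.IH[of x y'] bx bv Suc.prems by (intro add_mono) auto
    also have "\<dots> \<le> \<rho> ^ n * (r1 * enorm c x * enorm c y) + \<rho> ^ n * (enorm c x * (r2 * enorm c y))"
      using bx bv \<rho> by (intro add_mono mult_left_mono mult_right_mono) auto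
    also have "\<dots> = (r1 + r2) * (\<rho> ^ n * (enorm c x * enorm c y))" by (simp add: algebra_simps)
    finally have "cmod (energy c (pot_cnj x) y) \<le> (r1 + r2) * (\<rho> ^ n * (enorm c x * enorm c y)) / \<bar>s1 - s2\<bar>"
      using d by (simp add: field_simps)
    then show ?case by (simp add: \<rho>_def)
  qed
  have "(\<lambda>n. \<rho> ^ n * (enorm c x * enorm c y)) \<longlonglongrightarrow> 0"
    using \<rho> by (intro tendsto_mult_left_zero LIMSEQ_realpow_zero) auto
  then have "cmod (energy c (pot_cnj x) y) \<le> 0"
    using step[OF x y] by (intro LIMSEQ_le_const) auto
  then show ?thesis by simp
qed

lemma E_incseq_tendsto:
  assumes B: "incseq B" "\<And>n. B n \<in> sets borel" and u: "u \<in> H"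
  shows "(\<lambda>n. enorm c (E (B n) u - E (\<Union>n. B n) u)) \<longlonglongrightarrow> 0"
proof -
  interpret finite_measure "\<mu> u" using finite_measure_\<mu>[OF u] .
  let ?C = "\<lambda>n. (\<Union>n. B n) - B n"
  have U: "(\<Union>n. B n) \<in> sets borel" using B by auto
  have C: "?C n \<in> sets borel" for n using B U by auto
  have eq: "enorm c (E (B n) u - E (\<Union>n. B n) u) = sqrt (measure (\<mu> u) (?C n))" for n
  proof -
    have "B n \<union> ?C n = (\<Union>n. B n)" by auto
    then have "E (\<Union>n. B n) u = E (B n) u + E (?C n) u"
      using E_union[of "B n" "?C n" u] B C u by auto
    then show ?thesis using measure_\<mu>[OF u C] by simp
  qed
  have "(\<lambda>n. measure (\<mu> u) (?C n)) \<longlonglongrightarrow> measure (\<mu> u) (\<Inter>n. ?C n)"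
    using C B(1) by (intro finite_Lim_measure_decseq) (auto simp: decseq_def incseq_def)
  moreover have "(\<Inter>n. ?C n) = {}" by auto
  ultimately have "(\<lambda>n. sqrt (measure (\<mu> u) (?C n))) \<longlonglongrightarrow> sqrt 0"
    by (intro tendsto_real_sqrt) simp
  then show ?thesis by (simp add: eq)
qed

text \<open>The complement of a compact interval is exhausted by pairs of compact intervals at positive
  distance from it.\<close>

lemma cnj_interval_orthogonal:
  assumes x: "x \<in> H" "E {p..q} x = x" and w: "w \<in> H" and pq: "p \<le> q"
  shows "energy c (pot_cnj x) (E (- {p..q}) w) = 0"
proof -
  define L where "L n = {p - real (Suc n) .. p - 1 / real (Suc n)}" for n
  define R where "R n = {q + 1 / real (Suc n) .. q + real (Suc n)}" for n
  have x': "E {(p + q) / 2 - (q - p) / 2 .. (p + q) / 2 + (q - p) / 2} x = x"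
  proof -
    have "(p + q) / 2 - (q - p) / 2 = p" "(p + q) / 2 + (q - p) / 2 = q" by (auto simp: field_simps)
    then show ?thesis using x by simp
  qed
  have orth: "energy c (pot_cnj x) (E {a..d} w) = 0" if "a \<le> d" "d < p \<or> q < a" for a d
  proof (rule cnj_separated_orthogonal[OF _ _ _ x(1) x'])
    have "(a + d) / 2 - (d - a) / 2 = a" "(a + d) / 2 + (d - a) / 2 = d" by (auto simp: field_simps)
    then show "E {(a + d) / 2 - (d - a) / 2 .. (a + d) / 2 + (d - a) / 2} (E {a..d} w) = E {a..d} w"
      using w by simp
    show "(q - p) / 2 + (d - a) / 2 < \<bar>(p + q) / 2 - (a + d) / 2\<bar>"
      using that pq by (auto simp: field_simps abs_if)
  qed (use that pq w in auto)
  have le: "1 / real (Suc n) \<le> real (Suc n)" for n by (simp add: field_simps)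
  have inc: "1 / real (Suc n) \<le> 1 / real (Suc m)" if "m \<le> n" for m n
    using that by (simp add: field_simps)
  have "incseq (\<lambda>n. L n \<union> R n)"
    unfolding incseq_def
  proof (intro allI impI)
    fix m n :: nat assume mn: "m \<le> n"
    have "real (Suc m) \<le> real (Suc n)" using mn by simp
    with inc[OF mn] have "L m \<subseteq> L n" "R m \<subseteq> R n" unfolding L_def R_def by (auto simp del: of_nat_Suc)
    then show "L m \<union> R m \<subseteq> L n \<union> R n" by blast
  qed
  moreover have "(\<Union>n. L n \<union> R n) = - {p..q}"
  proof (intro set_eqI iffI)
    fix t assume t: "t \<in> - {p..q}"
    have ev: "\<exists>n. 1 / real (Suc n) \<le> e \<and> e \<le> real (Suc n)" if "0 < e" for e
    proof -
      obtain n where n: "1 / e + e \<le> real n" using real_arch_simple by blast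
      have "0 < 1 / e" using that by simp
      then have "1 / e \<le> real (Suc n)" "e \<le> real (Suc n)"
        using n that unfolding of_nat_Suc by linarith+
      then show ?thesis using that by (intro exI[of _ n]) (auto simp: field_simps)
    qed
    from t have "t < p \<or> q < t" by auto
    then show "t \<in> (\<Union>n. L n \<union> R n)"
    proof
      assume "t < p"
      with ev[of "p - t"] obtain n where "1 / real (Suc n) \<le> p - t" "p - t \<le> real (Suc n)" by auto
      then have "t \<in> L n" by (auto simp: L_def simp del: of_nat_Suc)
      then show ?thesis by blast
    next
      assume "q < t"
      with ev[of "t - q"] obtain n where "1 / real (Suc n) \<le> t - q" "t - q \<le> real (Suc n)" by auto
      then have "t \<in> R n" by (auto simp: R_def simp del: of_nat_Suc)
      then show ?thesis by blast
    qed
  next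
    fix t assume "t \<in> (\<Union>n. L n \<union> R n)"
    then obtain n where n: "t \<in> L n \<or> t \<in> R n" by auto
    define e where "e = 1 / real (Suc n)"
    have "0 < e" by (simp add: e_def)
    with n show "t \<in> - {p..q}" unfolding L_def R_def e_def[symmetric] by auto
  qed
  moreover have LR: "L n \<in> sets borel" "R n \<in> sets borel" for n by (auto simp: L_def R_def)
  ultimately have "(\<lambda>n. enorm c (E (L n \<union> R n) w - E (- {p..q}) w)) \<longlonglongrightarrow> 0"
    using E_incseq_tendsto[of "\<lambda>n. L n \<union> R n" w] w by simp
  then have "(\<lambda>n. energy c (pot_cnj x) (E (L n \<union> R n) w)) \<longlonglongrightarrow> energy c (pot_cnj x) (E (- {p..q}) w)"
    using x w LR by (intro energy_tendsto_right) (auto intro: borel_comp)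
  moreover have "energy c (pot_cnj x) (E (L n \<union> R n) w) = 0" for n
  proof -
    define e where "e = 1 / real (Suc n)"
    have e: "0 < e" "e \<le> real (Suc n)" using le[of n] by (auto simp: e_def)
    have "L n \<inter> R n = {}" using pq e unfolding L_def R_def e_def[symmetric] by auto
    moreover have "energy c (pot_cnj x) (E (L n) w) = 0" unfolding L_def e_def[symmetric]
      using e by (intro orth; linarith)
    moreover have "energy c (pot_cnj x) (E (R n) w) = 0" unfolding R_def e_def[symmetric]
      using e by (intro orth; linarith)
    ultimately show ?thesis using LR w x by (simp add: E_union energy_add_right)
  qed
  ultimately show ?thesis by (simp add: LIMSEQ_const_iff)
qed

text \<open>By the orthogonality just shown, conjugation preserves the range of the projection and also
  the range of the complementary projection.\<close>

lemma E_interval_cnj: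
  assumes u: "u \<in> H" and pq: "p \<le> q"
  shows "pot_cnj (E {p..q} u) = E {p..q} (pot_cnj u)"
proof -
  let ?I = "{p..q}"
  have I': "- ?I \<in> sets borel" by (simp add: borel_comp)
  have a: "E ?I (pot_cnj (E ?I v)) = pot_cnj (E ?I v)" if "v \<in> H" for v
  proof -
    have "E (- ?I) (pot_cnj (E ?I v)) = 0"
    proof (rule energy_separates)
      fix w assume w: "w \<in> H"
      have "energy c (pot_cnj (E ?I v)) (E (- ?I) w) = 0"
        using that w pq by (intro cnj_interval_orthogonal) auto
      then have "energy c (E (- ?I) w) (pot_cnj (E ?I v)) = 0" by (subst energy_commute) simp
      then show "energy c w (E (- ?I) (pot_cnj (E ?I v))) = energy c w 0"
        using w that I' by (simp add: E_sym)
    qed (use that I' in auto)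
    then show ?thesis using E_Compl[of ?I "pot_cnj (E ?I v)"] that by simp
  qed
  have b: "E ?I (pot_cnj (E (- ?I) u)) = 0"
  proof (rule energy_separates)
    fix w assume w: "w \<in> H"
    have "energy c w (E ?I (pot_cnj (E (- ?I) u))) = energy c (E ?I w) (pot_cnj (E (- ?I) u))"
      using w u I' by (simp add: E_sym)
    also have "\<dots> = cnj (energy c (pot_cnj (E ?I w)) (E (- ?I) u))"
      by (simp flip: energy_cnj)
    also have "\<dots> = 0" using cnj_interval_orthogonal[of "E ?I w" p q u] w u pq by simp
    finally show "energy c w (E ?I (pot_cnj (E (- ?I) u))) = energy c w 0" by simp
  qed (use u I' in auto)
  have "pot_cnj u = pot_cnj (E ?I u) + pot_cnj (E (- ?I) u)"
    using E_Compl[of ?I u] u by (simp flip: pot_cnj_add)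
  then have "E ?I (pot_cnj u) = E ?I (pot_cnj (E ?I u)) + E ?I (pot_cnj (E (- ?I) u))"
    using u I' by (simp add: E_add)
  then show ?thesis using a[OF u] b by simp
qed

end

section \<open>Test functions and distributions\<close>

context spectral_operator
begin

abbreviation "S \<equiv> test_space D A"

lemma test_iff: "u \<in> S \<longleftrightarrow> real_potential u \<and> (\<forall>k. (A ^^ k) u \<in> D)"
proof -
  have "(\<forall>p\<in>{1..}. \<forall>k<p. (A ^^ k) u \<in> D) \<longleftrightarrow> (\<forall>k. (A ^^ k) u \<in> D)" by auto
  then show ?thesis unfolding test_space_def dom_power_def by blast
qed

lemma test_real: "u \<in> S \<Longrightarrow> real_potential u"
  and test_D: "u \<in> S \<Longrightarrow> (A ^^ k) u \<in> D"
  by (auto simp: test_iff)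

lemma test_H [simp]: "u \<in> S \<Longrightarrow> u \<in> H"
  using test_D[of u 0] D_H by simp

lemma test_pow_H [simp]: "u \<in> S \<Longrightarrow> (A ^^ k) u \<in> H"
  using test_D D_H by blast

lemma pow_add: "u \<in> S \<Longrightarrow> v \<in> S \<Longrightarrow> (A ^^ k) (u + v) = (A ^^ k) u + (A ^^ k) v"
  by (induction k) (auto simp: A_add test_D)

lemma pow_cscale: "u \<in> S \<Longrightarrow> (A ^^ k) (cscale a u) = cscale a ((A ^^ k) u)"
  by (induction k) (auto simp: A_cscale test_D)

lemma test_add: "u \<in> S \<Longrightarrow> v \<in> S \<Longrightarrow> u + v \<in> S"
  using pow_add by (subst test_iff) (auto simp: test_real test_D real_potential_add D_add)

lemma test_cscale: "u \<in> S \<Longrightarrow> cscale (complex_of_real a) u \<in> S"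
  using pow_cscale by (subst test_iff) (auto simp: test_real test_D real_potential_cscale D_cscale)

lemma test_uminus: "u \<in> S \<Longrightarrow> - u \<in> S"
  using test_cscale[of u "-1"] by simp

lemma test_diff: "u \<in> S \<Longrightarrow> v \<in> S \<Longrightarrow> u - v \<in> S"
  using test_add[of u "- v"] test_uminus by simp

lemma test_0: "0 \<in> S"
proof -
  have "A 0 = 0" using A_cscale[of 0 0] D_0 by simp
  then have "(A ^^ k) 0 = 0" for k by (induction k) auto
  then show ?thesis by (auto simp: test_iff D_0)
qed

lemma test_sum: "(\<And>i. i \<in> I \<Longrightarrow> f i \<in> S) \<Longrightarrow> sum f I \<in> S"
  by (induction I rule: infinite_finite_induct) (auto simp: test_0 test_add)

lemma pow_diff: "u \<in> S \<Longrightarrow> v \<in> S \<Longrightarrow> (A ^^ k) (u - v) = (A ^^ k) u - (A ^^ k) v"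
  using pow_add[of u "- v" k] pow_cscale[of v k "-1"] test_uminus by simp

lemma E_pow: "u \<in> S \<Longrightarrow> B \<in> sets borel \<Longrightarrow> (A ^^ k) (E B u) = E B ((A ^^ k) u)"
  by (induction k) (auto simp: E_A_commute test_D)

lemma test_E: "u \<in> S \<Longrightarrow> B \<in> sets borel \<Longrightarrow> real_potential (E B u) \<Longrightarrow> E B u \<in> S"
  by (auto simp: test_iff[of "E B u"] E_pow test_D E_D)

lemma real_E_interval: "u \<in> H \<Longrightarrow> real_potential u \<Longrightarrow> p \<le> q \<Longrightarrow> real_potential (E {p..q} u)"
  using E_interval_cnj[of u p q] by (simp add: real_potential_iff_cnj)

text \<open>The range of the projection for a compact interval is contained in the domain of \<open>A\<close> and invariant
  under \<open>A\<close>, so it is contained in the domain of every power.\<close>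

lemma test_E_interval:
  assumes u: "u \<in> H" "real_potential u" and pq: "p \<le> q"
  shows "E {p..q} u \<in> S"
proof -
  have "(A ^^ k) (E {p..q} u) \<in> D \<and> E {p..q} ((A ^^ k) (E {p..q} u)) = (A ^^ k) (E {p..q} u)" for k
  proof (induction k)
    case 0
    then show ?case using u by (simp add: E_bounded_D)
  next
    case (Suc k)
    let ?x = "(A ^^ k) (E {p..q} u)"
    have Ax: "E {p..q} (A ?x) = A ?x" using Suc by (intro E_A_invariant) auto
    moreover have "E {p..q} (A ?x) \<in> D" using Suc by (intro E_bounded_D) auto
    ultimately show ?case by simp
  qed
  then show ?thesis using real_E_interval[OF u pq] by (auto simp: test_iff)
qed

lemma real_potential_limit:
  assumes s: "\<And>n. s n \<in> H" "\<And>n. real_potential (s n)" and u: "u \<in> H"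
    and lim: "(\<lambda>n. enorm c (s n - u)) \<longlonglongrightarrow> 0"
  shows "real_potential u"
proof -
  have "enorm c (s n - pot_cnj u) = enorm c (s n - u)" for n
    using enorm_cnj[of "s n - u"] s(2)[of n] by (simp add: pot_cnj_diff real_potential_iff_cnj)
  then have "(\<lambda>n. enorm c (s n - pot_cnj u)) \<longlonglongrightarrow> 0" using lim by simp
  then have "pot_cnj u = u" using s u lim by (intro enorm_limit_unique[of s]) auto
  then show ?thesis by (simp add: real_potential_iff_cnj)
qed

lemma positive_intervals:
  "incseq (\<lambda>n. {1 / real (Suc n)..real (Suc n)})"
  "(\<Union>n. {1 / real (Suc n)..real (Suc n)}) = {0<..}"
proof -
  show "incseq (\<lambda>n. {1 / real (Suc n)..real (Suc n)})"
  proof (unfold incseq_def, intro allI impI)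
    fix m n :: nat assume "m \<le> n"
    then have "1 / real (Suc n) \<le> 1 / real (Suc m)" "real (Suc m) \<le> real (Suc n)"
      by (auto simp: field_simps)
    then show "{1 / real (Suc m)..real (Suc m)} \<subseteq> {1 / real (Suc n)..real (Suc n)}"
      by (auto simp del: of_nat_Suc)
  qed
  show "(\<Union>n. {1 / real (Suc n)..real (Suc n)}) = {0<..}"
  proof (intro set_eqI iffI)
    fix t :: real assume "t \<in> {0<..}"
    then have t: "0 < t" "0 < 1 / t" by auto
    obtain n where "1 / t + t \<le> real n" using real_arch_simple by blast
    then have "1 / t \<le> real (Suc n)" "t \<le> real (Suc n)"
      using t unfolding of_nat_Suc by linarith+
    then have "t \<in> {1 / real (Suc n)..real (Suc n)}" using t by (auto simp: field_simps)
    then show "t \<in> (\<Union>n. {1 / real (Suc n)..real (Suc n)})" by blast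
  next
    fix t assume "t \<in> (\<Union>n. {1 / real (Suc n)..real (Suc n)})"
    then obtain n where n: "1 / real (Suc n) \<le> t" by auto
    have "0 < 1 / real (Suc n)" by simp
    with n show "t \<in> {0<..}" unfolding greaterThan_iff by linarith
  qed
qed

lemma negative_intervals:
  "incseq (\<lambda>n. {- real n..0})" "(\<Union>n. {- real n..0}) = {..0}"
proof -
  show "incseq (\<lambda>n. {- real n..0})" by (auto simp: incseq_def)
  show "(\<Union>n. {- real n..0}) = {..0}"
  proof (intro set_eqI iffI)
    fix t :: real assume t: "t \<in> {..0}"
    obtain n where "- t \<le> real n" using real_arch_simple by blast
    then have "t \<in> {- real n..0}" using t by auto
    then show "t \<in> (\<Union>n. {- real n..0})" by blast
  qed auto
qed

lemma test_E_n: "u \<in> H \<Longrightarrow> real_potential u \<Longrightarrow> E {1 / real n..real n} u \<in> S"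
proof (rule test_E_interval)
  show "1 / real n \<le> real n" by (cases n) (auto simp: field_simps)
qed

lemma E_positive_tendsto:
  assumes "u \<in> H"
  shows "(\<lambda>n. enorm c (E {1 / real n..real n} u - E {0<..} u)) \<longlonglongrightarrow> 0"
proof (rule LIMSEQ_imp_Suc)
  have "(\<lambda>n. enorm c (E {1 / real (Suc n)..real (Suc n)} u
      - E (\<Union>n. {1 / real (Suc n)..real (Suc n)}) u)) \<longlonglongrightarrow> 0"
    by (rule E_incseq_tendsto[OF positive_intervals(1) _ assms]) (rule borel_closed closed_atLeastAtMost)+
  then show "(\<lambda>n. enorm c (E {1 / real (Suc n)..real (Suc n)} u - E {0<..} u)) \<longlonglongrightarrow> 0"
    unfolding positive_intervals(2) .
qed

lemma test_E_positive:
  assumes s: "s \<in> S"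
  shows "E {0<..} s \<in> S"
proof (rule test_E[OF s])
  show "real_potential (E {0<..} s)"
    by (rule real_potential_limit[OF _ _ _ E_positive_tendsto])
      (use s test_E_n[of s] in \<open>auto simp: test_real\<close>)
qed simp

text \<open>Sequential continuity. The seminorm balls form a subbase, so convergence can be tested on them.\<close>

lemma distribution_tendsto:
  assumes \<xi>: "\<xi> \<in> distributions c D A" and s: "\<And>n. s n \<in> S" and u: "u \<in> S"
    and lim: "\<And>p. (\<lambda>n. enorm c ((A ^^ p) (s n) - (A ^^ p) u)) \<longlonglongrightarrow> 0"
  shows "(\<lambda>n. \<xi> (s n)) \<longlonglongrightarrow> \<xi> u"
proof -
  let ?B = "{{w \<in> S. enorm c ((A ^^ p) (w - u)) < e} | u p e. u \<in> S \<and> e > 0}"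
  have top: "topspace (test_topology c D A) = S"
  proof -
    have "w \<in> \<Union> ?B" if "w \<in> S" for w
    proof -
      have "{v \<in> S. enorm c ((A ^^ 0) (v - w)) < 1} \<in> ?B"
        using that by (intro CollectI exI[of _ w] exI[of _ 0] exI[of _ "1 :: real"]) simp
      moreover have "w \<in> {v \<in> S. enorm c ((A ^^ 0) (v - w)) < 1}" using that by simp
      ultimately show ?thesis by blast
    qed
    then have "\<Union> ?B = S" by blast
    then show ?thesis by (simp add: test_topology_def topology_generated_by_topspace)
  qed
  have cont: "continuous_map (test_topology c D A) euclideanreal \<xi>"
    using \<xi> by (simp add: distributions_def)
  have ev: "\<forall>\<^sub>F n in sequentially. s n \<in> U" if "generate_topology_on ?B U" "u \<in> U" for U
    using that
  proof (induction rule: generate_topology_on.induct)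
    case (Int a b)
    then show ?case by (auto intro: eventually_conj)
  next
    case (UN K)
    then obtain k where k: "k \<in> K" "u \<in> k" by auto
    then have "\<forall>\<^sub>F n in sequentially. s n \<in> k" using UN.IH by blast
    then show ?case using k by (auto elim: eventually_mono)
  next
    case (Basis b)
    then obtain v p e where b: "b = {w \<in> S. enorm c ((A ^^ p) (w - v)) < e}" and v: "v \<in> S" by auto
    define d where "d = e - enorm c ((A ^^ p) (u - v))"
    have "0 < d" using Basis b by (simp add: d_def)
    from order_tendstoD(2)[OF lim[of p] this] show ?case
    proof eventually_elim
      case (elim n)
      have "enorm c ((A ^^ p) (s n) - (A ^^ p) v) \<le>
          enorm c ((A ^^ p) (s n) - (A ^^ p) u) + enorm c ((A ^^ p) u - (A ^^ p) v)"
        using s u v by (intro enorm_triangle_diff) auto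
      then show ?case using elim s u v unfolding b d_def by (simp add: pow_diff)
    qed
  qed simp
  show ?thesis
  proof (rule topological_tendstoI)
    fix V assume V: "open V" "\<xi> u \<in> V"
    have "openin (test_topology c D A) {w \<in> S. \<xi> w \<in> V}"
      using openin_continuous_map_preimage[OF cont, of V] V by (simp add: top)
    then have "generate_topology_on ?B {w \<in> S. \<xi> w \<in> V}"
      by (simp add: test_topology_def openin_topology_generated_by_iff)
    from ev[OF this] show "\<forall>\<^sub>F n in sequentially. \<xi> (s n) \<in> V"
      using u V by (auto elim: eventually_mono)
  qed
qed

lemma distribution_add: "\<xi> \<in> distributions c D A \<Longrightarrow> u \<in> S \<Longrightarrow> v \<in> S \<Longrightarrow> \<xi> (u + v) = \<xi> u + \<xi> v"
  and distribution_cscale: "\<xi> \<in> distributions c D A \<Longrightarrow> u \<in> S \<Longrightarrow> \<xi> (cscale (complex_of_real a) u) = a * \<xi> u"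
  by (auto simp: distributions_def)

lemma distribution_0: "\<xi> \<in> distributions c D A \<Longrightarrow> \<xi> 0 = 0"
  using distribution_cscale[of \<xi> 0 0] test_0 by simp

lemma distribution_diff:
  "\<xi> \<in> distributions c D A \<Longrightarrow> u \<in> S \<Longrightarrow> v \<in> S \<Longrightarrow> \<xi> (u - v) = \<xi> u - \<xi> v"
  using distribution_add[of \<xi> u "- v"] distribution_cscale[of \<xi> v "-1"] test_uminus[of v] by simp

lemma distribution_sum:
  assumes "\<xi> \<in> distributions c D A" "\<And>i. i \<in> I \<Longrightarrow> f i \<in> S"
  shows "\<xi> (sum f I) = (\<Sum>i\<in>I. \<xi> (f i))"
  using assms(2)
  by (induction I rule: infinite_finite_induct)
    (auto simp: distribution_0 distribution_add test_sum assms(1))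

lemma pairing_test:
  assumes \<xi>: "\<xi> \<in> distributions c D A" and s: "s \<in> S"
  shows "pairing E s \<xi> = \<xi> (E {0<..} s)"
proof -
  have "(\<lambda>n. \<xi> (E {1 / real n..real n} s)) \<longlonglongrightarrow> \<xi> (E {0<..} s)"
  proof (rule distribution_tendsto[OF \<xi>])
    show "E {1 / real n..real n} s \<in> S" for n
      using s by (intro test_E_n) (auto simp: test_real)
    show "E {0<..} s \<in> S" using test_E_positive[OF s] .
    show "(\<lambda>n. enorm c ((A ^^ p) (E {1 / real n..real n} s) - (A ^^ p) (E {0<..} s))) \<longlonglongrightarrow> 0" for p
      using E_positive_tendsto[of "(A ^^ p) s"] s by (simp add: E_pow)
  qed
  then show ?thesis by (simp add: pairing_def truncated_pairing_def[abs_def] limI)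
qed

end

section \<open>The Gaussian field of the Wiener transform\<close>

locale gaussian_field = spectral_operator c D A E
  for c :: "'v \<Rightarrow> 'v \<Rightarrow> real" and D A E +
  fixes P :: "('v potential \<Rightarrow> real) measure"
  assumes minlos: "minlos_gaussian c D A E P"
begin

sublocale P: prob_space P
  using minlos by (simp add: minlos_gaussian_def radon_prob_on_def)

lemma space_P: "space P = distributions c D A"
  using minlos
  by (auto simp: minlos_gaussian_def radon_prob_on_def weak_star_topology_def distributions_def
      extensional_def PiE_def)

lemma evaluation_measurable [measurable]: "(\<lambda>\<xi>. \<xi> s) \<in> borel_measurable P"
proof (cases "s \<in> S")
  case True
  let ?T = "weak_star_topology c D A"
  have T: "space P = topspace ?T" "sets P = sigma_sets (topspace ?T) {U. openin ?T U}"
    using minlos by (auto simp: minlos_gaussian_def radon_prob_on_def)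
  have cont: "continuous_map ?T euclideanreal (\<lambda>\<xi>. \<xi> s)"
    unfolding weak_star_topology_def using True
    by (intro continuous_map_from_subtopology continuous_map_product_projection)
  show ?thesis
  proof (rule borel_measurableI)
    fix V :: "real set" assume "open V"
    then have "openin ?T {\<xi> \<in> topspace ?T. \<xi> s \<in> V}"
      using openin_continuous_map_preimage[OF cont, of V] by simp
    moreover have "(\<lambda>\<xi>. \<xi> s) -` V \<inter> space P = {\<xi> \<in> topspace ?T. \<xi> s \<in> V}" by (auto simp: T)
    ultimately show "(\<lambda>\<xi>. \<xi> s) -` V \<inter> space P \<in> sets P" by (auto simp: T)
  qed
next
  case False
  then have "\<xi> s = undefined" if "\<xi> \<in> space P" for \<xi>
    using that by (auto simp: space_P distributions_def extensional_def)
  then have "(\<lambda>\<xi>. \<xi> s) \<in> borel_measurable P \<longleftrightarrow> (\<lambda>_. undefined :: real) \<in> borel_measurable P"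
    by (intro measurable_cong) auto
  then show ?thesis by simp
qed

lemma truncated_pairing_measurable [measurable]: "(\<lambda>\<xi>. truncated_pairing E u \<xi> n) \<in> borel_measurable P"
  unfolding truncated_pairing_def by measurable

lemma pairing_measurable [measurable]: "pairing E u \<in> borel_measurable P"
  unfolding pairing_def[abs_def] by measurable

text \<open>The characteristic function forces the spectrum into the open half-line: a test function that
  all cut-offs kill would pair to \<open>0\<close> with every distribution, although its characteristic
  function is that of a centred Gaussian variable of variance \<open>\<parallel>s\<parallel>\<^sup>2\<close>.\<close>

lemma E_positive_test:
  assumes s: "s \<in> S"
  shows "E {0<..} s = s"
proof -
  let ?r = "s - E {0<..} s"
  have r: "?r \<in> S" using s test_E_positive by (intro test_diff) auto
  have z: "E {0<..} ?r = 0" using s by (simp add: E_diff)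
  have "(CLINT \<xi>|P. exp (\<i> * complex_of_real (pairing E ?r \<xi>))) = (CLINT \<xi>|P. 1)"
    by (intro Bochner_Integration.integral_cong)
      (auto simp: space_P pairing_test[OF _ r] z distribution_0)
  also have "\<dots> = 1" by (simp add: P.prob_space)
  finally have "complex_of_real (exp (- (enorm c ?r)\<^sup>2 / 2)) = 1"
    using minlos r by (simp add: minlos_gaussian_def)
  then have "exp (- (enorm c ?r)\<^sup>2 / 2) = 1" by (simp only: of_real_eq_1_iff)
  then have "enorm c ?r = 0" by simp
  then have "?r = 0" using r by (intro enorm_eq_0) auto
  then show ?thesis by simp
qed

lemma E_positive:
  assumes u: "u \<in> H"
  shows "E {0<..} u = u"
proof -
  have real_case: "E {..0} v = 0" if v: "v \<in> H" "real_potential v" for v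
  proof -
    have "E {- real n..0} v = 0" for n
    proof -
      have "E {0<..} (E {- real n..0} v) = E {- real n..0} v"
        using v by (intro E_positive_test test_E_interval) auto
      moreover have "E {0<..} (E {- real n..0} v) = 0"
      proof -
        have "{0<..} \<inter> {- real n..0} = {}" by auto
        then show ?thesis using v by (simp add: E_inter)
      qed
      ultimately show ?thesis by simp
    qed
    then have "enorm c (E {..0} v) = 0"
      using E_incseq_tendsto[OF negative_intervals(1) _ v(1), unfolded negative_intervals(2)]
      by (simp add: LIMSEQ_const_iff)
    then show ?thesis using v by (intro enorm_eq_0) auto
  qed
  have "E {..0} u = E {..0} (pot_Re u) + cscale \<i> (E {..0} (pot_Im u))"
    using u pot_Re_Im[of u] E_add[of "{..0}" "pot_Re u" "cscale \<i> (pot_Im u)"] by (simp add: E_cscale)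
  then have "E {..0} u = 0" using u by (simp add: real_case)
  moreover have "- {0<..} = {..0 :: real}" by auto
  ultimately show ?thesis using E_Compl[of "{0<..}" u] u by simp
qed

lemma E_n_tendsto: "u \<in> H \<Longrightarrow> (\<lambda>n. enorm c (E {1 / real n..real n} u - u)) \<longlonglongrightarrow> 0"
  using E_positive_tendsto[of u] by (simp add: E_positive)

lemma evaluation_characteristic:
  assumes s: "s \<in> S"
  shows "(CLINT \<xi>|P. iexp (\<xi> s)) = complex_of_real (exp (- (enorm c s)\<^sup>2 / 2))"
proof -
  have "(CLINT \<xi>|P. iexp (\<xi> s)) = (CLINT \<xi>|P. exp (\<i> * complex_of_real (pairing E s \<xi>)))"
    by (intro Bochner_Integration.integral_cong) (auto simp: space_P pairing_test[OF _ s] E_positive_test[OF s])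
  then show ?thesis using minlos s by (simp add: minlos_gaussian_def)
qed

lemma evaluation_second_moment:
  assumes s: "s \<in> S"
  shows "integrable P (\<lambda>\<xi>. (\<xi> s)\<^sup>2)" "(\<integral>\<xi>. (\<xi> s)\<^sup>2 \<partial>P) = (enorm c s)\<^sup>2"
proof -
  have "(CLINT \<xi>|P. iexp (t * \<xi> s)) = complex_of_real (exp (- (t * enorm c s)\<^sup>2 / 2))" for t
  proof -
    have "(CLINT \<xi>|P. iexp (t * \<xi> s)) = (CLINT \<xi>|P. iexp (\<xi> (cscale (complex_of_real t) s)))"
      by (intro Bochner_Integration.integral_cong) (auto simp: space_P distribution_cscale[OF _ s])
    then show ?thesis
      using evaluation_characteristic[OF test_cscale[OF s, of t]] by (simp add: power_mult_distrib)
  qed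
  from P.gaussian_of_characteristic_function(2,3)[OF evaluation_measurable enorm_nonneg this]
  show "integrable P (\<lambda>\<xi>. (\<xi> s)\<^sup>2)" "(\<integral>\<xi>. (\<xi> s)\<^sup>2 \<partial>P) = (enorm c s)\<^sup>2" .
qed

text \<open>Orthogonal test functions are evaluated independently; for characteristic functions this is the
  theorem of Pythagoras.\<close>

lemma orthogonal_characteristic:
  assumes y: "y \<in> S" and x: "\<And>j. j < k \<Longrightarrow> x j \<in> S" and orth: "\<And>j. j < k \<Longrightarrow> energy c y (x j) = 0"
  shows "(CLINT \<xi>|P. iexp (s * \<xi> y) * iexp (\<Sum>j<k. t j * \<xi> (x j))) =
    (CLINT \<xi>|P. iexp (s * \<xi> y)) * (CLINT \<xi>|P. iexp (\<Sum>j<k. t j * \<xi> (x j)))"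
proof -
  define v where "v = cscale (complex_of_real s) y"
  define w where "w = (\<Sum>j<k. cscale (complex_of_real (t j)) (x j))"
  have vS: "v \<in> S" and wS: "w \<in> S" using x y by (auto simp: v_def w_def intro!: test_cscale test_sum)
  have \<xi>v: "\<xi> v = s * \<xi> y" if "\<xi> \<in> space P" for \<xi>
    using that y by (simp add: v_def space_P distribution_cscale)
  have \<xi>w: "\<xi> w = (\<Sum>j<k. t j * \<xi> (x j))" if "\<xi> \<in> space P" for \<xi>
  proof -
    have "\<xi> w = (\<Sum>j<k. \<xi> (cscale (complex_of_real (t j)) (x j)))"
      unfolding w_def using that x by (intro distribution_sum) (auto simp: space_P intro: test_cscale)
    also have "\<dots> = (\<Sum>j<k. t j * \<xi> (x j))"
      using that x by (intro sum.cong) (auto simp: space_P distribution_cscale)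
    finally show ?thesis .
  qed
  have "energy c v w = (\<Sum>j<k. energy c v (cscale (complex_of_real (t j)) (x j)))"
    unfolding w_def using x vS by (intro energy_sum_right) auto
  also have "\<dots> = 0" using orth by (intro sum.neutral) (auto simp: v_def)
  finally have pyth: "(enorm c (v + w))\<^sup>2 = (enorm c v)\<^sup>2 + (enorm c w)\<^sup>2"
    using vS wS by (simp add: enorm_add_square)
  have "(CLINT \<xi>|P. iexp (s * \<xi> y) * iexp (\<Sum>j<k. t j * \<xi> (x j))) = (CLINT \<xi>|P. iexp (\<xi> (v + w)))"
    using vS wS
    by (intro Bochner_Integration.integral_cong refl)
      (simp add: \<xi>v[symmetric] \<xi>w[symmetric] space_P distribution_add exp_add distrib_left del: of_real_mult of_real_sum)
  also have "\<dots> = complex_of_real (exp (- (enorm c v)\<^sup>2 / 2)) * complex_of_real (exp (- (enorm c w)\<^sup>2 / 2))"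
    using evaluation_characteristic[OF test_add[OF vS wS]]
    by (simp add: pyth add_divide_distrib diff_divide_distrib exp_add[symmetric] flip: of_real_mult)
  also have "\<dots> = (CLINT \<xi>|P. iexp (\<xi> v)) * (CLINT \<xi>|P. iexp (\<xi> w))"
    by (simp add: evaluation_characteristic vS wS)
  also have "(CLINT \<xi>|P. iexp (\<xi> v)) = (CLINT \<xi>|P. iexp (s * \<xi> y))"
    by (intro Bochner_Integration.integral_cong) (auto simp: \<xi>v)
  also have "(CLINT \<xi>|P. iexp (\<xi> w)) = (CLINT \<xi>|P. iexp (\<Sum>j<k. t j * \<xi> (x j)))"
    by (intro Bochner_Integration.integral_cong) (auto simp: \<xi>w)
  finally show ?thesis .
qed

text \<open>The cut-offs of \<open>u\<close> have orthogonal increments, hence give a sequence of random variables with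
  independent increments, which is Cauchy in mean square.\<close>

lemma truncated_pairing_convergent:
  assumes u: "u \<in> H" "real_potential u"
  shows "AE \<xi> in P. convergent (truncated_pairing E u \<xi>)"
proof -
  \<comment> \<open>The shift of the index leaves out the cut-off for \<open>n = 0\<close>, which is to \<open>{0}\<close> as \<open>1 / 0 = 0\<close>
    and does not fit into the increasing family.\<close>
  define J where "J n = {1 / real (Suc n)..real (Suc n)}" for n
  define e where "e n = E (J n) u" for n
  have Jb: "J n \<in> sets borel" for n by (simp add: J_def)
  have Jmin: "J m \<inter> J n = J (min m n)" for m n
    using positive_intervals(1) unfolding incseq_def J_def[symmetric] by (metis inf.absorb1 inf.absorb2 inf_commute min_def nle_le)
  have eS: "e n \<in> S" for n
    unfolding e_def J_def using u by (intro test_E_interval) (auto simp: field_simps)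
  have inner: "energy c (e m) (e n) = energy c u (e (min m n))" for m n
    using u Jb by (simp add: e_def E_sym E_inter Jmin)
  have X: "truncated_pairing E u \<xi> (Suc n) = \<xi> (e n)" for \<xi> n
    by (simp add: truncated_pairing_def e_def J_def)
  have eH: "e n \<in> H" for n using eS test_H by blast
  have "AE \<xi> in P. convergent (\<lambda>n. \<xi> (e n))"
  proof (rule P.independent_increments_AE_convergent)
    fix N n k :: nat and s :: real and t :: "nat \<Rightarrow> real"
    assume kn: "k \<le> n"
    have eq: "\<xi> (e (N + n)) - \<xi> (e (N + k)) = \<xi> (e (N + n) - e (N + k))"
      "\<xi> (e (N + j)) - \<xi> (e N) = \<xi> (e (N + j) - e N)" if "\<xi> \<in> space P" for \<xi> j
      using that eS by (simp_all add: space_P distribution_diff)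
    have orth: "energy c (e (N + n) - e (N + k)) (e (N + j) - e N) = 0" if "j < Suc k" for j
    proof -
      have "min (N + n) (N + j) = N + j" "min (N + k) (N + j) = N + j" "min (N + n) N = N" "min (N + k) N = N"
        using that kn by auto
      then show ?thesis using eH by (simp add: energy_diff_left energy_diff_right inner)
    qed
    have "(CLINT \<xi>|P. iexp (s * \<xi> (e (N + n) - e (N + k))) * iexp (\<Sum>j<Suc k. t j * \<xi> (e (N + j) - e N))) =
      (CLINT \<xi>|P. iexp (s * \<xi> (e (N + n) - e (N + k)))) * (CLINT \<xi>|P. iexp (\<Sum>j<Suc k. t j * \<xi> (e (N + j) - e N)))"
      using eS orth by (intro orthogonal_characteristic test_diff) auto
    then show "(CLINT \<xi>|P. iexp (s * (\<xi> (e (N + n)) - \<xi> (e (N + k)))) * iexp (\<Sum>j<Suc k. t j * (\<xi> (e (N + j)) - \<xi> (e N)))) =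
      (CLINT \<xi>|P. iexp (s * (\<xi> (e (N + n)) - \<xi> (e (N + k))))) * (CLINT \<xi>|P. iexp (\<Sum>j<Suc k. t j * (\<xi> (e (N + j)) - \<xi> (e N))))"
      by (simp only: eq cong: Bochner_Integration.integral_cong)
  next
    fix a \<epsilon> :: real assume a: "0 < a" and \<epsilon>: "0 < \<epsilon>"
    have "(\<lambda>n. enorm c (e n - u)) \<longlonglongrightarrow> 0"
      using LIMSEQ_Suc[OF E_n_tendsto[OF u(1)]] by (simp add: e_def J_def)
    moreover have "0 < a * sqrt \<epsilon> / 2" using a \<epsilon> by simp
    ultimately obtain N where N: "\<And>n. N \<le> n \<Longrightarrow> enorm c (e n - u) < a * sqrt \<epsilon> / 2"
      unfolding LIMSEQ_iff by (metis abs_of_nonneg diff_zero enorm_nonneg real_norm_def)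
    show "\<exists>N. \<forall>m\<ge>N. \<forall>n\<ge>m. P.prob {\<xi> \<in> space P. a < \<bar>\<xi> (e n) - \<xi> (e m)\<bar>} \<le> \<epsilon>"
    proof (intro exI allI impI)
      fix m n assume mn: "N \<le> m" "m \<le> n"
      let ?d = "e n - e m"
      have dS: "?d \<in> S" using eS by (intro test_diff)
      have d: "\<xi> (e n) - \<xi> (e m) = \<xi> ?d" if "\<xi> \<in> space P" for \<xi>
        using that eS by (simp add: space_P distribution_diff)
      have "enorm c ?d \<le> enorm c (e n - u) + enorm c (u - e m)"
        using u eH by (intro enorm_triangle_diff) auto
      also have "\<dots> \<le> a * sqrt \<epsilon>"
        using N[of n] N[of m] mn by (simp add: enorm_minus_commute[of u])
      finally have "(enorm c ?d)\<^sup>2 \<le> (a * sqrt \<epsilon>)\<^sup>2" by (intro power_mono) auto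
      then have small: "(enorm c ?d)\<^sup>2 / a\<^sup>2 \<le> \<epsilon>" using a \<epsilon> by (simp add: power_mult_distrib field_simps)
      have "P.prob {\<xi> \<in> space P. a < \<bar>\<xi> (e n) - \<xi> (e m)\<bar>} \<le> P.prob {\<xi> \<in> space P. a \<le> \<bar>\<xi> ?d\<bar>}"
        using d by (intro P.finite_measure_mono) auto
      also have "\<dots> \<le> (\<integral>\<xi>. (\<xi> ?d)\<^sup>2 \<partial>P) / a\<^sup>2"
        using a evaluation_second_moment[OF dS] by (intro P.second_moment_method) auto
      also have "\<dots> \<le> \<epsilon>" using small evaluation_second_moment[OF dS] by simp
      finally show "P.prob {\<xi> \<in> space P. a < \<bar>\<xi> (e n) - \<xi> (e m)\<bar>} \<le> \<epsilon>" .
    qed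
  qed simp
  then show ?thesis
  proof eventually_elim
    case (elim \<xi>)
    then have "convergent (\<lambda>n. truncated_pairing E u \<xi> (Suc n))" by (simp add: X)
    then show ?case by (simp add: convergent_Suc_iff)
  qed
qed

lemma pairing_limit:
  assumes "u \<in> H" "real_potential u"
  shows "AE \<xi> in P. truncated_pairing E u \<xi> \<longlonglongrightarrow> pairing E u \<xi>"
  using truncated_pairing_convergent[OF assms]
  by eventually_elim (simp add: pairing_def convergent_LIMSEQ_iff)

lemma pairing_characteristic:
  assumes u: "u \<in> H" "real_potential u"
  shows "(CLINT \<xi>|P. iexp (t * pairing E u \<xi>)) = complex_of_real (exp (- (t * enorm c u)\<^sup>2 / 2))"
proof (rule LIMSEQ_unique)
  let ?e = "\<lambda>n. E {1 / real n..real n} u"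
  have eS: "?e n \<in> S" for n using u by (rule test_E_n)
  have "(CLINT \<xi>|P. iexp (t * truncated_pairing E u \<xi> n)) =
      complex_of_real (exp (- (t * enorm c (?e n))\<^sup>2 / 2))" for n
  proof -
    have "(CLINT \<xi>|P. iexp (t * truncated_pairing E u \<xi> n)) =
        (CLINT \<xi>|P. iexp (\<xi> (cscale (complex_of_real t) (?e n))))"
      using eS by (intro Bochner_Integration.integral_cong)
        (auto simp: space_P distribution_cscale truncated_pairing_def)
    then show ?thesis
      using evaluation_characteristic[OF test_cscale[OF eS[of n], of t]] by (simp add: power_mult_distrib)
  qed
  moreover have "(\<lambda>n. enorm c (?e n)) \<longlonglongrightarrow> enorm c u"
    using u E_n_tendsto[OF u(1)] by (intro enorm_tendsto) auto
  then have "(\<lambda>n. complex_of_real (exp (- (t * enorm c (?e n))\<^sup>2 / 2))) \<longlonglongrightarrow>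
      complex_of_real (exp (- (t * enorm c u)\<^sup>2 / 2))"
    by (intro tendsto_intros) auto
  ultimately show "(\<lambda>n. CLINT \<xi>|P. iexp (t * truncated_pairing E u \<xi> n)) \<longlonglongrightarrow>
      complex_of_real (exp (- (t * enorm c u)\<^sup>2 / 2))" by simp
  show "(\<lambda>n. CLINT \<xi>|P. iexp (t * truncated_pairing E u \<xi> n)) \<longlonglongrightarrow> (CLINT \<xi>|P. iexp (t * pairing E u \<xi>))"
  proof (rule integral_dominated_convergence[where w = "\<lambda>_. 1"])
    show "AE \<xi> in P. (\<lambda>n. iexp (t * truncated_pairing E u \<xi> n)) \<longlonglongrightarrow> iexp (t * pairing E u \<xi>)"
      using pairing_limit[OF u] by eventually_elim (intro tendsto_intros)
  qed auto
qed

lemmas pairing_gaussian =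
  P.gaussian_of_characteristic_function[OF pairing_measurable enorm_nonneg pairing_characteristic]

lemma pairing_add:
  assumes u: "u \<in> H" "real_potential u" and v: "v \<in> H" "real_potential v"
  shows "AE \<xi> in P. pairing E (u + v) \<xi> = pairing E u \<xi> + pairing E v \<xi>"
  using pairing_limit[OF u] pairing_limit[OF v] AE_space
proof eventually_elim
  case (elim \<xi>)
  have "truncated_pairing E (u + v) \<xi> = (\<lambda>n. truncated_pairing E u \<xi> n + truncated_pairing E v \<xi> n)"
  proof
    fix n
    have "E {1 / real n..real n} w \<in> S" if "w \<in> H" "real_potential w" for w
      using that by (rule test_E_n)
    then show "truncated_pairing E (u + v) \<xi> n = truncated_pairing E u \<xi> n + truncated_pairing E v \<xi> n"
      using u v elim(3) by (simp add: truncated_pairing_def E_add distribution_add space_P)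
  qed
  then have "truncated_pairing E (u + v) \<xi> \<longlonglongrightarrow> pairing E u \<xi> + pairing E v \<xi>"
    using tendsto_add[OF elim(1,2)] by simp
  then show ?case by (simp add: pairing_def limI)
qed

lemma pairing_cscale:
  assumes u: "u \<in> H" "real_potential u"
  shows "AE \<xi> in P. pairing E (cscale (complex_of_real a) u) \<xi> = a * pairing E u \<xi>"
  using pairing_limit[OF u] AE_space
proof eventually_elim
  case (elim \<xi>)
  have "truncated_pairing E (cscale (complex_of_real a) u) \<xi> = (\<lambda>n. a * truncated_pairing E u \<xi> n)"
  proof
    fix n
    have "E {1 / real n..real n} u \<in> S" using u by (rule test_E_n)
    then show "truncated_pairing E (cscale (complex_of_real a) u) \<xi> n = a * truncated_pairing E u \<xi> n"
      using u elim(2) by (simp add: truncated_pairing_def E_cscale distribution_cscale space_P)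
  qed
  then have "truncated_pairing E (cscale (complex_of_real a) u) \<xi> \<longlonglongrightarrow> a * pairing E u \<xi>"
    using tendsto_mult_left[OF elim(1), of a] by simp
  then show ?case by (simp add: pairing_def limI)
qed

lemma pairing_0: "\<xi> \<in> space P \<Longrightarrow> pairing E 0 \<xi> = 0"
  by (simp add: pairing_def truncated_pairing_def[abs_def] space_P distribution_0 limI)

lemma pairing_sum:
  assumes "finite F" "\<And>i. i \<in> F \<Longrightarrow> f i \<in> H \<and> real_potential (f i)"
  shows "AE \<xi> in P. pairing E (\<Sum>i\<in>F. cscale (complex_of_real (a i)) (f i)) \<xi> = (\<Sum>i\<in>F. a i * pairing E (f i) \<xi>)"
  using assms
proof (induction F rule: finite_induct)
  case empty
  show ?case using AE_space by eventually_elim (simp add: pairing_0)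
next
  case (insert x F)
  let ?s = "\<Sum>i\<in>F. cscale (complex_of_real (a i)) (f i)"
  have fx: "f x \<in> H" "real_potential (f x)" using insert.prems by auto
  have s: "?s \<in> H" using insert.prems by (intro H_sum) auto
  have sr: "real_potential ?s" using insert.hyps(1) insert.prems
    by (induction F rule: finite_induct) (auto intro: real_potential_add real_potential_cscale)
  have "AE \<xi> in P. pairing E (cscale (complex_of_real (a x)) (f x) + ?s) \<xi> =
      pairing E (cscale (complex_of_real (a x)) (f x)) \<xi> + pairing E ?s \<xi>"
    using fx s sr by (intro pairing_add real_potential_cscale) auto
  moreover have "AE \<xi> in P. pairing E ?s \<xi> = (\<Sum>i\<in>F. a i * pairing E (f i) \<xi>)"
    using insert.prems by (intro insert.IH) auto
  ultimately show ?case using pairing_cscale[OF fx, of "a x"]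
    by eventually_elim (simp add: insert.hyps)
qed

lemma pairing_product_integrable:
  assumes u: "u \<in> H" "real_potential u" and v: "v \<in> H" "real_potential v"
  shows "integrable P (\<lambda>\<xi>. pairing E u \<xi> * pairing E v \<xi>)"
proof (rule Bochner_Integration.integrable_bound)
  show "integrable P (\<lambda>\<xi>. (pairing E u \<xi>)\<^sup>2 + (pairing E v \<xi>)\<^sup>2)"
    using pairing_gaussian(2)[OF u] pairing_gaussian(2)[OF v] by simp
  have "\<bar>x * y\<bar> \<le> \<bar>x\<^sup>2 + y\<^sup>2\<bar>" for x y :: real
  proof -
    have "0 \<le> \<bar>x\<bar> * \<bar>y\<bar>" by simp
    then have "\<bar>x\<bar> * \<bar>y\<bar> \<le> x\<^sup>2 + y\<^sup>2"
      using sum_squares_bound[of "\<bar>x\<bar>" "\<bar>y\<bar>"] unfolding power2_abs by linarith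
    then show ?thesis by (simp add: abs_mult)
  qed
  then show "AE \<xi> in P. norm (pairing E u \<xi> * pairing E v \<xi>) \<le> norm ((pairing E u \<xi>)\<^sup>2 + (pairing E v \<xi>)\<^sup>2)"
    by simp
qed measurable

lemma pairing_covariance:
  assumes u: "u \<in> H" "real_potential u" and v: "v \<in> H" "real_potential v"
  shows "complex_of_real (\<integral>\<xi>. pairing E u \<xi> * pairing E v \<xi> \<partial>P) = energy c u v"
proof -
  have uv: "u + v \<in> H" "real_potential (u + v)" using u v by (auto intro: real_potential_add)
  have "(enorm c (u + v))\<^sup>2 = (\<integral>\<xi>. (pairing E (u + v) \<xi>)\<^sup>2 \<partial>P)" using pairing_gaussian(3)[OF uv] by simp
  also have "\<dots> = (\<integral>\<xi>. (pairing E u \<xi>)\<^sup>2 + 2 * (pairing E u \<xi> * pairing E v \<xi>) + (pairing E v \<xi>)\<^sup>2 \<partial>P)"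
  proof (rule integral_cong_AE)
    show "AE \<xi> in P. (pairing E (u + v) \<xi>)\<^sup>2 =
        (pairing E u \<xi>)\<^sup>2 + 2 * (pairing E u \<xi> * pairing E v \<xi>) + (pairing E v \<xi>)\<^sup>2"
      using pairing_add[OF u v] by eventually_elim (simp add: power2_sum)
  qed measurable
  also have "\<dots> = (enorm c u)\<^sup>2 + 2 * (\<integral>\<xi>. pairing E u \<xi> * pairing E v \<xi> \<partial>P) + (enorm c v)\<^sup>2"
    using pairing_gaussian(2,3)[OF u] pairing_gaussian(2,3)[OF v] pairing_product_integrable[OF u v] by simp
  finally have "(\<integral>\<xi>. pairing E u \<xi> * pairing E v \<xi> \<partial>P) = Re (energy c u v)"
    using u v by (simp add: enorm_add_square)
  then show ?thesis using energy_real[OF u(2) v(2)] by simp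
qed

section \<open>The Wiener transform\<close>

lemma wiener_measurable [measurable]: "wiener E u \<in> borel_measurable P"
  unfolding wiener_def[abs_def] by measurable

lemma wiener_real:
  assumes "real_potential u" "\<xi> \<in> space P"
  shows "wiener E u \<xi> = complex_of_real (pairing E u \<xi>)"
  using assms by (simp add: wiener_def pot_Re_real pot_Im_real pairing_0)

lemma wiener_product:
  assumes u: "u \<in> H" and v: "v \<in> H"
  shows "energy c u v = (CLINT \<xi>|P. cnj (wiener E u \<xi>) * wiener E v \<xi>)"
proof -
  let ?p = "\<lambda>u v \<xi>. pairing E u \<xi> * pairing E v \<xi>"
  let ?a = "pot_Re u" and ?b = "pot_Im u" and ?c = "pot_Re v" and ?d = "pot_Im v"
  have int: "integrable P (?p x y)" if "x \<in> {?a, ?b}" "y \<in> {?c, ?d}" for x y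
    using that u v by (intro pairing_product_integrable) auto
  have "(CLINT \<xi>|P. cnj (wiener E u \<xi>) * wiener E v \<xi>) =
      (CLINT \<xi>|P. complex_of_real (?p ?a ?c \<xi> + ?p ?b ?d \<xi>) + \<i> * complex_of_real (?p ?a ?d \<xi> - ?p ?b ?c \<xi>))"
    by (intro Bochner_Integration.integral_cong) (auto simp: wiener_def complex_eq_iff)
  also have "\<dots> = (CLINT \<xi>|P. complex_of_real (?p ?a ?c \<xi> + ?p ?b ?d \<xi>)) +
      (CLINT \<xi>|P. \<i> * complex_of_real (?p ?a ?d \<xi> - ?p ?b ?c \<xi>))"
    using int by (intro Bochner_Integration.integral_add integrable_mult_right integrable_of_real
        Bochner_Integration.integrable_add Bochner_Integration.integrable_diff) auto
  also have "\<dots> = complex_of_real (\<integral>\<xi>. ?p ?a ?c \<xi> + ?p ?b ?d \<xi> \<partial>P) +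
      \<i> * complex_of_real (\<integral>\<xi>. ?p ?a ?d \<xi> - ?p ?b ?c \<xi> \<partial>P)"
    by (simp only: integral_complex_of_real integral_mult_right_zero)
  also have "\<dots> = (energy c ?a ?c + energy c ?b ?d) + \<i> * (energy c ?a ?d - energy c ?b ?c)"
    using int u v by (simp add: pairing_covariance[symmetric])
  also have "\<dots> = energy c (?a + cscale \<i> ?b) (?c + cscale \<i> ?d)"
    using u v by (simp add: energy_add_left energy_add_right algebra_simps)
  finally show ?thesis by (simp flip: pot_Re_Im)
qed

lemma wiener_square:
  assumes u: "u \<in> H"
  shows "integrable P (\<lambda>\<xi>. (cmod (wiener E u \<xi>))\<^sup>2)" "(\<integral>\<xi>. (cmod (wiener E u \<xi>))\<^sup>2 \<partial>P) = (enorm c u)\<^sup>2"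
proof -
  have eq: "(cmod (wiener E u \<xi>))\<^sup>2 = (pairing E (pot_Re u) \<xi>)\<^sup>2 + (pairing E (pot_Im u) \<xi>)\<^sup>2" for \<xi>
    by (simp add: cmod_power2 wiener_def)
  show "integrable P (\<lambda>\<xi>. (cmod (wiener E u \<xi>))\<^sup>2)"
    unfolding eq using u by (intro Bochner_Integration.integrable_add pairing_gaussian(2)) auto
  have "complex_of_real (\<integral>\<xi>. (cmod (wiener E u \<xi>))\<^sup>2 \<partial>P) = (CLINT \<xi>|P. cnj (wiener E u \<xi>) * wiener E u \<xi>)"
    unfolding integral_complex_of_real[symmetric]
    by (intro Bochner_Integration.integral_cong refl) (simp only: complex_norm_square mult.commute)
  then have "complex_of_real (\<integral>\<xi>. (cmod (wiener E u \<xi>))\<^sup>2 \<partial>P) = complex_of_real ((enorm c u)\<^sup>2)"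
    using wiener_product[OF u u] energy_self[of u] by simp
  then show "(\<integral>\<xi>. (cmod (wiener E u \<xi>))\<^sup>2 \<partial>P) = (enorm c u)\<^sup>2" by (simp only: of_real_eq_iff)
qed

lemma wiener_add:
  assumes u: "u \<in> H" and v: "v \<in> H"
  shows "AE \<xi> in P. wiener E (u + v) \<xi> = wiener E u \<xi> + wiener E v \<xi>"
proof -
  have "pot_Re (u + v) = pot_Re u + pot_Re v" "pot_Im (u + v) = pot_Im u + pot_Im v"
    by (rule potential_eqI'; simp)+
  then have "AE \<xi> in P. pairing E (pot_Re (u + v)) \<xi> = pairing E (pot_Re u) \<xi> + pairing E (pot_Re v) \<xi>"
    "AE \<xi> in P. pairing E (pot_Im (u + v)) \<xi> = pairing E (pot_Im u) \<xi> + pairing E (pot_Im v) \<xi>"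
    using u v by (simp_all add: pairing_add)
  then show ?thesis by eventually_elim (simp add: wiener_def algebra_simps)
qed

lemma wiener_cscale:
  assumes u: "u \<in> H"
  shows "AE \<xi> in P. wiener E (cscale a u) \<xi> = a * wiener E u \<xi>"
proof -
  have comb: "AE \<xi> in P. pairing E (cscale (complex_of_real r) (pot_Re u) + cscale (complex_of_real s) (pot_Im u)) \<xi> =
      r * pairing E (pot_Re u) \<xi> + s * pairing E (pot_Im u) \<xi>" for r s
  proof -
    have "AE \<xi> in P. pairing E (cscale (complex_of_real r) (pot_Re u) + cscale (complex_of_real s) (pot_Im u)) \<xi> =
        pairing E (cscale (complex_of_real r) (pot_Re u)) \<xi> + pairing E (cscale (complex_of_real s) (pot_Im u)) \<xi>"
      using u by (intro pairing_add real_potential_cscale) auto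
    moreover have "AE \<xi> in P. pairing E (cscale (complex_of_real r) (pot_Re u)) \<xi> = r * pairing E (pot_Re u) \<xi>"
      "AE \<xi> in P. pairing E (cscale (complex_of_real s) (pot_Im u)) \<xi> = s * pairing E (pot_Im u) \<xi>"
      using u by (intro pairing_cscale; simp)+
    ultimately show ?thesis by eventually_elim simp
  qed
  have "pot_Re (cscale a u) = cscale (complex_of_real (Re a)) (pot_Re u) + cscale (complex_of_real (- Im a)) (pot_Im u)"
    "pot_Im (cscale a u) = cscale (complex_of_real (Im a)) (pot_Re u) + cscale (complex_of_real (Re a)) (pot_Im u)"
    by (rule potential_eqI'; simp)+
  with comb[of "Re a" "- Im a"] comb[of "Im a" "Re a"]
  have "AE \<xi> in P. pairing E (pot_Re (cscale a u)) \<xi> = Re a * pairing E (pot_Re u) \<xi> - Im a * pairing E (pot_Im u) \<xi>"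
    "AE \<xi> in P. pairing E (pot_Im (cscale a u)) \<xi> = Im a * pairing E (pot_Re u) \<xi> + Re a * pairing E (pot_Im u) \<xi>"
    by simp_all
  then show ?thesis by eventually_elim (simp add: wiener_def complex_eq_iff)
qed

lemma wiener_isometry: "L2_isometry c P (wiener E)"
  unfolding L2_isometry_def square_integrable_def
  using wiener_add wiener_cscale by (auto simp: wiener_square)

lemma wiener_gaussian_system:
  fixes f :: "'i \<Rightarrow> 'v potential"
  assumes "\<And>i. f i \<in> H" "\<And>i. real_potential (f i)"
  shows "gaussian_system P (\<lambda>i \<xi>. Re (wiener E (f i) \<xi>))"
  unfolding gaussian_system_def gaussian_rv_def
proof (intro allI impI conjI)
  fix F :: "'i set" and a :: "'i \<Rightarrow> real" assume F: "finite F"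
  let ?X = "\<lambda>\<xi>. \<Sum>i\<in>F. a i * Re (wiener E (f i) \<xi>)"
  let ?s = "\<Sum>i\<in>F. cscale (complex_of_real (a i)) (f i)"
  show X: "?X \<in> borel_measurable P" by measurable
  have s: "?s \<in> H" "real_potential ?s"
  proof -
    show "?s \<in> H" using assms by (intro H_sum) auto
    show "real_potential ?s" using F
      by (induction F rule: finite_induct) (auto intro: real_potential_add real_potential_cscale assms)
  qed
  have "AE \<xi> in P. pairing E ?s \<xi> = (\<Sum>i\<in>F. a i * pairing E (f i) \<xi>)"
    using F assms by (intro pairing_sum) auto
  then have "AE \<xi> in P. ?X \<xi> = pairing E ?s \<xi>"
    using AE_space by eventually_elim (simp add: wiener_real assms)
  then have "distr P borel ?X = distr P borel (pairing E ?s)"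
    using X by (intro distr_cong_AE) auto
  then show "\<exists>\<mu> \<sigma>. 0 \<le> \<sigma> \<and> distr P borel ?X =
      (if \<sigma> = 0 then return borel \<mu> else density lborel (\<lambda>x. ennreal (normal_density \<mu> \<sigma> x)))"
    using pairing_gaussian(1)[OF s] by (intro exI[of _ 0] exI[of _ "enorm c ?s"]) simp
qed

lemma wiener_difference_square:
  assumes u: "u \<in> H" "real_potential u" and v: "v \<in> H" "real_potential v"
  shows "(CLINT \<xi>|P. (wiener E u \<xi> - wiener E v \<xi>)\<^sup>2) = complex_of_real ((enorm c (u - v))\<^sup>2)"
proof -
  have uv: "u - v \<in> H" "real_potential (u - v)" using u v by (auto intro: real_potential_diff)
  have "AE \<xi> in P. pairing E u \<xi> = pairing E (u - v) \<xi> + pairing E v \<xi>"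
    using pairing_add[OF uv v] by simp
  then have "AE \<xi> in P. (wiener E u \<xi> - wiener E v \<xi>)\<^sup>2 = complex_of_real ((pairing E (u - v) \<xi>)\<^sup>2)"
    using AE_space by eventually_elim (simp add: wiener_real u v)
  then have "(CLINT \<xi>|P. (wiener E u \<xi> - wiener E v \<xi>)\<^sup>2) = (CLINT \<xi>|P. complex_of_real ((pairing E (u - v) \<xi>)\<^sup>2))"
    by (intro integral_cong_AE) measurable
  then show ?thesis using pairing_gaussian(3)[OF uv] by (simp only: integral_complex_of_real)
qed

end

theorem theorem5p15:
  fixes c :: "'v \<Rightarrow> 'v \<Rightarrow> real" and b :: 'v
    and D\<^sub>S :: "'v potential set" and \<Delta>\<^sub>S :: "'v potential \<Rightarrow> 'v potential"
    and E :: "real set \<Rightarrow> 'v potential \<Rightarrow> 'v potential"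
    and P :: "('v potential \<Rightarrow> real) measure"
  assumes network: "resistance_network c"
    and self_adjoint: "self_adjoint c D\<^sub>S \<Delta>\<^sub>S"
    and extension: "closed_laplacian c b \<subseteq> op_graph D\<^sub>S \<Delta>\<^sub>S"
    and real_operator: "commutes_with_cnj D\<^sub>S \<Delta>\<^sub>S"
    and spectral: "spectral_measure_of c D\<^sub>S \<Delta>\<^sub>S E"
    and minlos: "minlos_gaussian c D\<^sub>S \<Delta>\<^sub>S E P"
  shows
    "(\<forall>u\<in>energy_space c. AE \<xi> in P.
        convergent (truncated_pairing E (pot_Re u) \<xi>) \<and>
        convergent (truncated_pairing E (pot_Im u) \<xi>)) \<and>
     L2_isometry c P (wiener E) \<and>
     (\<forall>x. \<forall>\<xi>\<in>space P. wiener E (energy_kernel c b x) \<xi> \<in> \<real>) \<and>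
     gaussian_system P (\<lambda>x \<xi>. Re (wiener E (energy_kernel c b x) \<xi>)) \<and>
     (\<forall>x y. complex_of_real (free_resistance c x y) =
        (CLINT \<xi>|P. (wiener E (energy_kernel c b x) \<xi> - wiener E (energy_kernel c b y) \<xi>)\<^sup>2)) \<and>
     (\<forall>u\<in>energy_space c. \<forall>v\<in>energy_space c.
        energy c u v = (CLINT \<xi>|P. cnj (wiener E u \<xi>) * wiener E v \<xi>))"
proof -
  interpret gaussian_field c D\<^sub>S \<Delta>\<^sub>S E P
    using network self_adjoint real_operator spectral minlos by unfold_locales
  show ?thesis
  proof (intro conjI ballI allI)
    fix u assume "u \<in> energy_space c"
    then show "AE \<xi> in P. convergent (truncated_pairing E (pot_Re u) \<xi>) \<and>
        convergent (truncated_pairing E (pot_Im u) \<xi>)"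
      using truncated_pairing_convergent[of "pot_Re u"] truncated_pairing_convergent[of "pot_Im u"]
      by simp
  next
    show "L2_isometry c P (wiener E)" by (rule wiener_isometry)
  next
    fix x \<xi> assume "\<xi> \<in> space P"
    then show "wiener E (energy_kernel c b x) \<xi> \<in> \<real>" by (simp add: wiener_real energy_kernel_real)
  next
    show "gaussian_system P (\<lambda>x \<xi>. Re (wiener E (energy_kernel c b x) \<xi>))"
      by (intro wiener_gaussian_system) (simp_all add: energy_kernel_real)
  next
    fix x y
    show "complex_of_real (free_resistance c x y) =
        (CLINT \<xi>|P. (wiener E (energy_kernel c b x) \<xi> - wiener E (energy_kernel c b y) \<xi>)\<^sup>2)"
      unfolding free_resistance_energy_kernel[of x y b]
      by (rule wiener_difference_square[symmetric]) (simp_all add: energy_kernel_real)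
  next
    fix u v assume "u \<in> energy_space c" "v \<in> energy_space c"
    then show "energy c u v = (CLINT \<xi>|P. cnj (wiener E u \<xi>) * wiener E v \<xi>)" by (rule wiener_product)
  qed
qed

end
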